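(* Let $L_1, L_2 \subset \mathbb{R}^d$ be two convex bodies such that $L_2 \subset \operatorname{int} L_1$. Then the pair $(L_1, L_2)$ has at least one Santaló point. Moreover, let $d \ge 2$ and $\kappa_d = \sqrt{\frac{6}{(d+1)(d+2)}}$. If the Hilbert diameter of $L_2$ with respect to $L_1$ satisfies \[ \operatorname{diam}_{L_1}(L_2) < \log \frac{1+\kappa_d}{1-\kappa_d}, \] then the Santaló point of the pair $(L_1, L_2)$ is unique.
   Context: A convex body is a compact convex set with non-empty interior. For a convex body $L\subset\mathbb{R}^d$ and a point $y$, the polar dual of $L$ with respect to $y$ (with respect to the unit sphere centered at $y$) is $L^\circ_y = \{x \in \mathbb{R}^d \mid \langle x-y, z-y \rangle \ge -1 \ \forall z \in L\}$. A point $y \in \operatorname{int} L_1 \cap \operatorname{int} L_2$ is called a Santaló point of the pair $(L_1, L_2)$ if $(L_1)^\circ_y$ and $(L_2)^\circ_y$ have the same centroid, where the centroid of $K$ is $\frac{1}{\operatorname{vol}(K)} \int_K x\, dx$. For convex bodies $L_1 \supset L_2$ in $\mathbb{R}^d$, the Hilbert diameter of $L_2$ with respect to $L_1$ is \[ \operatorname{diam}_{L_1}(L_2) = \max_{p,q \in L_2} \tfrac12 \log |\operatorname{cr}(p,q;a,b)|, \] where $a,b \in \partial L_1$ are the points of $\partial L_1$ collinear with $p$ and $q$, and $\operatorname{cr}(p,q;a,b) = \frac{(p-a)(q-b)}{(p-b)(q-a)}$ (the value is $0$ for $p=q$). *)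

theory Defs
  imports "HOL-Analysis.Analysis"
begin

definition convex_body :: "'a::euclidean_space set \<Rightarrow> bool" where
  "convex_body K \<longleftrightarrow> compact K \<and> convex K \<and> interior K \<noteq> {}"

definition polar_dual :: "'a::euclidean_space \<Rightarrow> 'a set \<Rightarrow> 'a set" where
  "polar_dual y L = {x. \<forall>z\<in>L. (x - y) \<bullet> (z - y) \<ge> -1}"

definition centroid :: "'a::euclidean_space set \<Rightarrow> 'a" where
  "centroid K = (1 / measure lebesgue K) *\<^sub>R integral K (\<lambda>x. x)"

definition santalo_point :: "'a::euclidean_space set \<Rightarrow> 'a set \<Rightarrow> 'a \<Rightarrow> bool" where
  "santalo_point L1 L2 y \<longleftrightarrow>
     y \<in> interior L1 \<inter> interior L2 \<and> centroid (polar_dual y L1) = centroid (polar_dual y L2)"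

text \<open>For collinear points, the inner product of two difference vectors is the product of their
  signed lengths along the common line, so this is the signed cross-ratio on that line
  (see the lemma below).\<close>

definition cross_ratio :: "'a::euclidean_space \<Rightarrow> 'a \<Rightarrow> 'a \<Rightarrow> 'a \<Rightarrow> real" where
  "cross_ratio p q a b = ((p - a) \<bullet> (q - b)) / ((p - b) \<bullet> (q - a))"

lemma cross_ratio_on_line:
  fixes c u :: "'a::euclidean_space"
  assumes "u \<noteq> 0"
  shows "cross_ratio (c + p *\<^sub>R u) (c + q *\<^sub>R u) (c + a *\<^sub>R u) (c + b *\<^sub>R u) =
           ((p - a) * (q - b)) / ((p - b) * (q - a))"
  using assms by (simp add: cross_ratio_def mult.commute flip: scaleR_diff_left)

text \<open>Exchanging \<open>a\<close> and \<open>b\<close> inverts the cross-ratio, hence changes the sign of the logarithm.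
  Both labellings are admitted below, which does not affect the maximum: the nonnegative of the two
  values is the Hilbert distance. If \<open>L2\<close> is compact and contained in the interior of
  the convex body \<open>L1\<close>, then for \<open>p \<noteq> q\<close> the points \<open>a\<close> and \<open>b\<close> are determined up to this exchange,
  and the supremum is a maximum.\<close>

definition hilbert_diam :: "'a::euclidean_space set \<Rightarrow> 'a set \<Rightarrow> real" where
  "hilbert_diam L1 L2 = Sup {v. \<exists>p\<in>L2. \<exists>q\<in>L2. (p = q \<and> v = 0) \<or>
     (p \<noteq> q \<and> (\<exists>a\<in>frontier L1. \<exists>b\<in>frontier L1. a \<noteq> b \<and> collinear {p, q, a, b} \<and>
        v = 1/2 * ln \<bar>cross_ratio p q a b\<bar>))}"

definition kappa :: "nat \<Rightarrow> real" where
  "kappa d = sqrt (6 / ((real d + 1) * (real d + 2)))"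

end

theory Submission
  imports Defs "HOL-Probability.Distributions" "HOL-Real_Asymp.Real_Asymp"
begin

text \<open>
Translating the polar dual by \<open>- y\<close> gives \<open>P(L, y) = {u. \<forall>z\<in>L. u \<bullet> (y - z) \<le> 1}\<close>, whose
gauge is the support function \<open>x \<bullet> y + h(x)\<close> of \<open>y - L\<close>, where \<open>h\<close> does not depend on
\<open>y\<close>. Integrating over the dilates of \<open>P(L, y)\<close> shows that \<open>d! vol P(L, y)\<close> is the Laplace
transform \<open>W(L, y) = \<integral> exp (- x \<bullet> y - h(x)) dx\<close>, and moments of order \<open>j\<close> of \<open>P(L, y)\<close>
are, up to sign and the factor \<open>(d + j)!\<close>, the derivatives of order \<open>j\<close> of \<open>W\<close>. In particular
\<open>- \<nabla> log W(L, y)\<close> is \<open>d + 1\<close> times the centroid of \<open>P(L, y)\<close>, so the Santalo points of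
the pair are the critical points of \<open>log W(L2, y) - log W(L1, y)\<close> on the interior of \<open>L2\<close>.

Existence: \<open>W(L1, y)\<close> is continuous and positive on the compact set \<open>L2\<close>, whereas \<open>W(L2, y)\<close>
is lower semicontinuous and infinite off the interior of \<open>L2\<close>. Hence the quotient has a minimizer
in the interior of \<open>L2\<close> (\<open>ratio_minimizer_exists\<close>).

Uniqueness: restrict the difference of the logarithms to the line through two Santalo points with
direction \<open>v\<close>. At a critical point of the restriction the two polar bodies have the same mean in
direction \<open>v\<close>, and the second derivative is \<open>(d + 1) (d + 2)\<close> times the difference of their
variances in direction \<open>v\<close>. If the variance for \<open>L2\<close> always exceeds that for \<open>L1\<close>, every
critical point on the line is a strict local minimum, and two of them cannot occur. The
comparison of the variances rests on two sharp bounds for a convex body whose projection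
to the line is the interval \<open>[m - a, m + b]\<close> around its mean \<open>m\<close>:

  \<^item> the variance is at most \<open>a b / 3\<close>, with equality for cylinders (\<open>convex_second_moment_le\<close>);

  \<^item> the variance is at least \<open>2 a b / ((d + 1) (d + 2))\<close>, with equality for double cones
    with \<open>a = b\<close> (\<open>convex_second_moment_ge\<close>).

The endpoints of the projections are, up to sign, the reciprocals of the endpoints of the sections
of \<open>L1\<close> and \<open>L2\<close> by the line, so their cross-ratio is bounded by the Hilbert diameter. The
threshold is the one at which this bound forces \<open>a1 b1 < \<kappa>\<^sup>2 a2 b2\<close>
(\<open>product_lt_of_cross_ratio_lt\<close>), and \<open>\<kappa>\<^sup>2 / 3 = 2 / ((d + 1) (d + 2))\<close>.

The upper bound needs log-concavity of the marginals of a convex body, which is the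
Prekopa-Leindler inequality; the lower bound only uses that the body is star-shaped about a lowest
and about a highest point.
\<close>

section \<open>The Prekopa-Leindler inequality\<close>

text \<open>Take \<open>a\<close> almost maximal in \<open>A\<close> and \<open>b\<close> almost minimal in \<open>B\<close>. The half-size copies
\<open>(A + b) / 2\<close> and \<open>(a + B) / 2\<close> both lie in \<open>C\<close> and overlap only in an interval of small length.\<close>

lemma emeasure_midpoint_set_bounded:
  fixes A B C :: "real set"
  assumes [measurable]: "A \<in> sets borel" "B \<in> sets borel" "C \<in> sets borel"
    and "A \<noteq> {}" "B \<noteq> {}" "bdd_above A" "bdd_below B"
    and mid: "\<And>a b. a \<in> A \<Longrightarrow> b \<in> B \<Longrightarrow> (a + b) / 2 \<in> C"
  shows "emeasure lborel A + emeasure lborel B \<le> 2 * emeasure lborel C"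
proof (rule ennreal_le_epsilon)
  fix e :: real assume "0 < e"
  obtain a where a: "a \<in> A" "Sup A - e/2 < a"
    using less_cSupE[of "Sup A - e/2" A] \<open>0 < e\<close> \<open>A \<noteq> {}\<close> by auto
  obtain b where b: "b \<in> B" "b < Inf B + e/2"
    using cInf_lessD[of B "Inf B + e/2"] \<open>0 < e\<close> \<open>B \<noteq> {}\<close> by auto
  define A' where "A' = {z. - b + 2 * z \<in> A}"
  define B' where "B' = {z. - a + 2 * z \<in> B}"
  have [measurable]: "A' \<in> sets borel" "B' \<in> sets borel"
    unfolding A'_def B'_def by measurable
  have A': "emeasure lborel A = 2 * emeasure lborel A'"
    using nn_integral_real_affine[of "indicator A" 2 "- b"]
    by (simp add: A'_def indicator_def[abs_def] nn_integral_indicator[symmetric] del: nn_integral_indicator)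
  have B': "emeasure lborel B = 2 * emeasure lborel B'"
    using nn_integral_real_affine[of "indicator B" 2 "- a"]
    by (simp add: B'_def indicator_def[abs_def] nn_integral_indicator[symmetric] del: nn_integral_indicator)
  have sub: "A' \<union> B' \<subseteq> C"
    using mid[OF _ b(1)] mid[OF a(1)] unfolding A'_def B'_def by fastforce
  have "A' \<inter> B' \<subseteq> {(a + Inf B)/2 .. (Sup A + b)/2}"
    using cSup_upper[OF _ \<open>bdd_above A\<close>] cInf_lower[OF _ \<open>bdd_below B\<close>]
    unfolding A'_def B'_def by fastforce
  then have "emeasure lborel (A' \<inter> B') \<le> emeasure lborel {(a + Inf B)/2 .. (Sup A + b)/2}"
    by (intro emeasure_mono) auto
  also have "\<dots> \<le> ennreal (e/2)"
    using a b \<open>0 < e\<close> by (auto simp: emeasure_lborel_Icc_eq add_divide_distrib intro!: ennreal_leI)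
  finally have cap: "emeasure lborel (A' \<inter> B') \<le> ennreal (e/2)" .
  have "emeasure lborel A' + emeasure lborel B' = emeasure lborel (A' \<union> B') + emeasure lborel (A' \<inter> B')"
    using emeasure_Un_Int[of A' lborel B'] by simp
  also have "\<dots> \<le> emeasure lborel C + ennreal (e/2)"
    using emeasure_mono[OF sub, of lborel] cap by (intro add_mono) auto
  finally have *: "2 * (emeasure lborel A' + emeasure lborel B') \<le> 2 * (emeasure lborel C + ennreal (e/2))"
    by (intro mult_left_mono) auto
  have "2 * ennreal (e/2) = ennreal e"
    using \<open>0 < e\<close> by (simp add: ennreal_mult'[symmetric] flip: ennreal_numeral)
  then show "emeasure lborel A + emeasure lborel B \<le> 2 * emeasure lborel C + ennreal e"
    using * by (simp add: A' B' distrib_left)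
qed

lemma emeasure_midpoint_set:
  fixes A B C :: "real set"
  assumes [measurable]: "A \<in> sets borel" "B \<in> sets borel" "C \<in> sets borel"
    and ne: "A \<noteq> {}" "B \<noteq> {}"
    and mid: "\<And>a b. a \<in> A \<Longrightarrow> b \<in> B \<Longrightarrow> (a + b) / 2 \<in> C"
  shows "emeasure lborel A + emeasure lborel B \<le> 2 * emeasure lborel C"
proof -
  define I where "I n = {- real n .. real n}" for n
  have un: "(\<Union>n. I n) = UNIV"
  proof -
    have "\<exists>n. x \<in> I n" for x
      using real_arch_simple[of "\<bar>x\<bar>"] by (auto simp: I_def abs_le_iff minus_le_iff)
    then show ?thesis by auto
  qed
  have inc: "incseq (\<lambda>n. X \<inter> I n)" for X
    by (auto simp: I_def incseq_def)
  have lim: "(\<lambda>n. emeasure lborel (X \<inter> I n)) \<longlonglongrightarrow> emeasure lborel X" if [measurable]: "X \<in> sets borel" for X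
  proof -
    have "range (\<lambda>n. X \<inter> I n) \<subseteq> sets lborel" unfolding I_def by auto
    from Lim_emeasure_incseq[OF this inc] show ?thesis
      using un by (simp flip: Int_UN_distrib)
  qed
  obtain a b where ab: "a \<in> A" "b \<in> B" using ne by auto
  obtain N where N: "\<bar>a\<bar> \<le> real N" "\<bar>b\<bar> \<le> real N"
    using real_arch_simple[of "max \<bar>a\<bar> \<bar>b\<bar>"] by auto
  have "emeasure lborel (A \<inter> I n) + emeasure lborel (B \<inter> I n) \<le> 2 * emeasure lborel C" if "n \<ge> N" for n
  proof (rule emeasure_midpoint_set_bounded)
    have "a \<in> A \<inter> I n" "b \<in> B \<inter> I n"
      using ab N that by (auto simp: I_def)
    then show "A \<inter> I n \<noteq> {}" "B \<inter> I n \<noteq> {}"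
      by auto
    show "bdd_above (A \<inter> I n)" "bdd_below (B \<inter> I n)"
      unfolding I_def by auto
  qed (use mid in \<open>auto simp: I_def\<close>)
  then show ?thesis
    by (intro tendsto_upperbound[OF tendsto_add[OF lim lim]])
       (auto simp: eventually_sequentially)
qed

text \<open>The layer-cake formula for \<open>min F \<alpha>\<close>, with levels scaled to the unit interval so that
different functions can be compared at the same relative level \<open>\<tau>\<close>.\<close>

lemma nn_integral_min_layers:
  fixes F :: "real \<Rightarrow> ennreal"
  assumes [measurable]: "F \<in> borel_measurable borel" and "0 < \<alpha>"
  shows "(\<integral>\<^sup>+x. min (F x) (ennreal \<alpha>) \<partial>lborel)
    = \<alpha> * (\<integral>\<^sup>+\<tau>. indicator {0<..<1} \<tau> * emeasure lborel {x. ennreal (\<alpha> * \<tau>) < F x} \<partial>lborel)"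
proof -
  have level: "min (F x) (ennreal \<alpha>)
      = \<alpha> * (\<integral>\<^sup>+\<tau>. indicator {0<..<1} \<tau> * indicator {x. ennreal (\<alpha> * \<tau>) < F x} x \<partial>lborel)" for x
  proof -
    have "(\<integral>\<^sup>+\<tau>. indicator {0<..<1} \<tau> * indicator {x. ennreal (\<alpha> * \<tau>) < F x} x \<partial>lborel)
      = emeasure lborel {\<tau>\<in>{0<..<1}. ennreal (\<alpha> * \<tau>) < F x}"
      by (subst nn_integral_indicator[symmetric], measurable)
         (rule nn_integral_cong, auto simp: indicator_def)
    also have "\<alpha> * \<dots> = min (F x) (ennreal \<alpha>)"
    proof (cases "F x")
      case (real r)
      have "{\<tau>\<in>{0<..<1}. ennreal (\<alpha> * \<tau>) < F x} = {0<..<min 1 (r/\<alpha>)}"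
        using real \<open>0 < \<alpha>\<close> by (auto simp: ennreal_less_iff field_simps)
      then show ?thesis using real \<open>0 < \<alpha>\<close>
        by (simp add: emeasure_lborel_Ioo ennreal_mult'[symmetric] min_def field_simps)
    next
      case top
      then have "{\<tau>\<in>{0<..<1::real}. ennreal (\<alpha> * \<tau>) < F x} = {0<..<1}"
        by auto
      then show ?thesis using top by simp
    qed
    finally show ?thesis by simp
  qed
  have "(\<integral>\<^sup>+x. min (F x) (ennreal \<alpha>) \<partial>lborel)
    = \<alpha> * (\<integral>\<^sup>+x. (\<integral>\<^sup>+\<tau>. indicator {0<..<1} \<tau> * indicator {x. ennreal (\<alpha> * \<tau>) < F x} x \<partial>lborel) \<partial>lborel)"
    by (subst level, subst nn_integral_cmult) auto
  also have "(\<integral>\<^sup>+x. (\<integral>\<^sup>+\<tau>. indicator {0<..<1} \<tau> * indicator {x. ennreal (\<alpha> * \<tau>) < F x} x \<partial>lborel) \<partial>lborel)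
    = (\<integral>\<^sup>+\<tau>. (\<integral>\<^sup>+x. indicator {0<..<1} \<tau> * indicator {x. ennreal (\<alpha> * \<tau>) < F x} x \<partial>lborel) \<partial>lborel)"
    by (rule lborel_pair.Fubini') (measurable)
  also have "\<dots> = (\<integral>\<^sup>+\<tau>. indicator {0<..<1} \<tau> * emeasure lborel {x. ennreal (\<alpha> * \<tau>) < F x} \<partial>lborel)"
    by (intro nn_integral_cong) (subst nn_integral_cmult, auto)
  finally show ?thesis .
qed

text \<open>At the relative level \<open>\<tau>\<close>, the superlevel set of \<open>H\<close> for \<open>\<tau> \<surd>(\<alpha> \<beta>)\<close> contains
all midpoints of the superlevel sets of \<open>F\<close> for \<open>\<tau> \<alpha>\<close> and of \<open>G\<close> for \<open>\<tau> \<beta>\<close>.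
Integrating the one-dimensional bound over \<open>\<tau>\<close> and using the inequality of arithmetic and
geometric means gives the product form. The last two hypotheses keep these sets
non-empty; without them the midpoint bound would say nothing about the larger of the two sets.\<close>

lemma prekopa_leindler_truncated:
  fixes F G H :: "real \<Rightarrow> ennreal"
  assumes [measurable]: "F \<in> borel_measurable borel" "G \<in> borel_measurable borel" "H \<in> borel_measurable borel"
    and mid: "\<And>x y. F x * G y \<le> (H ((x + y) / 2))\<^sup>2"
    and "0 < \<alpha>" "0 < \<beta>" and ex: "\<exists>x. ennreal \<alpha> < F x" "\<exists>y. ennreal \<beta> < G y"
  shows "(\<integral>\<^sup>+x. min (F x) (ennreal \<alpha>) \<partial>lborel) * (\<integral>\<^sup>+x. min (G x) (ennreal \<beta>) \<partial>lborel) \<le> (\<integral>\<^sup>+x. H x \<partial>lborel)\<^sup>2"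
proof -
  define \<gamma> where "\<gamma> = sqrt (\<alpha> * \<beta>)"
  have \<gamma>: "0 < \<gamma>" "\<gamma>\<^sup>2 = \<alpha> * \<beta>" using \<open>0 < \<alpha>\<close> \<open>0 < \<beta>\<close> by (auto simp: \<gamma>_def)
  define lv where "lv F c \<tau> = indicator {0<..<1} \<tau> * emeasure lborel {x. ennreal (c * \<tau>) < F x}"
    for F :: "real \<Rightarrow> ennreal" and c \<tau> :: real
  have [measurable]: "(\<lambda>\<tau>. lv F c \<tau>) \<in> borel_measurable borel" if [measurable]: "F \<in> borel_measurable borel" for F c
    unfolding lv_def by measurable
  define I J K where "I = (\<integral>\<^sup>+\<tau>. lv F \<alpha> \<tau> \<partial>lborel)" and "J = (\<integral>\<^sup>+\<tau>. lv G \<beta> \<tau> \<partial>lborel)"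
    and "K = (\<integral>\<^sup>+\<tau>. lv H \<gamma> \<tau> \<partial>lborel)"
  have "lv F \<alpha> \<tau> + lv G \<beta> \<tau> \<le> 2 * lv H \<gamma> \<tau>" for \<tau>
  proof (cases "\<tau> \<in> {0<..<1}")
    case True
    have "emeasure lborel {x. ennreal (\<alpha> * \<tau>) < F x} + emeasure lborel {x. ennreal (\<beta> * \<tau>) < G x}
      \<le> 2 * emeasure lborel {x. ennreal (\<gamma> * \<tau>) < H x}"
    proof (rule emeasure_midpoint_set)
      have "ennreal (\<alpha> * \<tau>) \<le> ennreal \<alpha>" "ennreal (\<beta> * \<tau>) \<le> ennreal \<beta>"
        using True \<open>0 < \<alpha>\<close> \<open>0 < \<beta>\<close> by (auto intro!: ennreal_leI)
      then show "{x. ennreal (\<alpha> * \<tau>) < F x} \<noteq> {}" "{x. ennreal (\<beta> * \<tau>) < G x} \<noteq> {}"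
        using ex by (auto intro: le_less_trans)
      show "(a + b) / 2 \<in> {x. ennreal (\<gamma> * \<tau>) < H x}"
        if "a \<in> {x. ennreal (\<alpha> * \<tau>) < F x}" "b \<in> {x. ennreal (\<beta> * \<tau>) < G x}" for a b
      proof (rule ccontr)
        assume "(a + b) / 2 \<notin> {x. ennreal (\<gamma> * \<tau>) < H x}"
        then have "H ((a + b) / 2) \<le> ennreal (\<gamma> * \<tau>)" by auto
        then have "(H ((a + b) / 2))\<^sup>2 \<le> (ennreal (\<gamma> * \<tau>))\<^sup>2"
          by (intro power_mono) auto
        also have "\<dots> = ennreal (\<alpha> * \<tau>) * ennreal (\<beta> * \<tau>)"
          using True \<gamma> \<open>0 < \<alpha>\<close> \<open>0 < \<beta>\<close>
          by (simp add: power2_eq_square ennreal_mult'[symmetric] algebra_simps)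
        also have "\<dots> < ennreal (\<alpha> * \<tau>) * G b"
          using that True \<open>0 < \<alpha>\<close> by (intro ennreal_mult_strict_left_mono) auto
        also have "\<dots> \<le> F a * G b"
          using that by (intro mult_right_mono) auto
        finally show False using mid[of a b] by auto
      qed
    qed auto
    then show ?thesis using True by (simp add: lv_def)
  qed (simp add: lv_def)
  then have "I + J \<le> 2 * K"
    unfolding I_def J_def K_def
    by (subst nn_integral_add[symmetric], measurable, subst nn_integral_cmult[symmetric], measurable)
       (intro nn_integral_mono, auto)
  then have 1: "(I + J)\<^sup>2 \<le> (2 * K)\<^sup>2" by (intro power_mono) auto
  have "4 * (I * J) \<le> (I + J)\<^sup>2"
  proof (cases "I = top \<or> J = top")
    case True
    then have "(I + J)\<^sup>2 = top" by (auto simp: power2_eq_square ennreal_mult_top top_add add_top)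
    then show ?thesis by simp
  next
    case False
    then obtain i j where ij: "I = ennreal i" "J = ennreal j" "0 \<le> i" "0 \<le> j"
      by (metis ennreal_cases)
    have "4 * (i * j) \<le> (i + j)\<^sup>2"
      using zero_le_power2[of "i - j"] by (simp add: power2_eq_square algebra_simps)
    then show ?thesis using ij
      by (simp add: ennreal_mult'[symmetric] ennreal_plus[symmetric] power2_eq_square ennreal_leI
          del: ennreal_plus flip: ennreal_numeral)
  qed
  with 1 have "4 * (I * J) \<le> 4 * K\<^sup>2" by (simp add: power_mult_distrib)
  then have 2: "I * J \<le> K\<^sup>2"
    by (subst (asm) ennreal_mult_le_mult_iff) auto
  have "(\<integral>\<^sup>+x. min (F x) (ennreal \<alpha>) \<partial>lborel) * (\<integral>\<^sup>+x. min (G x) (ennreal \<beta>) \<partial>lborel)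
     = (\<alpha> * I) * (\<beta> * J)"
    using \<open>0 < \<alpha>\<close> \<open>0 < \<beta>\<close> by (simp add: nn_integral_min_layers I_def J_def lv_def)
  also have "\<dots> = ennreal (\<alpha> * \<beta>) * (I * J)"
    using \<open>0 < \<alpha>\<close> \<open>0 < \<beta>\<close> by (simp add: ennreal_mult' mult_ac)
  also have "\<dots> \<le> ennreal (\<gamma>\<^sup>2) * K\<^sup>2"
    using 2 by (auto simp: \<gamma> intro: mult_left_mono)
  also have "\<dots> = (\<integral>\<^sup>+x. min (H x) (ennreal \<gamma>) \<partial>lborel)\<^sup>2"
    using \<gamma> by (simp add: nn_integral_min_layers K_def lv_def power_mult_distrib ennreal_power)
  also have "\<dots> \<le> (\<integral>\<^sup>+x. H x \<partial>lborel)\<^sup>2"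
    by (intro power_mono nn_integral_mono) auto
  finally show ?thesis .
qed

text \<open>Truncation levels that stay strictly below the supremum, as
\<open>prekopa_leindler_truncated\<close> requires, and still exhaust the integral.\<close>

lemma nn_integral_truncation_below_SUP:
  fixes F :: "'a \<Rightarrow> ennreal"
  assumes [measurable]: "F \<in> borel_measurable M" and nz: "(\<integral>\<^sup>+x. F x \<partial>M) \<noteq> 0"
  obtains f :: "nat \<Rightarrow> real" where "\<And>n. 0 < f n" "\<And>n. \<exists>x. ennreal (f n) < F x"
    "(\<lambda>n. \<integral>\<^sup>+x. min (F x) (ennreal (f n)) \<partial>M) \<longlonglongrightarrow> (\<integral>\<^sup>+x. F x \<partial>M)"
proof -
  define s where "s = (SUP x. F x)"
  have "0 < s"
  proof (rule ccontr)
    assume "\<not> 0 < s"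
    then have "F x = 0" for x
      using SUP_upper[of x UNIV F] by (simp add: s_def)
    then show False using nz by simp
  qed
  then have ne: "{0<..<s} \<noteq> {}" and sup: "Sup {0<..<s} = s"
    using dense[of 0 s] by (auto intro: Sup_greaterThanLessThan)
  obtain g where g: "range g \<subseteq> {0<..<s}" "incseq g" "s = (SUP n. g n)"
    using ennreal_Sup_countable_SUP[OF ne] sup by (auto simp: image_def)
  have fin: "g n < top" "0 < g n" "g n < s" for n
    using g(1) by (auto simp: image_subset_iff intro: less_le_trans)
  define f where "f n = enn2real (g n)" for n
  have f: "ennreal (f n) = g n" for n using fin by (simp add: f_def)
  have F: "(SUP n. min (F x) (g n)) = F x" for x
  proof -
    have "F x \<le> (SUP n. g n)" using SUP_upper[of x UNIV F] g(3) by (simp add: s_def)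
    then show ?thesis
      by (metis inf_SUP inf_min inf.absorb1)
  qed
  show thesis
  proof
    show "0 < f n" for n using fin[of n] by (simp add: f_def enn2real_positive_iff)
    show "\<exists>x. ennreal (f n) < F x" for n
      using fin(3)[of n] unfolding f s_def by (auto simp: less_SUP_iff)
    have inc: "incseq (\<lambda>n x. min (F x) (g n))"
      using g(2) by (auto simp: incseq_def le_fun_def min_le_iff_disj intro: min.mono)
    have "(\<lambda>n. \<integral>\<^sup>+x. min (F x) (g n) \<partial>M) \<longlonglongrightarrow> (SUP n. \<integral>\<^sup>+x. min (F x) (g n) \<partial>M)"
      using inc by (intro LIMSEQ_SUP) (auto simp: incseq_def le_fun_def intro!: nn_integral_mono)
    also have "(SUP n. \<integral>\<^sup>+x. min (F x) (g n) \<partial>M) = (\<integral>\<^sup>+x. F x \<partial>M)"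
      using nn_integral_monotone_convergence_SUP[OF inc, of M] F by simp
    finally show "(\<lambda>n. \<integral>\<^sup>+x. min (F x) (ennreal (f n)) \<partial>M) \<longlonglongrightarrow> (\<integral>\<^sup>+x. F x \<partial>M)"
      unfolding f .
  qed
qed

lemma prekopa_leindler_real:
  fixes F G H :: "real \<Rightarrow> ennreal"
  assumes [measurable]: "F \<in> borel_measurable borel" "G \<in> borel_measurable borel" "H \<in> borel_measurable borel"
    and mid: "\<And>x y. F x * G y \<le> (H ((x + y) / 2))\<^sup>2"
  shows "(\<integral>\<^sup>+x. F x \<partial>lborel) * (\<integral>\<^sup>+x. G x \<partial>lborel) \<le> (\<integral>\<^sup>+x. H x \<partial>lborel)\<^sup>2"
proof (cases "(\<integral>\<^sup>+x. F x \<partial>lborel) = 0 \<or> (\<integral>\<^sup>+x. G x \<partial>lborel) = 0")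
  case False
  obtain f where f: "\<And>n. 0 < f n" "\<And>n. \<exists>x. ennreal (f n) < F x"
    "(\<lambda>n. \<integral>\<^sup>+x. min (F x) (ennreal (f n)) \<partial>lborel) \<longlonglongrightarrow> (\<integral>\<^sup>+x. F x \<partial>lborel)"
    using nn_integral_truncation_below_SUP[of F lborel] False by auto
  obtain g where g: "\<And>n. 0 < g n" "\<And>n. \<exists>x. ennreal (g n) < G x"
    "(\<lambda>n. \<integral>\<^sup>+x. min (G x) (ennreal (g n)) \<partial>lborel) \<longlonglongrightarrow> (\<integral>\<^sup>+x. G x \<partial>lborel)"
    using nn_integral_truncation_below_SUP[of G lborel] False by auto
  have "(\<lambda>n. (\<integral>\<^sup>+x. min (F x) (ennreal (f n)) \<partial>lborel) * (\<integral>\<^sup>+x. min (G x) (ennreal (g n)) \<partial>lborel))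
    \<longlonglongrightarrow> (\<integral>\<^sup>+x. F x \<partial>lborel) * (\<integral>\<^sup>+x. G x \<partial>lborel)"
    using f(3) g(3) False by (intro tendsto_mult_ennreal) auto
  then show ?thesis
    by (rule tendsto_upperbound)
       (auto intro!: always_eventually prekopa_leindler_truncated mid f g)
qed auto

text \<open>Integrating out all but one coordinate turns the hypothesis for the slices into the hypothesis for
the marginals, so the one-dimensional case applies to the remaining coordinate.\<close>

lemma prekopa_leindler_PiM:
  fixes F G H :: "('i \<Rightarrow> real) \<Rightarrow> ennreal"
  assumes "finite I"
    and "F \<in> borel_measurable (PiM I (\<lambda>_. lborel))" "G \<in> borel_measurable (PiM I (\<lambda>_. lborel))"
      "H \<in> borel_measurable (PiM I (\<lambda>_. lborel))"
    and "\<And>x y. F x * G y \<le> (H (\<lambda>i\<in>I. (x i + y i) / 2))\<^sup>2"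
  shows "(\<integral>\<^sup>+x. F x \<partial>PiM I (\<lambda>_. lborel)) * (\<integral>\<^sup>+x. G x \<partial>PiM I (\<lambda>_. lborel))
     \<le> (\<integral>\<^sup>+x. H x \<partial>PiM I (\<lambda>_. lborel))\<^sup>2"
  using assms
proof (induction I arbitrary: F G H rule: finite_induct)
  case empty
  interpret product_sigma_finite "\<lambda>_. lborel :: real measure" ..
  have "F (\<lambda>_. undefined) * G (\<lambda>_. undefined) \<le> (H (\<lambda>i\<in>{}. (undefined + undefined) / 2))\<^sup>2"
    using empty(4) by blast
  then show ?case by (simp add: nn_integral_empty restrict_def)
next
  case (insert i I)
  interpret product_sigma_finite "\<lambda>_. lborel :: real measure" ..
  interpret I: finite_product_sigma_finite "\<lambda>_. lborel :: real measure" I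
    by standard fact
  note [measurable] = insert.prems(1-3)
  have slice: "(\<lambda>x. F (x(i := s))) \<in> borel_measurable (PiM I (\<lambda>_. lborel))"
    if [measurable]: "F \<in> borel_measurable (PiM (insert i I) (\<lambda>_. lborel :: real measure))"
    for s and F :: "('i \<Rightarrow> real) \<Rightarrow> ennreal"
    by measurable
  have marg: "(\<lambda>s. \<integral>\<^sup>+x. F (x(i := s)) \<partial>PiM I (\<lambda>_. lborel)) \<in> borel_measurable borel"
    if [measurable]: "F \<in> borel_measurable (PiM (insert i I) (\<lambda>_. lborel :: real measure))"
    for F :: "('i \<Rightarrow> real) \<Rightarrow> ennreal"
  proof -
    have "(\<lambda>s. \<integral>\<^sup>+x. F (x(i := s)) \<partial>PiM I (\<lambda>_. lborel)) \<in> borel_measurable lborel"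
      by measurable
    then show ?thesis by simp
  qed
  have "(\<integral>\<^sup>+x. F (x(i := s)) \<partial>PiM I (\<lambda>_. lborel)) * (\<integral>\<^sup>+x. G (x(i := t)) \<partial>PiM I (\<lambda>_. lborel))
     \<le> (\<integral>\<^sup>+x. H (x(i := (s + t) / 2)) \<partial>PiM I (\<lambda>_. lborel))\<^sup>2" for s t
  proof (rule insert.IH[OF slice[OF insert.prems(1)] slice[OF insert.prems(2)] slice[OF insert.prems(3)]])
    fix x y :: "'i \<Rightarrow> real"
    have "(\<lambda>j\<in>insert i I. ((x(i := s)) j + (y(i := t)) j) / 2)
        = (\<lambda>j\<in>I. (x j + y j) / 2)(i := (s + t) / 2)"
      using insert.hyps(2) by (auto simp: restrict_def fun_eq_iff)
    then show "F (x(i := s)) * G (y(i := t)) \<le> (H ((\<lambda>j\<in>I. (x j + y j) / 2)(i := (s + t) / 2)))\<^sup>2"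
      using insert.prems(4)[of "x(i := s)" "y(i := t)"] by metis
  qed
  then show ?case
    using insert.hyps
    by (simp add: product_nn_integral_insert_rev)
       (rule prekopa_leindler_real, auto intro!: marg)
qed

text \<open>The midpoint form of the inequality. It says that integrating out some of the variables of a
midpoint log-concave function leaves a midpoint log-concave function.\<close>

theorem prekopa_leindler:
  fixes F G H :: "'a::euclidean_space \<Rightarrow> ennreal"
  assumes [measurable]: "F \<in> borel_measurable borel" "G \<in> borel_measurable borel" "H \<in> borel_measurable borel"
    and mid: "\<And>x y. F x * G y \<le> (H ((1/2) *\<^sub>R (x + y)))\<^sup>2"
  shows "(\<integral>\<^sup>+x. F x \<partial>lborel) * (\<integral>\<^sup>+x. G x \<partial>lborel) \<le> (\<integral>\<^sup>+x. H x \<partial>lborel)\<^sup>2"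
proof -
  define e where "e f = (\<Sum>b\<in>Basis. f b *\<^sub>R b :: 'a)" for f
  have [measurable]: "e \<in> borel_measurable (PiM Basis (\<lambda>_. lborel))"
    unfolding e_def by measurable
  have coord: "(\<integral>\<^sup>+x. F x \<partial>lborel) = (\<integral>\<^sup>+f. F (e f) \<partial>PiM Basis (\<lambda>_. lborel))"
    if [measurable]: "F \<in> borel_measurable borel" for F
    by (subst lborel_eq, subst nn_integral_distr) (auto simp: e_def[abs_def])
  have "e (\<lambda>i\<in>Basis. (x i + y i) / 2) = (1/2) *\<^sub>R (e x + e y)" for x y
    by (simp add: e_def scaleR_sum_right sum.distrib[symmetric] scaleR_add_left add_divide_distrib scaleR_add_right)
  then show ?thesis
    by (simp add: coord) (rule prekopa_leindler_PiM, auto simp: mid)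
qed

section \<open>Second moments of log-concave functions on an interval\<close>

text \<open>A gap of \<open>S\<close> inside the interval would have endpoints in \<open>S\<close>, hence a midpoint in \<open>S\<close>.\<close>

lemma closed_midpoint_convex_Icc:
  fixes S :: "real set"
  assumes "closed S" and mid: "\<And>x y. x \<in> S \<Longrightarrow> y \<in> S \<Longrightarrow> (x + y) / 2 \<in> S"
    and "a \<in> S" "b \<in> S"
  shows "{a..b} \<subseteq> S"
proof (rule ccontr)
  assume "\<not> {a..b} \<subseteq> S"
  then obtain u where u: "a \<le> u" "u \<le> b" "u \<notin> S" by (auto simp: subset_eq)
  define p where "p = Sup (S \<inter> {..u})"
  define q where "q = Inf (S \<inter> {u..})"
  have p: "p \<in> S \<inter> {..u}" unfolding p_def
    by (rule closed_contains_Sup) (use u assms in auto)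
  have q: "q \<in> S \<inter> {u..}" unfolding q_def
    by (rule closed_contains_Inf) (use u assms in auto)
  have ne: "p < u" "u < q" using p q u by (auto simp: less_le)
  have m: "(p + q) / 2 \<in> S" using mid p q by auto
  show False
  proof (cases "(p + q) / 2 \<le> u")
    case True
    then have "(p + q) / 2 \<le> p"
      unfolding p_def by (intro cSup_upper) (use m in \<open>auto simp: p_def\<close>)
    then show False using ne by (simp add: field_simps)
  next
    case False
    then have "q \<le> (p + q) / 2"
      unfolding q_def by (intro cInf_lower) (use m in \<open>auto simp: q_def\<close>)
    then show False using ne by (simp add: field_simps)
  qed
qed

text \<open>Let \<open>x = A / B\<close>. The left side is non-positive for \<open>x \<le> 1/3\<close>. For larger \<open>x\<close>, the logarithm of
the right side divided by the left side vanishes at \<open>x = 1\<close> and has derivative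
 \<open>- 9 (1 - x)^4 / (2 x^2 (3 - x) (3 x - 1))\<close>. The inequality says that the
density \<open>exp (- s t)\<close> on \<open>{- A..B}\<close> has non-positive mean for this value of \<open>s\<close>.\<close>

lemma exp_le_at_critical_slope:
  fixes A B :: real
  assumes "0 < A" "A \<le> B" and s: "s = 3/2 * (1/A - 1/B)"
  shows "(1 - A * s) * exp (s * (A + B)) \<le> 1 + B * s"
proof -
  define x where "x = A / B"
  have x: "0 < x" "x \<le> 1" using assms by (auto simp: x_def)
  have eqs: "1 - A * s = (3 * x - 1) / 2" "1 + B * s = (3 - x) / (2 * x)"
    "s * (A + B) = 3/2 * (1/x - x)"
    unfolding s x_def using assms(1,2) by (auto simp: field_simps)
  show ?thesis
  proof (cases "3 * x \<le> 1")
    case True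
    then have "(3 * x - 1) / 2 * exp (3/2 * (1/x - x)) \<le> 0"
      by (intro mult_nonpos_nonneg) auto
    also have "0 \<le> (3 - x) / (2 * x)" using x by auto
    finally show ?thesis unfolding eqs .
  next
    case False
    define h where "h x = ln (3 - x) - ln x - ln (3 * x - 1) - 3/2 * (1/x - x)" for x :: real
    have "h 1 \<le> h x"
    proof (rule DERIV_nonpos_imp_nonincreasing[of x 1])
      show "x \<le> 1" by fact
      fix y assume y: "x \<le> y" "y \<le> 1"
      then have pos: "0 < y" "1 < 3 * y" using x False by auto
      have "(h has_real_derivative (- 1/(3 - y) - 1/y - 3/(3*y - 1) + 3/2 * (1/y^2 + 1))) (at y)"
        unfolding h_def using y pos
        by (auto intro!: derivative_eq_intros simp: power2_eq_square diff_divide_distrib add_divide_distrib)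
      moreover have "- 1/(3 - y) - 1/y - 3/(3*y - 1) + 3/2 * (1/y^2 + 1)
          = - (9 * (1 - y)^4 / (2 * y^2 * (3 - y) * (3 * y - 1)))"
      proof -
        have nz: "3 - y \<noteq> 0" "y \<noteq> 0" "3 * y - 1 \<noteq> 0" using y pos by auto
        define p q where "p = 3 - y" and "q = 3 * y - 1"
        have pq: "p \<noteq> 0" "q \<noteq> 0" using nz by (auto simp: p_def q_def)
        have "- 1/p - 1/y - 3/q + 3/2 * (1/y^2 + 1)
            = (- 2*y^2*q - 2*y*p*q - 6 * y^2 * p + 3*p*q*(1 + y^2)) / (2*y^2*p*q)"
          using pq nz by (simp add: field_simps power2_eq_square)
        also have "(- 2*y^2*q - 2*y*p*q - 6 * y^2 * p + 3*p*q*(1 + y^2)) = - (9 * (1 - y)^4)"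
          unfolding p_def q_def by algebra
        finally show ?thesis by (simp add: p_def q_def)
      qed
      moreover have "0 \<le> 9 * (1 - y)^4 / (2 * y^2 * (3 - y) * (3 * y - 1))"
        using y pos by (intro divide_nonneg_nonneg mult_nonneg_nonneg) auto
      ultimately show "\<exists>z. (h has_real_derivative z) (at y) \<and> z \<le> 0"
        by (metis neg_le_0_iff_le)
    qed
    then have "ln ((3 * x - 1) / 2) + 3/2 * (1/x - x) \<le> ln ((3 - x) / (2 * x))"
    proof -
      have "ln ((3 * x - 1) / 2) = ln (3 * x - 1) - ln 2" "ln ((3 - x) / (2 * x)) = ln (3 - x) - ln 2 - ln x"
        using x False by (auto simp: ln_div ln_mult)
      moreover have "0 \<le> h x" using \<open>h 1 \<le> h x\<close> by (simp add: h_def[of 1])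
      ultimately show ?thesis unfolding h_def by linarith
    qed
    then have "exp (ln ((3 * x - 1) / 2) + 3/2 * (1/x - x)) \<le> exp (ln ((3 - x) / (2 * x)))"
      by simp
    then show ?thesis
      unfolding eqs using x False by (simp add: exp_add)
  qed
qed

text \<open>For \<open>s > 0\<close>, integration by parts gives the second moment of a centred density proportional to
\<open>exp (- s t)\<close> as \<open>(A B - (B - A) / s) Z\<close>. This is at most \<open>A B Z / 3\<close> as soon as
\<open>s \<le> 3/2 (1/A - 1/B)\<close>, and the previous lemma locates the centring value of \<open>s\<close> below
this bound. The uniform density is the limiting case \<open>A = B\<close>.\<close>

lemma centered_exponential:
  fixes A B :: real
  assumes "0 < A" "A \<le> B"
  obtains s Z V where
    "((\<lambda>t. exp (- s * t)) has_integral Z) {- A..B}"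
    "((\<lambda>t. t * exp (- s * t)) has_integral 0) {- A..B}"
    "((\<lambda>t. t\<^sup>2 * exp (- s * t)) has_integral V) {- A..B}"
    "0 < Z" "V \<le> A * B / 3 * Z"
proof (cases "A = B")
  case True
  have le: "- A \<le> B" using assms by auto
  have 0: "((\<lambda>t. exp (- 0 * t)) has_integral (B - (- A))) {- A..B}"
    using le by (intro fundamental_theorem_of_calculus)
      (auto intro!: derivative_eq_intros simp flip: has_real_derivative_iff_has_vector_derivative)
  have 1: "((\<lambda>t. t * exp (- 0 * t)) has_integral (B\<^sup>2/2 - (- A)\<^sup>2/2)) {- A..B}"
    using le by (intro fundamental_theorem_of_calculus)
      (auto intro!: derivative_eq_intros simp flip: has_real_derivative_iff_has_vector_derivative)
  have 2: "((\<lambda>t. t\<^sup>2 * exp (- 0 * t)) has_integral (B^3/3 - (- A)^3/3)) {- A..B}"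
    using le by (intro fundamental_theorem_of_calculus)
      (auto intro!: derivative_eq_intros simp flip: has_real_derivative_iff_has_vector_derivative)
  show thesis
  proof (rule that[OF 0 _ 2])
    show "((\<lambda>t. t * exp (- 0 * t)) has_integral 0) {- A..B}" using 1 True by simp
  qed (use assms True in \<open>auto simp: power3_eq_cube\<close>)
next
  case False
  then have AB: "0 < A" "A < B" using assms by auto
  \<comment> \<open>The sign of \<open>k s\<close> is the sign of the first moment of \<open>exp (- s t)\<close>.\<close>
  define k where "k s = (1 - A * s) * exp (s * (A + B)) - (1 + B * s)" for s
  \<comment> \<open>At \<open>s1\<close> the bound \<open>exp z \<ge> 1 + z + z\<^sup>2 / 2\<close> gives exactly \<open>k s1 \<ge> 0\<close>.\<close>
  define s1 where "s1 = (B - A) / (A * (A + B))"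
  define s2 where "s2 = 3/2 * (1/A - 1/B)"
  have s1: "0 < s1" using AB by (simp add: s1_def)
  have "1 - A * s1 = 2 * A / (A + B)" using AB by (simp add: s1_def divide_simps)
  moreover have "exp (s1 * (A + B)) \<ge> 1 + s1 * (A + B) + (s1 * (A + B))\<^sup>2 / 2"
    using s1 AB by (intro exp_lower_Taylor_quadratic) auto
  ultimately have "(1 - A * s1) * exp (s1 * (A + B)) \<ge> 2 * A / (A + B) * (1 + s1 * (A + B) + (s1 * (A + B))\<^sup>2 / 2)"
    using AB by (auto intro!: mult_left_mono simp del: times_divide_eq_left)
  moreover have "2 * A / (A + B) * (1 + s1 * (A + B) + (s1 * (A + B))\<^sup>2 / 2) = 1 + B * s1"
  proof -
    have "s1 * (A + B) = (B - A) / A" using AB by (simp add: s1_def)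
    moreover have "2 * A / (A + B) * (1 + (B - A) / A + ((B - A) / A)\<^sup>2 / 2)
        = 1 + B * ((B - A) / (A * (A + B)))"
      using AB by (simp add: divide_simps power2_eq_square) algebra
    ultimately show ?thesis by (simp only: s1_def)
  qed
  ultimately have k1: "0 \<le> k s1" by (simp add: k_def)
  have k2: "k s2 \<le> 0"
    using exp_le_at_critical_slope[OF AB(1) less_imp_le[OF AB(2)] s2_def] by (simp add: k_def)
  have "s1 \<le> s2"
  proof -
    have "s2 = (B - A) * (3 / (2 * A * B))" using AB by (simp add: s2_def field_simps)
    moreover have "s1 = (B - A) * (1 / (A * (A + B)))" by (simp add: s1_def)
    moreover have "1 / (A * (A + B)) \<le> 3 / (2 * A * B)"
      using AB by (simp add: divide_simps)
    ultimately show ?thesis using AB by (metis mult_left_mono diff_ge_0_iff_ge less_imp_le)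
  qed
  have "\<exists>s. s1 \<le> s \<and> s \<le> s2 \<and> k s = 0"
    by (rule IVT2') (use k1 k2 \<open>s1 \<le> s2\<close> in \<open>auto simp: k_def intro!: continuous_intros\<close>)
  then obtain s where s: "s1 \<le> s" "s \<le> s2" "k s = 0" by auto
  have "0 < s" using s s1 by auto
  define E F where "E = exp (s * A)" and "F = exp (- s * B)"
  have rel: "(1 - A * s) * E = (1 + B * s) * F"
  proof -
    have "(1 - A * s) * exp (s * (A + B)) * F = (1 + B * s) * F"
      using s(3) by (simp add: k_def)
    moreover have "exp (s * (A + B)) * F = E"
      by (simp add: E_def F_def exp_add[symmetric] algebra_simps)
    ultimately show ?thesis by (simp add: mult.assoc)
  qed
  define Z where "Z = (E - F) / s"
  define V where "V = (A\<^sup>2/s - 2*A/s\<^sup>2 + 2/s^3) * E - (B\<^sup>2/s + 2*B/s\<^sup>2 + 2/s^3) * F"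
  have le: "- A \<le> B" using AB by auto
  have 0: "((\<lambda>t. exp (- s * t)) has_integral (- exp (- s * B) / s - (- exp (- s * (- A)) / s))) {- A..B}"
    using le \<open>0 < s\<close> by (intro fundamental_theorem_of_calculus)
      (auto intro!: derivative_eq_intros simp flip: has_real_derivative_iff_has_vector_derivative)
  have D1: "((\<lambda>t. - (t/s + 1/s\<^sup>2) * exp (- s * t)) has_real_derivative t * exp (- s * t)) (at t within X)" for t X
    using \<open>0 < s\<close> by (auto intro!: derivative_eq_intros)
      (simp add: divide_simps power2_eq_square, algebra)
  have D2: "((\<lambda>t. - (t\<^sup>2/s + 2*t/s\<^sup>2 + 2/s^3) * exp (- s * t)) has_real_derivative t\<^sup>2 * exp (- s * t)) (at t within X)" for t X
    using \<open>0 < s\<close> by (auto intro!: derivative_eq_intros)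
      (simp add: divide_simps power2_eq_square power3_eq_cube, algebra)
  have 1: "((\<lambda>t. t * exp (- s * t)) has_integral
      (- (B/s + 1/s\<^sup>2) * exp (- s * B) - (- ((- A)/s + 1/s\<^sup>2) * exp (- s * (- A))))) {- A..B}"
    by (rule fundamental_theorem_of_calculus[OF le])
      (simp only: has_real_derivative_iff_has_vector_derivative[symmetric] D1)
  have 2: "((\<lambda>t. t\<^sup>2 * exp (- s * t)) has_integral
      (- (B\<^sup>2/s + 2*B/s\<^sup>2 + 2/s^3) * exp (- s * B) - (- ((- A)\<^sup>2/s + 2*(- A)/s\<^sup>2 + 2/s^3) * exp (- s * (- A))))) {- A..B}"
    by (rule fundamental_theorem_of_calculus[OF le])
      (simp only: has_real_derivative_iff_has_vector_derivative[symmetric] D2)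
  have V: "V = A * B * Z - (B - A) / s * Z"
  proof -
    have "V - (A * B * Z - (B - A) / s * Z)
      = (2/s^3 + (B - A)/s\<^sup>2) * ((1 - A * s) * E - (1 + B * s) * F)"
    proof -
      define r where "r = inverse s"
      have "r * s = 1" using \<open>0 < s\<close> by (simp add: r_def)
      have r: "x / s = x * r" "x / s\<^sup>2 = x * r\<^sup>2" "x / s^3 = x * r^3" for x
        by (auto simp: divide_inverse power_inverse r_def)
      show ?thesis unfolding V_def Z_def r using \<open>r * s = 1\<close> by algebra
    qed
    then show ?thesis using rel by simp
  qed
  have "0 < Z"
    using \<open>0 < s\<close> AB by (auto simp: Z_def E_def F_def intro!: divide_pos_pos) (smt (verit) mult_pos_pos)
  moreover have "2/3 * (A * B) \<le> (B - A) / s"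
  proof -
    have "s * (2/3 * (A * B)) \<le> s2 * (2/3 * (A * B))"
      using s AB by (intro mult_right_mono) auto
    also have "\<dots> = B - A" using AB by (simp add: s2_def field_simps)
    finally show ?thesis using \<open>0 < s\<close> by (simp add: field_simps)
  qed
  ultimately have "2/3 * (A * B) * Z \<le> (B - A) / s * Z"
    by (intro mult_right_mono) auto
  then have VZ: "V \<le> A * B / 3 * Z" unfolding V by (simp add: algebra_simps)
  have e1: "- (B/s + 1/s\<^sup>2) * exp (- s * B) - (- ((- A)/s + 1/s\<^sup>2) * exp (- s * (- A))) = 0"
  proof -
    have "- (B/s + 1/s\<^sup>2) * F - (- ((- A)/s + 1/s\<^sup>2) * E) = ((1 - A * s) * E - (1 + B * s) * F) / s\<^sup>2"
      using \<open>0 < s\<close> by (simp add: field_simps power2_eq_square)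
    then show ?thesis using rel by (simp add: E_def F_def)
  qed
  have e0: "- exp (- s * B) / s - (- exp (- s * (- A)) / s) = Z"
    by (simp add: Z_def E_def F_def diff_divide_distrib)
  have e2: "- (B\<^sup>2/s + 2*B/s\<^sup>2 + 2/s^3) * exp (- s * B) - (- ((- A)\<^sup>2/s + 2*(- A)/s\<^sup>2 + 2/s^3) * exp (- s * (- A))) = V"
    by (simp add: V_def E_def F_def algebra_simps)
  show thesis
    using 0 1 2 \<open>0 < Z\<close> VZ unfolding e0 e1 e2 by (rule that)
qed

text \<open>Compare \<open>f\<close> with the centred exponential \<open>g\<close> of the same mass. As \<open>f / g\<close> is log-concave,
\<open>f \<ge> g\<close> holds exactly on an interval \<open>[t1, t2]\<close>, so \<open>(t - t1) (t - t2) (f t - g t)\<close> is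
never positive. Masses and means agree, so its integral is the difference of the second moments.\<close>

lemma log_concave_second_moment_le_if_le:
  fixes f :: "real \<Rightarrow> real"
  assumes AB: "0 < A" "A \<le> B"
    and cont: "continuous_on {- A..B} f"
    and nonneg: "\<And>t. t \<in> {- A..B} \<Longrightarrow> 0 \<le> f t"
    and mid: "\<And>x y. x \<in> {- A..B} \<Longrightarrow> y \<in> {- A..B} \<Longrightarrow> f x * f y \<le> (f ((x + y) / 2))\<^sup>2"
    and mean: "integral {- A..B} (\<lambda>t. t * f t) = 0"
  shows "integral {- A..B} (\<lambda>t. t\<^sup>2 * f t) \<le> A * B / 3 * integral {- A..B} f"
proof -
  obtain s Z V where Z: "((\<lambda>t. exp (- s * t)) has_integral Z) {- A..B}"
    and 1: "((\<lambda>t. t * exp (- s * t)) has_integral 0) {- A..B}"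
    and V: "((\<lambda>t. t\<^sup>2 * exp (- s * t)) has_integral V) {- A..B}"
    and "0 < Z" and VZ: "V \<le> A * B / 3 * Z"
    by (rule centered_exponential[OF AB])
  define I where "I = integral {- A..B} f"
  have "0 \<le> I" unfolding I_def
    by (intro integral_nonneg integrable_continuous_real cont) (use nonneg in auto)
  define C where "C = I / Z"
  have C: "0 \<le> C" "C * Z = I" using \<open>0 \<le> I\<close> \<open>0 < Z\<close> by (auto simp: C_def)
  define g where "g t = C * exp (- s * t)" for t
  have g0: "0 \<le> g t" for t using C by (simp add: g_def)
  have gmid: "g x * g y = (g ((x + y) / 2))\<^sup>2" for x y
    by (simp add: g_def power2_eq_square exp_add[symmetric] algebra_simps)
  have gcont: "continuous_on {- A..B} g"
    unfolding g_def by (intro continuous_intros)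
  define S where "S = {t \<in> {- A..B}. g t \<le> f t}"
  have "\<exists>t1 t2. \<forall>t\<in>{- A..B}. (t - t1) * (t - t2) * (f t - g t) \<le> 0"
  \<comment> \<open>For empty \<open>S\<close> any double root will do.\<close>
  proof (cases "S = {}")
    case True
    then have "(t - 0) * (t - 0) * (f t - g t) \<le> 0" if "t \<in> {- A..B}" for t
      using that by (intro mult_nonneg_nonpos) (auto simp: S_def)
    then show ?thesis by blast
  next
    case False
    have bdd: "bdd_above S" "bdd_below S" by (auto simp: S_def intro!: bdd_aboveI bdd_belowI)
    have "closed S" unfolding S_def
    proof -
      have "closed {t \<in> {- A..B}. 0 \<le> f t - g t}"
        using continuous_closed_preimage[OF continuous_on_diff[OF cont gcont] _ closed_atLeast[of 0]]
        by (simp add: vimage_def Int_def)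
      then show "closed {t \<in> {- A..B}. g t \<le> f t}" by simp
    qed
    have Sm: "(x + y) / 2 \<in> S" if "x \<in> S" "y \<in> S" for x y
    proof -
      have "(g ((x + y) / 2))\<^sup>2 = g x * g y" by (simp add: gmid)
      also have "\<dots> \<le> f x * f y" using that g0 by (intro mult_mono) (auto simp: S_def intro: order_trans[OF g0])
      also have "\<dots> \<le> (f ((x + y) / 2))\<^sup>2" using that by (intro mid) (auto simp: S_def)
      finally have "g ((x + y) / 2) \<le> f ((x + y) / 2)"
        by (rule power2_le_imp_le) (use that in \<open>auto intro!: nonneg simp: S_def\<close>)
      then show ?thesis using that by (auto simp: S_def)
    qed
    have sub: "{Inf S..Sup S} \<subseteq> S"
      by (rule closed_midpoint_convex_Icc)
         (use \<open>closed S\<close> False bdd Sm in \<open>auto intro: closed_contains_Inf closed_contains_Sup\<close>)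
    have "(t - Inf S) * (t - Sup S) * (f t - g t) \<le> 0" if t: "t \<in> {- A..B}" for t
    proof (cases "t \<in> {Inf S..Sup S}")
      case True
      then have "g t \<le> f t" using sub by (auto simp: S_def)
      then show ?thesis using True by (intro mult_nonpos_nonneg mult_nonneg_nonpos) auto
    next
      case False
      then have "t \<notin> S" using cInf_lower[OF _ bdd(2)] cSup_upper[OF _ bdd(1)] by auto
      then have "f t - g t \<le> 0" using t by (auto simp: S_def)
      moreover have "Inf S \<le> Sup S"
        using \<open>S \<noteq> {}\<close> bdd by (metis cInf_le_cSup)
      then have "0 \<le> (t - Inf S) * (t - Sup S)"
        using False by (auto simp: zero_le_mult_iff)
      ultimately show ?thesis by (rule mult_nonneg_nonpos[rotated])
    qed
    then show ?thesis by blast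
  qed
  then obtain t1 t2 where sign: "\<And>t. t \<in> {- A..B} \<Longrightarrow> (t - t1) * (t - t2) * (f t - g t) \<le> 0"
    by blast
  have f0: "(f has_integral I) {- A..B}" unfolding I_def
    by (intro integrable_integral integrable_continuous_real cont)
  have f1: "((\<lambda>t. t * f t) has_integral 0) {- A..B}"
    using integrable_integral[of "\<lambda>t. t * f t" "{- A..B}"] mean
    by (simp add: integrable_continuous_real cont continuous_intros)
  have f2: "((\<lambda>t. t\<^sup>2 * f t) has_integral integral {- A..B} (\<lambda>t. t\<^sup>2 * f t)) {- A..B}"
    by (intro integrable_integral integrable_continuous_real cont continuous_intros)
  have "((\<lambda>t. ((t\<^sup>2 * f t - (t1 + t2) * (t * f t)) + (t1 * t2) * f t)
      - C * ((t\<^sup>2 * exp (- s * t) - (t1 + t2) * (t * exp (- s * t))) + (t1 * t2) * exp (- s * t))) has_integral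
      ((integral {- A..B} (\<lambda>t. t\<^sup>2 * f t) - (t1 + t2) * 0) + (t1 * t2) * I)
      - C * ((V - (t1 + t2) * 0) + (t1 * t2) * Z)) {- A..B}"
    by (intro has_integral_diff has_integral_add has_integral_mult_right f0 f1 f2 V Z 1)
  then have "((integral {- A..B} (\<lambda>t. t\<^sup>2 * f t) - (t1 + t2) * 0) + (t1 * t2) * I)
      - C * ((V - (t1 + t2) * 0) + (t1 * t2) * Z) \<le> 0"
  proof (rule has_integral_le[OF _ has_integral_0])
    fix t assume "t \<in> {- A..B}"
    from sign[OF this] show "((t\<^sup>2 * f t - (t1 + t2) * (t * f t)) + (t1 * t2) * f t)
      - C * ((t\<^sup>2 * exp (- s * t) - (t1 + t2) * (t * exp (- s * t))) + (t1 * t2) * exp (- s * t)) \<le> 0"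
      by (simp add: g_def algebra_simps power2_eq_square)
  qed
  then have "integral {- A..B} (\<lambda>t. t\<^sup>2 * f t) \<le> C * V + t1 * t2 * (C * Z - I)"
    by (simp add: algebra_simps)
  also have "\<dots> \<le> C * (A * B / 3 * Z)"
    using mult_left_mono[OF VZ C(1)] C(2) by simp
  also have "\<dots> = A * B / 3 * I" using C by (simp add: field_simps)
  finally show ?thesis by (simp add: I_def)
qed

lemma log_concave_second_moment_le:
  fixes f :: "real \<Rightarrow> real"
  assumes AB: "0 < A" "0 < B"
    and cont: "continuous_on {- A..B} f"
    and nonneg: "\<And>t. t \<in> {- A..B} \<Longrightarrow> 0 \<le> f t"
    and mid: "\<And>x y. x \<in> {- A..B} \<Longrightarrow> y \<in> {- A..B} \<Longrightarrow> f x * f y \<le> (f ((x + y) / 2))\<^sup>2"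
    and mean: "integral {- A..B} (\<lambda>t. t * f t) = 0"
  shows "integral {- A..B} (\<lambda>t. t\<^sup>2 * f t) \<le> A * B / 3 * integral {- A..B} f"
proof (cases "A \<le> B")
  case True
  then show ?thesis
    by (rule log_concave_second_moment_le_if_le[OF AB(1) _ cont nonneg mid mean])
next
  case False
  have refl: "integral {- B..- (- A)} (\<lambda>t. h (- t)) = integral {- A..B} h" for h :: "real \<Rightarrow> real"
    using Henstock_Kurzweil_Integration.integral_reflect_real[where a = "- A" and b = B and f = h] by simp
  have "integral {- B..A} (\<lambda>t. t\<^sup>2 * f (- t)) \<le> B * A / 3 * integral {- B..A} (\<lambda>t. f (- t))"
  proof (rule log_concave_second_moment_le_if_le)
    show "continuous_on {- B..A} (\<lambda>t. f (- t))"
      by (intro continuous_on_compose2[OF cont]) (auto intro!: continuous_intros)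
    show "f (- x) * f (- y) \<le> (f (- ((x + y) / 2)))\<^sup>2" if "x \<in> {- B..A}" "y \<in> {- B..A}" for x y
    proof -
      have "- ((x + y) / 2) = (- x + - y) / 2" by (simp add: field_simps)
      then show ?thesis using mid[of "- x" "- y"] that by (simp only:) auto
    qed
    show "integral {- B..A} (\<lambda>t. t * f (- t)) = 0"
      using refl[of "\<lambda>t. - (t * f t)"] mean by simp
  qed (use False AB nonneg in auto)
  then show ?thesis
    using refl[of f] refl[of "\<lambda>t. t\<^sup>2 * f t"] by (simp add: mult.commute)
qed

section \<open>Upper bound for the variance of a convex body\<close>

lemma set_integrable_continuous_compact:
  fixes f :: "'a::euclidean_space \<Rightarrow> real"
  assumes "compact K" "continuous_on K f"
  shows "set_integrable lborel K f"
  using borel_integrable_compact[OF assms] by (simp add: set_integrable_def)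

text \<open>A function that is concave on its support and vanishes elsewhere is midpoint log-concave.\<close>

lemma parabola_kernel_midpoint:
  fixes \<epsilon> u w :: real
  shows "max 0 (\<epsilon>\<^sup>2 - u\<^sup>2) * max 0 (\<epsilon>\<^sup>2 - w\<^sup>2) \<le> (max 0 (\<epsilon>\<^sup>2 - ((u + w) / 2)\<^sup>2))\<^sup>2"
proof (cases "0 < \<epsilon>\<^sup>2 - u\<^sup>2 \<and> 0 < \<epsilon>\<^sup>2 - w\<^sup>2")
  case True
  define p q where "p = \<epsilon>\<^sup>2 - u\<^sup>2" and "q = \<epsilon>\<^sup>2 - w\<^sup>2"
  have pq: "0 < p" "0 < q" using True by (auto simp: p_def q_def)
  have "p * q \<le> ((p + q) / 2)\<^sup>2"
    using zero_le_power2[of "p - q"] by (simp add: power2_eq_square field_simps)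
  also have "(p + q) / 2 \<le> \<epsilon>\<^sup>2 - ((u + w) / 2)\<^sup>2"
    using zero_le_power2[of "u - w"] by (simp add: p_def q_def power2_eq_square field_simps)
  then have "((p + q) / 2)\<^sup>2 \<le> (max 0 (\<epsilon>\<^sup>2 - ((u + w) / 2)\<^sup>2))\<^sup>2"
    using pq by (intro power_mono) auto
  finally show ?thesis using pq by (simp add: p_def q_def)
next
  case False
  then have "max 0 (\<epsilon>\<^sup>2 - u\<^sup>2) * max 0 (\<epsilon>\<^sup>2 - w\<^sup>2) = 0" by auto
  then show ?thesis by (simp only: zero_le_power2)
qed

text \<open>The marginal of \<open>K\<close> under \<open>l\<close> is convolved with the continuous kernel
\<open>max 0 (\<epsilon>\<^sup>2 - u\<^sup>2)\<close>. The result \<open>f\<close> is continuous, and it is midpoint log-concave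
by the Prekopa-Leindler inequality applied to the functions \<open>indicator K x * k (t - l x)\<close>. This
avoids disintegrating Lebesgue measure along \<open>l\<close>. The kernel is even, so, up to the mass of
the kernel, the convolution keeps the mean and can only increase the second moment, while the support grows by \<open>\<epsilon>\<close> on either side.\<close>

lemma smoothed_second_moment_le:
  fixes K :: "'a::euclidean_space set" and l :: "'a \<Rightarrow> real"
  assumes K: "compact K" "convex K" and "0 \<le> a" "0 \<le> b" "0 < \<epsilon>"
    and l: "continuous_on UNIV l" "\<And>x y. l ((1/2) *\<^sub>R (x + y)) = (l x + l y) / 2"
    and ran: "\<And>x. x \<in> K \<Longrightarrow> - a \<le> l x \<and> l x \<le> b"
    and mean: "(LINT x:K|lborel. l x) = 0"
  shows "(LINT x:K|lborel. (l x)\<^sup>2) \<le> (a + \<epsilon>) * (b + \<epsilon>) / 3 * measure lborel K"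
proof -
  define A B where "A = a + \<epsilon>" and "B = b + \<epsilon>"
  have AB: "0 < A" "0 < B" using assms by (auto simp: A_def B_def)
  have [measurable]: "K \<in> sets borel" using K by (intro borel_compact)
  have [measurable]: "l \<in> borel_measurable borel"
    using l by (intro borel_measurable_continuous_onI)
  define k where "k u = max 0 (\<epsilon>\<^sup>2 - u\<^sup>2)" for u :: real
  have k0: "0 \<le> k u" "k u \<le> \<epsilon>\<^sup>2" for u by (auto simp: k_def)
  have kcont: "continuous_on X k" for X unfolding k_def by (intro continuous_intros)
  have [measurable]: "k \<in> borel_measurable borel"
    by (intro borel_measurable_continuous_onI kcont)
  have ksupp: "k u = 0" if "u \<notin> {- \<epsilon>..\<epsilon>}" for u
  proof -
    have "\<epsilon> \<le> \<bar>u\<bar>" using that by auto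
    then have "\<epsilon>\<^sup>2 \<le> u\<^sup>2" using \<open>0 < \<epsilon>\<close> by (metis abs_le_square_iff abs_of_pos)
    then show ?thesis by (simp add: k_def)
  qed
  have kint: "integrable lborel (\<lambda>u. \<phi> u * k u)" if "continuous_on UNIV \<phi>" for \<phi> :: "real \<Rightarrow> real"
  proof -
    have "integrable lborel (\<lambda>u. indicator {- \<epsilon>..\<epsilon>} u *\<^sub>R (\<phi> u * k u))"
      by (intro borel_integrable_compact continuous_intros kcont continuous_on_subset[OF that]) auto
    also have "(\<lambda>u. indicator {- \<epsilon>..\<epsilon>} u *\<^sub>R (\<phi> u * k u)) = (\<lambda>u. \<phi> u * k u)"
      using ksupp by (auto simp: indicator_def fun_eq_iff)
    finally show ?thesis .
  qed
  define \<kappa> where "\<kappa> j = (\<integral>u. u ^ j * k u \<partial>lborel)" for j :: nat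
  have kint': "integrable lborel (\<lambda>u. u ^ j * k u)" for j
    by (intro kint continuous_intros)
  have \<kappa>0: "0 < \<kappa> 0"
  proof -
    have "\<epsilon>\<^sup>2 / 2 * \<epsilon> = (\<integral>u. \<epsilon>\<^sup>2 / 2 * indicator {- \<epsilon>/2..\<epsilon>/2} u \<partial>lborel)"
      using \<open>0 < \<epsilon>\<close> by simp
    also have "\<dots> \<le> \<kappa> 0" unfolding \<kappa>_def
    proof (rule integral_mono)
      show "integrable lborel (\<lambda>u. u ^ 0 * k u)" by (rule kint')
      fix u :: real
      have "\<epsilon>\<^sup>2 / 2 \<le> k u" if "u \<in> {- \<epsilon>/2..\<epsilon>/2}"
      proof -
        have "\<bar>u\<bar> \<le> \<bar>\<epsilon>/2\<bar>" using that by auto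
        then have "u\<^sup>2 \<le> (\<epsilon>/2)\<^sup>2" by (metis abs_le_square_iff)
        moreover have "(\<epsilon>/2)\<^sup>2 \<le> \<epsilon>\<^sup>2 / 2" by (simp add: power_divide)
        ultimately have "\<epsilon>\<^sup>2 / 2 \<le> \<epsilon>\<^sup>2 - u\<^sup>2" by linarith
        then show ?thesis unfolding k_def by (rule order_trans) simp
      qed
      then show "\<epsilon>\<^sup>2 / 2 * indicator {- \<epsilon>/2..\<epsilon>/2} u \<le> u ^ 0 * k u"
        using k0[of u] by (auto simp: indicator_def)
    qed (intro integrable_mult_right integrable_real_indicator, auto simp: emeasure_lborel_Icc_eq)
    finally show ?thesis by (rule less_le_trans[rotated]) (use \<open>0 < \<epsilon>\<close> in simp)
  qed
  have \<kappa>1: "\<kappa> 1 = 0"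
  proof -
    have "\<kappa> 1 = - \<kappa> 1"
      using lborel_integral_real_affine[of "-1" "\<lambda>u. u * k u" 0]
      by (simp add: \<kappa>_def k_def)
    then show ?thesis by simp
  qed
  have \<kappa>2: "0 \<le> \<kappa> 2" unfolding \<kappa>_def
    by (intro Bochner_Integration.integral_nonneg) (use k0 in auto)
  define f where "f t = (LINT x:K|lborel. k (t - l x))" for t
  have fint: "set_integrable lborel K (\<lambda>x. k (t - l x))" for t
    by (intro set_integrable_continuous_compact K continuous_on_compose2[OF kcont] continuous_intros
        continuous_on_subset[OF l(1)]) auto
  have f0: "0 \<le> f t" for t
    unfolding f_def set_lebesgue_integral_def
    by (intro Bochner_Integration.integral_nonneg) (use k0 in auto)
  have fsupp: "f t = 0" if "t \<notin> {- A..B}" for t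
  proof -
    have "k (t - l x) = 0" if "x \<in> K" for x
      using ran[OF that] \<open>t \<notin> {- A..B}\<close> by (intro ksupp) (auto simp: A_def B_def)
    then have "f t = (LINT x:K|lborel. 0)"
      unfolding f_def by (intro set_lebesgue_integral_cong) auto
    then show ?thesis by (simp add: set_lebesgue_integral_def)
  qed
  have fcont: "continuous_on X f" for X
  proof (rule continuous_on_sequentiallyI)
    fix u t assume "u \<longlonglongrightarrow> (t::real)"
    have "(\<lambda>n. \<integral>x. indicator K x *\<^sub>R k (u n - l x) \<partial>lborel) \<longlonglongrightarrow> (\<integral>x. indicator K x *\<^sub>R k (t - l x) \<partial>lborel)"
    proof (rule integral_dominated_convergence[where w = "\<lambda>x. indicator K x * \<epsilon>\<^sup>2"])
      show "integrable lborel (\<lambda>x. indicator K x * \<epsilon>\<^sup>2)"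
        using emeasure_compact_finite[OF K(1)] by (intro integrable_mult_left integrable_real_indicator) auto
      show "AE x in lborel. (\<lambda>n. indicator K x *\<^sub>R k (u n - l x)) \<longlonglongrightarrow> indicator K x *\<^sub>R k (t - l x)"
        by (intro AE_I2 tendsto_scaleR tendsto_const
             continuous_on_tendsto_compose[OF kcont[of UNIV]] tendsto_diff \<open>u \<longlonglongrightarrow> t\<close>) auto
      show "AE x in lborel. norm (indicator K x *\<^sub>R k (u n - l x)) \<le> indicator K x * \<epsilon>\<^sup>2" for n
        using k0 by (intro AE_I2) (auto simp: indicator_def)
    qed measurable
    then show "(\<lambda>n. f (u n)) \<longlonglongrightarrow> f t"
      by (simp add: f_def set_lebesgue_integral_def)
  qed
  have fnn: "ennreal (f t) = (\<integral>\<^sup>+x. ennreal (indicator K x * k (t - l x)) \<partial>lborel)" for t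
    unfolding f_def set_lebesgue_integral_def real_scaleR_def
    by (rule nn_integral_eq_integral[symmetric])
       (use fint[of t] k0 in \<open>auto simp: set_integrable_def\<close>)
  have fmid: "f s * f t \<le> (f ((s + t) / 2))\<^sup>2" for s t
  proof -
    have "ennreal (f s) * ennreal (f t) \<le> (ennreal (f ((s + t) / 2)))\<^sup>2"
      unfolding fnn
    proof (rule prekopa_leindler)
      fix x y :: 'a
      define z where "z = (1/2) *\<^sub>R (x + y)"
      have "indicator K x * k (s - l x) * (indicator K y * k (t - l y))
          \<le> (indicator K z * k ((s + t) / 2 - l z))\<^sup>2"
      proof (cases "x \<in> K \<and> y \<in> K")
        case True
        then have "z \<in> K"
          using convexD[OF K(2), of x y "1/2" "1/2"] by (simp add: z_def scaleR_add_right)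
        have "(s + t) / 2 - l z = ((s - l x) + (t - l y)) / 2"
          unfolding z_def l(2) by (simp add: field_simps)
        then have "k (s - l x) * k (t - l y) \<le> (k ((s + t) / 2 - l z))\<^sup>2"
          unfolding k_def using parabola_kernel_midpoint[of \<epsilon> "s - l x" "t - l y"] by metis
        then show ?thesis using True \<open>z \<in> K\<close> by simp
      qed auto
      then show "ennreal (indicator K x * k (s - l x)) * ennreal (indicator K y * k (t - l y))
        \<le> (ennreal (indicator K ((1/2) *\<^sub>R (x + y)) * k ((s + t) / 2 - l ((1/2) *\<^sub>R (x + y)))))\<^sup>2"
        using k0 by (simp add: z_def ennreal_mult'[symmetric] ennreal_power ennreal_leI)
    qed measurable
    then show ?thesis
      using f0 by (simp add: ennreal_mult'[symmetric] ennreal_power)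
  qed
  have moment: "((\<lambda>t. t ^ j * f t) has_integral (LINT x:K|lborel. (\<integral>u. (l x + u) ^ j * k u \<partial>lborel))) {- A..B}" for j
  proof -
    define g where "g x t = indicator K x * (t ^ j * k (t - l x))" for x :: 'a and t
    have "continuous_on {- A..B} (\<lambda>t::real. t ^ j)" by (intro continuous_intros)
    then have "bounded ((\<lambda>t::real. t ^ j) ` {- A..B})"
      by (intro compact_imp_bounded compact_continuous_image) auto
    then obtain C where "\<forall>y\<in>(\<lambda>t::real. t ^ j) ` {- A..B}. norm y \<le> C"
      unfolding bounded_iff by blast
    then have C: "\<bar>t ^ j\<bar> \<le> C" if "t \<in> {- A..B}" for t using that by force
    have "0 \<le> C" using order_trans[OF abs_ge_zero C[of 0]] AB by auto
    have gint: "integrable (lborel \<Otimes>\<^sub>M lborel) (case_prod g)"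
    proof (rule integrableI_bounded_set[where A = "K \<times> {- A..B}" and B = "C * \<epsilon>\<^sup>2"])
      show "K \<times> {- A..B} \<in> sets (lborel \<Otimes>\<^sub>M lborel)" by auto
      show "case_prod g \<in> borel_measurable (lborel \<Otimes>\<^sub>M lborel)" unfolding g_def by measurable
      show "emeasure (lborel \<Otimes>\<^sub>M lborel) (K \<times> {- A..B}) < \<infinity>"
        using emeasure_compact_finite[OF K(1)]
        by (subst lborel.emeasure_pair_measure_Times) (auto simp: ennreal_mult_less_top emeasure_lborel_Icc_eq)
      show "AE x in lborel \<Otimes>\<^sub>M lborel. x \<in> K \<times> {- A..B} \<longrightarrow> norm (case_prod g x) \<le> C * \<epsilon>\<^sup>2"
        using C k0 \<open>0 \<le> C\<close> by (intro AE_I2) (auto simp: g_def abs_mult intro!: mult_mono)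
      show "AE x in lborel \<Otimes>\<^sub>M lborel. x \<notin> K \<times> {- A..B} \<longrightarrow> case_prod g x = 0"
      proof (intro AE_I2 impI)
        fix x assume x: "x \<notin> K \<times> {- A..B}"
        show "case_prod g x = 0"
        proof (cases "fst x \<in> K")
          case True
          then have "k (snd x - l (fst x)) = 0"
            using x ran[OF True] by (intro ksupp) (auto simp: A_def B_def mem_Times_iff)
          then show ?thesis by (simp add: g_def case_prod_unfold)
        qed (simp add: g_def case_prod_unfold)
      qed
    qed
    have inner: "(\<integral>x. g x t \<partial>lborel) = t ^ j * f t" for t
    proof -
      have "(\<integral>x. g x t \<partial>lborel) = (\<integral>x. t ^ j * (indicator K x *\<^sub>R k (t - l x)) \<partial>lborel)"
        by (intro Bochner_Integration.integral_cong) (auto simp: g_def)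
      then show ?thesis by (simp add: f_def set_lebesgue_integral_def)
    qed
    have outer: "(\<integral>t. g x t \<partial>lborel) = indicator K x *\<^sub>R (\<integral>u. (l x + u) ^ j * k u \<partial>lborel)" for x
      using lborel_integral_real_affine[of 1 "\<lambda>t. t ^ j * k (t - l x)" "l x"]
      by (simp add: g_def)
    have "integrable lborel (\<lambda>t. t ^ j * f t)"
      using lborel_pair.integrable_snd[OF gint] by (simp add: inner)
    then have h: "((\<lambda>t. t ^ j * f t) has_integral (\<integral>t. t ^ j * f t \<partial>lborel)) UNIV"
      by (rule has_integral_integral_lborel)
    have eq: "(\<lambda>t. t ^ j * f t) = (\<lambda>t. if t \<in> {- A..B} then t ^ j * f t else 0)"
      using fsupp by auto
    have "((\<lambda>t. t ^ j * f t) has_integral (\<integral>t. t ^ j * f t \<partial>lborel)) {- A..B}"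
      by (subst has_integral_restrict_UNIV[symmetric], subst eq[symmetric]) (rule h)
    also have "(\<integral>t. t ^ j * f t \<partial>lborel) = (LINT x:K|lborel. (\<integral>u. (l x + u) ^ j * k u \<partial>lborel))"
      using lborel_pair.Fubini_integral[OF gint]
      by (simp add: inner outer set_lebesgue_integral_def)
    finally show ?thesis .
  qed
  have lint: "set_integrable lborel K (\<lambda>x. (l x) ^ j)" for j
    by (intro set_integrable_continuous_compact K continuous_intros continuous_on_subset[OF l(1)]) auto
  have vol: "(LINT x:K|lborel. c) = c * measure lborel K" for c :: real
    by (simp add: set_lebesgue_integral_def)
  have I0: "integral {- A..B} f = \<kappa> 0 * measure lborel K"
    using integral_unique[OF moment[of 0]] by (simp add: vol \<kappa>_def)
  have "(\<integral>u. (l x + u) ^ 1 * k u \<partial>lborel) = \<kappa> 0 * l x" for x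
    using kint'[of 0] kint'[of 1] \<kappa>1 by (simp add: distrib_right \<kappa>_def)
  then have I1: "integral {- A..B} (\<lambda>t. t * f t) = 0"
    using integral_unique[OF moment[of 1]] mean by simp
  have "(\<integral>u. (l x + u) ^ 2 * k u \<partial>lborel) = \<kappa> 0 * (l x)\<^sup>2 + \<kappa> 2" for x
  proof -
    have "(\<integral>u. (l x + u) ^ 2 * k u \<partial>lborel)
      = (\<integral>u. (l x)\<^sup>2 * (u ^ 0 * k u) + 2 * l x * (u ^ 1 * k u) + u ^ 2 * k u \<partial>lborel)"
      by (intro Bochner_Integration.integral_cong) (auto simp: power2_eq_square algebra_simps)
    also have "\<dots> = (l x)\<^sup>2 * \<kappa> 0 + 2 * l x * \<kappa> 1 + \<kappa> 2"
      unfolding \<kappa>_def using kint'[of 0] kint'[of 1] kint'[of 2]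
      by (subst Bochner_Integration.integral_add, simp, simp, subst Bochner_Integration.integral_add, simp, simp) simp
    finally show ?thesis using \<kappa>1 by simp
  qed
  then have I2: "integral {- A..B} (\<lambda>t. t\<^sup>2 * f t) = \<kappa> 0 * (LINT x:K|lborel. (l x)\<^sup>2) + \<kappa> 2 * measure lborel K"
    using integral_unique[OF moment[of 2]] lint[of 2]
      set_integrable_continuous_compact[OF K(1), of "\<lambda>_. \<kappa> 2"]
    by (simp add: set_integral_add(2) vol)
  have "integral {- A..B} (\<lambda>t. t\<^sup>2 * f t) \<le> A * B / 3 * integral {- A..B} f"
    by (rule log_concave_second_moment_le[OF AB fcont f0 fmid I1])
  then have "\<kappa> 0 * (LINT x:K|lborel. (l x)\<^sup>2) \<le> \<kappa> 0 * (A * B / 3 * measure lborel K)"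
    using \<kappa>2 unfolding I0 I2 by (smt (verit) mult.left_commute mult_nonneg_nonneg measure_nonneg)
  then show ?thesis using \<kappa>0 by (simp add: A_def B_def)
qed

text \<open>The estimate for the smoothed marginal, in the limit of a vanishing smoothing radius.\<close>

theorem convex_second_moment_le:
  fixes K :: "'a::euclidean_space set"
  assumes K: "compact K" "convex K" and ab: "0 \<le> a" "0 \<le> b"
    and ran: "\<And>x. x \<in> K \<Longrightarrow> m - a \<le> x \<bullet> v \<and> x \<bullet> v \<le> m + b"
    and mean: "(LINT x:K|lborel. x \<bullet> v - m) = 0"
  shows "(LINT x:K|lborel. (x \<bullet> v - m)\<^sup>2) \<le> a * b / 3 * measure lborel K"
proof (rule tendsto_lowerbound)
  show "((\<lambda>\<epsilon>. (a + \<epsilon>) * (b + \<epsilon>) / 3 * measure lborel K) \<longlongrightarrow> a * b / 3 * measure lborel K) (at_right 0)"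
    by (auto intro!: tendsto_eq_intros)
  show "\<forall>\<^sub>F \<epsilon> in at_right 0. (LINT x:K|lborel. (x \<bullet> v - m)\<^sup>2) \<le> (a + \<epsilon>) * (b + \<epsilon>) / 3 * measure lborel K"
    unfolding eventually_at_right_field
  proof (intro exI[of _ 1] conjI allI impI)
    fix \<epsilon> :: real assume \<epsilon>: "0 < \<epsilon>"
    show "(LINT x:K|lborel. (x \<bullet> v - m)\<^sup>2) \<le> (a + \<epsilon>) * (b + \<epsilon>) / 3 * measure lborel K"
    proof (rule smoothed_second_moment_le[OF K ab \<epsilon> _ _ _ mean])
      show "continuous_on UNIV (\<lambda>x. x \<bullet> v - m)" by (intro continuous_intros)
      show "- a \<le> x \<bullet> v - m \<and> x \<bullet> v - m \<le> b" if "x \<in> K" for x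
        using ran[OF that] by auto
      show "(1/2) *\<^sub>R (x + y) \<bullet> v - m = ((x \<bullet> v - m) + (y \<bullet> v - m)) / 2" for x y
        by (simp add: inner_add_left add_divide_distrib diff_divide_distrib)
    qed
  qed auto
qed auto

section \<open>Lower bound for the variance of a convex body\<close>

lemma lborel_integral_affine:
  fixes f :: "'a::euclidean_space \<Rightarrow> real"
  assumes [measurable]: "f \<in> borel_measurable borel" and c: "0 < c"
  shows "(\<integral>x. f x \<partial>lborel) = c ^ DIM('a) * (\<integral>x. f (t + c *\<^sub>R x) \<partial>lborel)"
  by (subst lborel_affine[of c t]) (use c in \<open>auto simp: integral_density integral_distr\<close>)

lemma nn_integral_lborel_affine:
  fixes f :: "'a::euclidean_space \<Rightarrow> ennreal"
  assumes [measurable]: "f \<in> borel_measurable borel" and c: "0 < c"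
  shows "(\<integral>\<^sup>+x. f x \<partial>lborel) = ennreal (c ^ DIM('a)) * (\<integral>\<^sup>+x. f (t + c *\<^sub>R x) \<partial>lborel)"
  by (subst lborel_affine[of c t]) (use c in \<open>auto simp: nn_integral_density nn_integral_distr nn_integral_cmult ennreal_power\<close>)

lemma set_integrable_continuous_bounded:
  fixes f :: "'a::euclidean_space \<Rightarrow> real"
  assumes "bounded K" "K \<in> sets borel" "continuous_on UNIV f"
  shows "set_integrable lborel K f"
proof (rule set_integrable_subset)
  show "set_integrable lborel (closure K) f"
    using assms by (intro set_integrable_continuous_compact continuous_on_subset[OF assms(3)]) auto
qed (use assms closure_subset in auto)

text \<open>Let \<open>\<Phi> t = \<alpha> + \<beta> t + \<gamma> t\<^sup>2\<close>. The contraction of \<open>K\<close> towards \<open>p\<close> by a factor \<open>c < 1\<close>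
stays in \<open>K\<close>, so the integral of \<open>\<Phi>\<close> over it is at most the integral over \<open>K\<close>. The
integral over the contracted set is a polynomial in \<open>c\<close> whose derivative at \<open>1\<close> is therefore
non-negative, and this derivative is the stated integral.\<close>

lemma star_shaped_moment_inequality:
  fixes K :: "'a::euclidean_space set" and p v :: 'a
  assumes K: "bounded K" "K \<in> sets borel"
    and star: "\<And>x c. x \<in> K \<Longrightarrow> 0 < c \<Longrightarrow> c < 1 \<Longrightarrow> p + c *\<^sub>R (x - p) \<in> K"
    and nonneg: "\<And>x. x \<in> K \<Longrightarrow> 0 \<le> \<alpha> + \<beta> * ((x - p) \<bullet> v) + \<gamma> * ((x - p) \<bullet> v)\<^sup>2"
  defines "d \<equiv> real DIM('a)"
  shows "0 \<le> (LINT x:K|lborel. d * \<alpha> + (d + 1) * \<beta> * ((x - p) \<bullet> v) + (d + 2) * \<gamma> * ((x - p) \<bullet> v)\<^sup>2)"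
proof -
  define h where "h x = (x - p) \<bullet> v" for x
  have h: "continuous_on UNIV (\<lambda>x. h x ^ j)" for j unfolding h_def by (intro continuous_intros)
  have [measurable]: "h \<in> borel_measurable borel" unfolding h_def by measurable
  note K(2)[measurable]
  define \<Phi> where "\<Phi> t = \<alpha> + \<beta> * t + \<gamma> * t\<^sup>2" for t
  have [measurable]: "\<Phi> \<in> borel_measurable borel" unfolding \<Phi>_def by measurable
  define M where "M j = (LINT x:K|lborel. h x ^ j)" for j :: nat
  have int: "set_integrable lborel K (\<lambda>x. h x ^ j)" for j
    by (rule set_integrable_continuous_bounded[OF K h])
  have lin: "(LINT x:K|lborel. a + b * h x + c * (h x)\<^sup>2) = a * M 0 + b * M 1 + c * M 2" for a b c
  proof -
    have 1: "set_integrable lborel K (\<lambda>x. a)" "set_integrable lborel K (\<lambda>x. b * h x)"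
      "set_integrable lborel K (\<lambda>x. c * (h x)\<^sup>2)"
      using int[of 0] int[of 1] int[of 2] set_integrable_mult_right[of a lborel K "\<lambda>_. 1"] by auto
    have "(LINT x:K|lborel. a) = a * M 0" by (simp add: M_def set_lebesgue_integral_def)
    then show ?thesis
      using 1 by (simp add: set_integral_add M_def)
  qed
  define J where "J c = c ^ DIM('a) * (\<alpha> * M 0 + \<beta> * c * M 1 + \<gamma> * c\<^sup>2 * M 2)" for c
  have J: "J c = (\<integral>x. indicator K (p + (1/c) *\<^sub>R (x - p)) * \<Phi> (h x) \<partial>lborel)" if "0 < c" for c
  proof -
    have "(\<integral>x. indicator K (p + (1/c) *\<^sub>R (x - p)) * \<Phi> (h x) \<partial>lborel)
      = c ^ DIM('a) * (\<integral>x. indicator K x * \<Phi> (c * h x) \<partial>lborel)"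
      using that
      by (subst lborel_integral_affine[of _ c "p - c *\<^sub>R p"], measurable)
         (auto simp: h_def algebra_simps inner_diff_left)
    also have "(\<integral>x. indicator K x * \<Phi> (c * h x) \<partial>lborel)
        = (LINT x:K|lborel. \<alpha> + (\<beta> * c) * h x + (\<gamma> * c\<^sup>2) * (h x)\<^sup>2)"
      by (simp add: set_lebesgue_integral_def \<Phi>_def power_mult_distrib mult_ac)
    finally show ?thesis unfolding lin J_def by simp
  qed
  have le: "J c \<le> J 1" if "0 < c" "c < 1" for c
    unfolding J[OF that(1)] J[OF zero_less_one]
  proof (rule integral_mono')
    have "set_integrable lborel K (\<lambda>x. \<Phi> (h x))"
      unfolding \<Phi>_def h_def by (intro set_integrable_continuous_bounded K continuous_intros)
    then show "integrable lborel (\<lambda>x. indicator K (p + (1/1) *\<^sub>R (x - p)) * \<Phi> (h x))"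
      by (simp add: set_integrable_def)
    fix x
    have pos: "0 \<le> \<Phi> (h x)" if "x \<in> K" using nonneg[OF that] by (simp add: \<Phi>_def h_def)
    show "0 \<le> indicator K (p + (1/1) *\<^sub>R (x - p)) * \<Phi> (h x)"
      using pos by (auto simp: indicator_def)
    have "x \<in> K" if "p + (1/c) *\<^sub>R (x - p) \<in> K"
      using star[OF that \<open>0 < c\<close> \<open>c < 1\<close>] \<open>0 < c\<close> by simp
    then show "indicator K (p + (1/c) *\<^sub>R (x - p)) * \<Phi> (h x) \<le> indicator K (p + (1/1) *\<^sub>R (x - p)) * \<Phi> (h x)"
      using pos by (auto simp: indicator_def)
  qed
  have DJ: "(J has_real_derivative (d * \<alpha> * M 0 + (d + 1) * \<beta> * M 1 + (d + 2) * \<gamma> * M 2)) (at 1)"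
    unfolding J_def d_def by (auto intro!: derivative_eq_intros simp: algebra_simps)
  have "0 \<le> d * \<alpha> * M 0 + (d + 1) * \<beta> * M 1 + (d + 2) * \<gamma> * M 2"
  proof (rule ccontr)
    assume "\<not> 0 \<le> d * \<alpha> * M 0 + (d + 1) * \<beta> * M 1 + (d + 2) * \<gamma> * M 2"
    then obtain e where e: "0 < e" "\<And>h. 0 < h \<Longrightarrow> h < e \<Longrightarrow> J 1 < J (1 - h)"
      using DERIV_neg_dec_left[OF DJ] by auto
    define h where "h = min (e/2) (1/2)"
    have "0 < h" "h < e" "h < 1" using e(1) by (auto simp: h_def)
    then show False using e(2)[of h] le[of "1 - h"] by auto
  qed
  then show ?thesis
    using lin[of "d * \<alpha>" "(d + 1) * \<beta>" "(d + 2) * \<gamma>"] by (simp add: h_def)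
qed

text \<open>The extremal bodies are double cones with apexes \<open>p\<close> and \<open>q\<close> over a common base at height
\<open>m + s\<close>, where \<open>s = (a - b) / (d - 1)\<close> is the height that puts the centroid at \<open>m\<close>. A quadratic
\<open>\<psi>\<close> is chosen whose integral over each of the two cones vanishes. Below height \<open>m + s\<close> the body
is star-shaped about \<open>p\<close>, above it about \<open>q\<close>, and the moment inequality for star-shaped sets shows
that the integral of \<open>\<psi>\<close> over each part is non-negative. Together the parts bound the variance
below by that of the double cone, which is at least \<open>2 a b / ((d + 1) (d + 2))\<close>.\<close>

theorem convex_second_moment_ge:
  fixes K :: "'a::euclidean_space set"
  assumes K: "compact K" "convex K" and vol: "0 < measure lborel K" and d2: "2 \<le> DIM('a)"
    and pq: "p \<in> K" "p \<bullet> v = m - a" "q \<in> K" "q \<bullet> v = m + b"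
    and ran: "\<And>x. x \<in> K \<Longrightarrow> m - a \<le> x \<bullet> v \<and> x \<bullet> v \<le> m + b"
    and mean: "(LINT x:K|lborel. x \<bullet> v - m) = 0"
  defines "d \<equiv> real DIM('a)"
  shows "2 * a * b / ((d + 1) * (d + 2)) * measure lborel K \<le> (LINT x:K|lborel. (x \<bullet> v - m)\<^sup>2)"
proof -
  define V where "V = measure lborel K"
  define l where "l x = x \<bullet> v - m" for x
  have d: "2 \<le> d" using d2 by (simp add: d_def)
  have [measurable]: "K \<in> sets borel" using K by (intro borel_compact)
  have [measurable]: "l \<in> borel_measurable borel" unfolding l_def by measurable
  have lcont: "continuous_on X l" for X unfolding l_def by (intro continuous_intros)
  have bK: "bounded K" using K compact_imp_bounded by auto
  define M where "M = (LINT x:K|lborel. (l x)\<^sup>2)"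
  have hp: "(x - p) \<bullet> v = l x + a" and hq: "(x - q) \<bullet> (- v) = b - l x" for x
    using pq by (auto simp: l_def inner_diff_left)
  have ran': "- a \<le> l x" "l x \<le> b" "0 \<le> a + l x"
    if "x \<in> K" for x using ran[OF that] by (auto simp: l_def)
  have seg: "z + c *\<^sub>R (x - z) \<in> K" if "z \<in> K" "x \<in> K" "0 < c" "c < 1" for x z c
    using convexD_alt[OF K(2) that(1,2), of c] that(3,4) by (simp add: algebra_simps)
  have seg_p: "l (p + c *\<^sub>R (x - p)) = (1 - c) * (- a) + c * l x"
    and seg_q: "l (q + c *\<^sub>R (x - q)) = (1 - c) * b + c * l x" for c x
    using pq by (auto simp: l_def inner_add_left inner_diff_left algebra_simps)
  have lin: "(LINT x:K|lborel. A + B * l x + C * (l x)\<^sup>2) = A * V + C * M" for A B C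
  proof -
    have 1: "set_integrable lborel K (\<lambda>x. A)" "set_integrable lborel K (\<lambda>x. B * l x)"
      "set_integrable lborel K (\<lambda>x. C * (l x)\<^sup>2)"
      by (intro set_integrable_continuous_compact K continuous_intros lcont)+
    have "(LINT x:K|lborel. A) = A * V" by (simp add: V_def set_lebesgue_integral_def)
    moreover have "(LINT x:K|lborel. B * l x) = 0" using mean by (simp add: l_def)
    ultimately show ?thesis
      using 1 by (simp add: set_integral_add M_def)
  qed
  \<comment> \<open>The choice \<open>\<Phi> t = a + b - t\<close> gives the classical bound \<open>a \<le> d b\<close> for the position of the centroid.\<close>
  have "0 \<le> (LINT x:K|lborel. d * (a + b) + (d + 1) * (-1) * ((x - p) \<bullet> v) + (d + 2) * 0 * ((x - p) \<bullet> v)\<^sup>2)"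
    unfolding d_def by (rule star_shaped_moment_inequality) (use bK seg pq ran' in \<open>auto simp: hp\<close>)
  also have "\<dots> = (LINT x:K|lborel. (d * b - a) + (- (d + 1)) * l x + 0 * (l x)\<^sup>2)"
    unfolding hp by (simp add: algebra_simps)
  also have "\<dots> = (d * b - a) * V" unfolding lin by simp
  finally have adb: "a \<le> d * b" using vol by (simp add: zero_le_mult_iff V_def)
  have "0 \<le> (LINT x:K|lborel. d * (a + b) + (d + 1) * (-1) * ((x - q) \<bullet> (- v)) + (d + 2) * 0 * ((x - q) \<bullet> (- v))\<^sup>2)"
    unfolding d_def by (rule star_shaped_moment_inequality) (use bK seg pq ran' in \<open>auto simp: hq simp del: inner_minus_right\<close>)
  also have "\<dots> = (LINT x:K|lborel. (d * a - b) + (d + 1) * l x + 0 * (l x)\<^sup>2)"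
    unfolding hq by (simp add: algebra_simps)
  also have "\<dots> = (d * a - b) * V" unfolding lin by simp
  finally have bda: "b \<le> d * a" using vol by (simp add: zero_le_mult_iff V_def)
  define s where "s = (a - b) / (d - 1)"
  \<comment> \<open>\<open>c\<close> is the variance of the extremal double cone, and \<open>\<psi> / (d + 2)\<close> is \<open>t\<^sup>2 - c\<close> up to a linear term.\<close>
  define c where "c = (a\<^sup>2 + b\<^sup>2 + (d - 1) * s\<^sup>2) / ((d + 1) * (d + 2))"
  define \<psi> where "\<psi> t = (d + 2) * (- c) + (- 2 * s) * t + (d + 2) * t\<^sup>2" for t
  have [measurable]: "\<psi> \<in> borel_measurable borel" unfolding \<psi>_def by measurable
  \<comment> \<open>\<open>\<psi>\<close> comes from \<open>\<Phi> h = (s + a - h) (r1 - h)\<close> about \<open>p\<close>, and symmetrically about \<open>q\<close>.\<close>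
  define r1 r2 where "r1 = ((d + 2) * a + b) / (d + 1)" and "r2 = ((d + 2) * b + a) / (d + 1)"
  have s: "a = b + (d - 1) * s" using d by (simp add: s_def)
  have e1: "(d + 1) * r1 = (d + 2) * a + b" and e2: "(d + 1) * r2 = (d + 2) * b + a"
    and ec: "(d + 1) * (d + 2) * c = a\<^sup>2 + b\<^sup>2 + (d - 1) * s\<^sup>2"
    using d by (auto simp: r1_def r2_def c_def)
  have 1: "\<psi> t = d * ((s + a) * r1) + (d + 1) * (- (s + a + r1)) * (t + a) + (d + 2) * 1 * (t + a)\<^sup>2" for t
  proof -
    have "(d + 1) * (d * ((s + a) * r1) + (d + 1) * (- (s + a + r1)) * (t + a) + (d + 2) * 1 * (t + a)\<^sup>2)
       = d * (s + a) * ((d + 2) * a + b) - (d + 1) * ((d + 1) * (s + a) + ((d + 2) * a + b)) * (t + a) + (d + 1) * (d + 2) * (t + a)\<^sup>2"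
      using e1 by algebra
    also have "\<dots> = - (a\<^sup>2 + b\<^sup>2 + (d - 1) * s\<^sup>2) - (d + 1) * 2 * s * t + (d + 1) * (d + 2) * t\<^sup>2"
      unfolding s by algebra
    also have "\<dots> = (d + 1) * \<psi> t"
      unfolding \<psi>_def using ec by algebra
    finally show ?thesis using d by simp
  qed
  have 2: "\<psi> t = d * ((b - s) * r2) + (d + 1) * (- (b - s + r2)) * (b - t) + (d + 2) * 1 * (b - t)\<^sup>2" for t
  proof -
    have "(d + 1) * (d * ((b - s) * r2) + (d + 1) * (- (b - s + r2)) * (b - t) + (d + 2) * 1 * (b - t)\<^sup>2)
       = d * (b - s) * ((d + 2) * b + a) - (d + 1) * ((d + 1) * (b - s) + ((d + 2) * b + a)) * (b - t) + (d + 1) * (d + 2) * (b - t)\<^sup>2"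
      using e2 by algebra
    also have "\<dots> = - (a\<^sup>2 + b\<^sup>2 + (d - 1) * s\<^sup>2) - (d + 1) * 2 * s * t + (d + 1) * (d + 2) * t\<^sup>2"
      unfolding s by algebra
    also have "\<dots> = (d + 1) * \<psi> t"
      unfolding \<psi>_def using ec by algebra
    finally show ?thesis using d by simp
  qed
  have sa: "- a \<le> s" "s \<le> b" using d adb bda by (auto simp: s_def field_simps)
  have r1: "s + a \<le> r1"
  proof -
    have "(d - 1) * (d + 1) * (r1 - (s + a)) = 2 * (d * b - a)"
      using e1 s by algebra
    then have "0 \<le> (d - 1) * (d + 1) * (r1 - (s + a))" using adb by simp
    moreover have "0 < (d - 1) * (d + 1)" using d by simp
    ultimately show ?thesis by (simp add: zero_le_mult_iff)
  qed
  have r2: "b - s \<le> r2"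
  proof -
    have "(d - 1) * (d + 1) * (r2 - (b - s)) = 2 * (d * a - b)"
      using e2 s by algebra
    then have "0 \<le> (d - 1) * (d + 1) * (r2 - (b - s))" using bda by simp
    moreover have "0 < (d - 1) * (d + 1)" using d by simp
    ultimately show ?thesis by (simp add: zero_le_mult_iff)
  qed
  define K1 K2 where "K1 = K \<inter> {x. l x \<le> s}" and "K2 = K \<inter> {x. s < l x}"
  have [measurable]: "K1 \<in> sets borel" "K2 \<in> sets borel" unfolding K1_def K2_def by measurable
  have b12: "bounded K1" "bounded K2" using bK by (auto simp: K1_def K2_def intro: bounded_subset)
  have "0 \<le> (LINT x:K1|lborel. d * ((s + a) * r1) + (d + 1) * (- (s + a + r1)) * ((x - p) \<bullet> v) + (d + 2) * 1 * ((x - p) \<bullet> v)\<^sup>2)"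
    unfolding d_def
  proof (rule star_shaped_moment_inequality)
    show "p + c *\<^sub>R (x - p) \<in> K1" if "x \<in> K1" "0 < c" "c < 1" for x c
    proof -
      have "(1 - c) * (- a) + c * l x \<le> (1 - c) * s + c * s"
        using that sa by (intro add_mono mult_left_mono) (auto simp: K1_def)
      also have "\<dots> = s" by (simp add: algebra_simps)
      finally have "l (p + c *\<^sub>R (x - p)) \<le> s" unfolding seg_p .
      then show ?thesis using that seg[OF pq(1), of x c] by (simp add: K1_def)
    qed
    show "0 \<le> (s + a) * r1 + - (s + a + r1) * ((x - p) \<bullet> v) + 1 * ((x - p) \<bullet> v)\<^sup>2" if "x \<in> K1" for x
    proof -
      have "0 \<le> (s + a - (l x + a)) * (r1 - (l x + a))"
        using that r1 by (intro mult_nonneg_nonneg) (auto simp: K1_def)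
      then show ?thesis unfolding hp by (simp add: algebra_simps power2_eq_square)
    qed
  qed (use b12 in auto)
  then have 3: "0 \<le> (LINT x:K1|lborel. \<psi> (l x))" unfolding 1 hp .
  have "0 \<le> (LINT x:K2|lborel. d * ((b - s) * r2) + (d + 1) * (- (b - s + r2)) * ((x - q) \<bullet> (- v)) + (d + 2) * 1 * ((x - q) \<bullet> (- v))\<^sup>2)"
    unfolding d_def
  proof (rule star_shaped_moment_inequality)
    show "q + c *\<^sub>R (x - q) \<in> K2" if "x \<in> K2" "0 < c" "c < 1" for x c
    proof -
      have "s = (1 - c) * s + c * s" by (simp add: algebra_simps)
      also have "\<dots> < (1 - c) * b + c * l x"
        using that sa by (intro add_le_less_mono mult_left_mono mult_strict_left_mono) (auto simp: K2_def)
      finally have "s < l (q + c *\<^sub>R (x - q))" unfolding seg_q .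
      then show ?thesis using that seg[OF pq(3), of x c] by (simp add: K2_def)
    qed
    show "0 \<le> (b - s) * r2 + - (b - s + r2) * ((x - q) \<bullet> (- v)) + 1 * ((x - q) \<bullet> (- v))\<^sup>2" if "x \<in> K2" for x
    proof -
      have "0 \<le> (b - s - (b - l x)) * (r2 - (b - l x))"
        using that r2 by (intro mult_nonneg_nonneg) (auto simp: K2_def)
      then show ?thesis unfolding hq by (simp add: algebra_simps power2_eq_square)
    qed
  qed (use b12 in auto)
  then have 4: "0 \<le> (LINT x:K2|lborel. \<psi> (l x))" unfolding 2 hq .
  have int: "set_integrable lborel X (\<lambda>x. \<psi> (l x))" if "bounded X" "X \<in> sets borel" for X
    using that unfolding \<psi>_def by (intro set_integrable_continuous_bounded continuous_intros lcont)
  have "(LINT x:K1 \<union> K2|lborel. \<psi> (l x)) = (LINT x:K1|lborel. \<psi> (l x)) + (LINT x:K2|lborel. \<psi> (l x))"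
    by (rule set_integral_Un) (use int b12 in \<open>auto simp: K1_def K2_def\<close>)
  moreover have "K1 \<union> K2 = K" by (auto simp: K1_def K2_def)
  ultimately have "0 \<le> (LINT x:K|lborel. \<psi> (l x))" using 3 4 by simp
  also have "\<dots> = (d + 2) * (M - c * V)" unfolding \<psi>_def lin by (simp add: algebra_simps)
  finally have "c * V \<le> M" using d by (simp add: zero_le_mult_iff)
  moreover have "2 * a * b / ((d + 1) * (d + 2)) \<le> c"
  proof -
    have "0 \<le> (a - b)\<^sup>2 + (d - 1) * s\<^sup>2" using d by simp
    then have "2 * a * b \<le> a\<^sup>2 + b\<^sup>2 + (d - 1) * s\<^sup>2" by (simp add: power2_eq_square algebra_simps)
    then show ?thesis unfolding c_def using d by (intro divide_right_mono) auto
  qed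
  then have "2 * a * b / ((d + 1) * (d + 2)) * V \<le> c * V"
    by (intro mult_right_mono) (auto simp: V_def)
  ultimately show ?thesis by (simp add: V_def M_def l_def)
qed

section \<open>Polar bodies and Laplace transforms\<close>

definition polar_body :: "'a::euclidean_space set \<Rightarrow> 'a \<Rightarrow> 'a set" where
  "polar_body L y = {u. \<forall>z\<in>L. u \<bullet> (y - z) \<le> 1}"

text \<open>The support function of \<open>- L\<close>.\<close>

definition reflected_support :: "'a::euclidean_space set \<Rightarrow> 'a \<Rightarrow> real" where
  "reflected_support L x = (SUP z\<in>L. - (x \<bullet> z))"

text \<open>This is the support function of \<open>y - L\<close> at \<open>x\<close>, which is the gauge of \<open>polar_body L y\<close>. The
form displays that \<open>y\<close> enters only through a linear term.\<close>

definition gauge_at :: "'a::euclidean_space set \<Rightarrow> 'a \<Rightarrow> 'a \<Rightarrow> real" where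
  "gauge_at L y x = x \<bullet> y + reflected_support L x"

lemma bdd_above_inner_compact:
  assumes "compact L" shows "bdd_above ((\<lambda>z. - (x \<bullet> z)) ` L)"
  by (intro compact_imp_bounded[THEN bounded_imp_bdd_above] compact_continuous_image assms continuous_intros)

lemma gauge_at_le_iff:
  assumes "compact L" "L \<noteq> {}"
  shows "gauge_at L y x \<le> r \<longleftrightarrow> (\<forall>z\<in>L. x \<bullet> (y - z) \<le> r)"
proof -
  have "gauge_at L y x \<le> r \<longleftrightarrow> reflected_support L x \<le> r - x \<bullet> y" by (auto simp: gauge_at_def)
  also have "\<dots> \<longleftrightarrow> (\<forall>z\<in>L. - (x \<bullet> z) \<le> r - x \<bullet> y)"
    unfolding reflected_support_def by (rule cSUP_le_iff[OF assms(2) bdd_above_inner_compact[OF assms(1)]])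
  also have "\<dots> \<longleftrightarrow> (\<forall>z\<in>L. x \<bullet> (y - z) \<le> r)" by (auto simp: inner_diff_right algebra_simps)
  finally show ?thesis .
qed

lemma polar_body_eq_gauge: "compact L \<Longrightarrow> L \<noteq> {} \<Longrightarrow> polar_body L y = {x. gauge_at L y x \<le> 1}"
  by (auto simp: polar_body_def gauge_at_le_iff)

lemma gauge_at_ge: "compact L \<Longrightarrow> z \<in> L \<Longrightarrow> x \<bullet> (y - z) \<le> gauge_at L y x"
  using gauge_at_le_iff[of L y x "gauge_at L y x"] by auto

lemma gauge_at_nonneg: "compact L \<Longrightarrow> y \<in> L \<Longrightarrow> 0 \<le> gauge_at L y x"
  using gauge_at_ge[of L y x y] by simp

lemma gauge_at_scale:
  assumes "compact L" "L \<noteq> {}" "0 < r"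
  shows "gauge_at L y (r *\<^sub>R x) \<le> r * s \<longleftrightarrow> gauge_at L y x \<le> s"
  using assms by (simp add: gauge_at_le_iff)

lemma gauge_at_shift: "gauge_at L (y + v) x = gauge_at L y x + x \<bullet> v"
  by (simp add: gauge_at_def inner_add_right)

text \<open>A supremum of linear functions is convex, and a finite convex function is continuous.\<close>

lemma continuous_gauge_at:
  assumes "compact L" "L \<noteq> {}"
  shows "continuous_on UNIV (gauge_at L y)"
proof (rule convex_on_continuous)
  show "convex_on UNIV (gauge_at L y)"
  proof (rule convex_onI)
    fix t :: real and u w :: 'a assume t: "0 < t" "t < 1"
    show "gauge_at L y ((1 - t) *\<^sub>R u + t *\<^sub>R w) \<le> (1 - t) * gauge_at L y u + t * gauge_at L y w"
      unfolding gauge_at_le_iff[OF assms]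
    proof
      fix z assume "z \<in> L"
      then have "(1 - t) * (u \<bullet> (y - z)) + t * (w \<bullet> (y - z)) \<le> (1 - t) * gauge_at L y u + t * gauge_at L y w"
        using t by (intro add_mono mult_left_mono gauge_at_ge assms) auto
      then show "((1 - t) *\<^sub>R u + t *\<^sub>R w) \<bullet> (y - z) \<le> (1 - t) * gauge_at L y u + t * gauge_at L y w"
        by (simp add: inner_add_left)
    qed
  qed auto
qed auto

lemma measurable_gauge_at[measurable (raw)]:
  assumes "compact L" "L \<noteq> {}"
  shows "gauge_at L y \<in> borel_measurable borel"
  by (intro borel_measurable_continuous_onI continuous_gauge_at assms)

lemma exp_minus_as_layers:
  assumes "0 \<le> (g::real)"
  shows "ennreal (exp (- g)) = (\<integral>\<^sup>+r. ennreal (exp (- r)) * indicator {g..} r \<partial>lborel)"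
proof -
  have "(\<integral>\<^sup>+r. ennreal (exp (- r)) * indicator {g..} r \<partial>lborel) = ennreal (0 - (- exp (- g)))"
  proof (rule nn_integral_FTC_atLeast)
    show "((\<lambda>r. - exp (- r)) \<longlongrightarrow> (0::real)) at_top" by real_asymp
  qed (auto intro!: derivative_eq_intros)
  then show ?thesis by simp
qed

text \<open>Write \<open>exp (- g)\<close> as the integral of \<open>exp (- r)\<close> over \<open>r \<ge> g\<close>. The set where the gauge is at
most \<open>r\<close> is the dilate of the polar body by \<open>r\<close>, so homogeneity produces the factor
\<open>r ^ (d + k)\<close>, whose integral against \<open>exp (- r)\<close> is \<open>(d + k)!\<close>.\<close>

lemma nn_integral_gauge:
  fixes \<phi> :: "'a::euclidean_space \<Rightarrow> ennreal"
  assumes L: "compact L" "y \<in> L" and [measurable]: "\<phi> \<in> borel_measurable borel"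
    and hom: "\<And>r x. 0 < r \<Longrightarrow> \<phi> (r *\<^sub>R x) = ennreal (r ^ k) * \<phi> x"
  shows "(\<integral>\<^sup>+x. \<phi> x * ennreal (exp (- gauge_at L y x)) \<partial>lborel)
    = ennreal (fact (DIM('a) + k)) * (\<integral>\<^sup>+x. \<phi> x * indicator (polar_body L y) x \<partial>lborel)"
proof -
  have ne: "L \<noteq> {}" using L by auto
  note [measurable] = measurable_gauge_at[OF L(1) ne]
  define P where "P = polar_body L y"
  have P: "P = {x. gauge_at L y x \<le> 1}" using polar_body_eq_gauge[OF L(1) ne] by (simp add: P_def)
  have [measurable]: "P \<in> sets borel" unfolding P by measurable
  define I where "I = (\<integral>\<^sup>+x. \<phi> x * indicator P x \<partial>lborel)"
  have inner: "(\<integral>\<^sup>+x. \<phi> x * indicator {x. gauge_at L y x \<le> r} x \<partial>lborel) = ennreal (r ^ (DIM('a) + k)) * I"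
    if "0 < r" for r
  proof -
    have "(\<integral>\<^sup>+x. \<phi> x * indicator {x. gauge_at L y x \<le> r} x \<partial>lborel)
      = ennreal (r ^ DIM('a)) * (\<integral>\<^sup>+x. \<phi> (0 + r *\<^sub>R x) * indicator {x. gauge_at L y x \<le> r} (0 + r *\<^sub>R x) \<partial>lborel)"
      using that by (intro nn_integral_lborel_affine) auto
    also have "(\<integral>\<^sup>+x. \<phi> (0 + r *\<^sub>R x) * indicator {x. gauge_at L y x \<le> r} (0 + r *\<^sub>R x) \<partial>lborel)
      = (\<integral>\<^sup>+x. ennreal (r ^ k) * (\<phi> x * indicator P x) \<partial>lborel)"
      using gauge_at_scale[OF L(1) ne that, of y _ 1]
      by (intro nn_integral_cong) (auto simp: hom[OF that] P indicator_def)
    also have "\<dots> = ennreal (r ^ k) * I" unfolding I_def by (intro nn_integral_cmult) measurable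
    finally show ?thesis
      using that by (simp add: power_add ennreal_mult' mult.assoc)
  qed
  have "(\<integral>\<^sup>+x. \<phi> x * ennreal (exp (- gauge_at L y x)) \<partial>lborel)
    = (\<integral>\<^sup>+x. (\<integral>\<^sup>+r. \<phi> x * (ennreal (exp (- r)) * indicator {x. gauge_at L y x \<le> r} x) \<partial>lborel) \<partial>lborel)"
  proof (intro nn_integral_cong)
    fix x
    have "(\<integral>\<^sup>+r. \<phi> x * (ennreal (exp (- r)) * indicator {x. gauge_at L y x \<le> r} x) \<partial>lborel)
       = \<phi> x * (\<integral>\<^sup>+r. ennreal (exp (- r)) * indicator {x. gauge_at L y x \<le> r} x \<partial>lborel)"
      by (intro nn_integral_cmult) measurable
    also have "(\<integral>\<^sup>+r. ennreal (exp (- r)) * indicator {x. gauge_at L y x \<le> r} x \<partial>lborel)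
       = (\<integral>\<^sup>+r. ennreal (exp (- r)) * indicator {gauge_at L y x..} r \<partial>lborel)"
      by (intro nn_integral_cong) (auto simp: indicator_def)
    also have "\<dots> = ennreal (exp (- gauge_at L y x))"
      using exp_minus_as_layers[OF gauge_at_nonneg[OF L]] by simp
    finally show "\<phi> x * ennreal (exp (- gauge_at L y x))
       = (\<integral>\<^sup>+r. \<phi> x * (ennreal (exp (- r)) * indicator {x. gauge_at L y x \<le> r} x) \<partial>lborel)" by simp
  qed
  also have "\<dots> = (\<integral>\<^sup>+r. (\<integral>\<^sup>+x. \<phi> x * (ennreal (exp (- r)) * indicator {x. gauge_at L y x \<le> r} x) \<partial>lborel) \<partial>lborel)"
    by (rule lborel_pair.Fubini') measurable
  also have "\<dots> = (\<integral>\<^sup>+r. ennreal (r ^ (DIM('a) + k) * exp (- r)) * indicator {0..} r * I \<partial>lborel)"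
  proof (rule nn_integral_cong_AE, rule AE_mp[OF AE_lborel_singleton[of 0]], intro AE_I2 impI)
    fix r :: real assume "r \<noteq> 0"
    show "(\<integral>\<^sup>+x. \<phi> x * (ennreal (exp (- r)) * indicator {x. gauge_at L y x \<le> r} x) \<partial>lborel)
      = ennreal (r ^ (DIM('a) + k) * exp (- r)) * indicator {0..} r * I"
    proof (cases "0 < r")
      case True
      have "(\<integral>\<^sup>+x. \<phi> x * (ennreal (exp (- r)) * indicator {x. gauge_at L y x \<le> r} x) \<partial>lborel)
        = (\<integral>\<^sup>+x. ennreal (exp (- r)) * (\<phi> x * indicator {x. gauge_at L y x \<le> r} x) \<partial>lborel)"
        by (intro nn_integral_cong) (simp add: mult_ac)
      also have "\<dots> = ennreal (exp (- r)) * (\<integral>\<^sup>+x. \<phi> x * indicator {x. gauge_at L y x \<le> r} x \<partial>lborel)"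
        by (intro nn_integral_cmult) measurable
      finally show ?thesis
        using True by (simp add: inner ennreal_mult' mult_ac)
    next
      case False
      have "\<not> gauge_at L y x \<le> r" for x
        using gauge_at_nonneg[OF L, of x] False \<open>r \<noteq> 0\<close> by linarith
      then show ?thesis using False \<open>r \<noteq> 0\<close> by simp
    qed
  qed
  also have "\<dots> = (\<integral>\<^sup>+r. ennreal (r ^ (DIM('a) + k) * exp (- r)) * indicator {0..} r \<partial>lborel) * I"
    by (intro nn_integral_multc) measurable
  also have "\<dots> = ennreal (fact (DIM('a) + k)) * I"
    by (simp add: nn_intergal_power_times_exp_Ici)
  finally show ?thesis by (simp add: I_def P_def)
qed

text \<open>A ball of radius \<open>e\<close> about \<open>y\<close> inside \<open>L\<close> confines the polar body to the ball of radius \<open>1 / e\<close>.\<close>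

lemma polar_body_bounded:
  assumes "compact L" "y \<in> interior L"
  shows "bounded (polar_body L y)"
proof -
  obtain e where e: "0 < e" "cball y e \<subseteq> L"
    using assms(2) mem_interior_cball by blast
  have "norm u \<le> 1 / e" if u: "u \<in> polar_body L y" for u
  proof (cases "u = 0")
    case False
    define z where "z = y - (e / norm u) *\<^sub>R u"
    have "z \<in> L" using e False by (auto simp: z_def dist_norm intro!: subsetD[OF e(2)])
    then have "u \<bullet> (y - z) \<le> 1" using u by (auto simp: polar_body_def)
    moreover have "u \<bullet> (y - z) = e * norm u"
      using False by (simp add: z_def power2_norm_eq_inner[symmetric] power2_eq_square)
    ultimately show ?thesis using e by (simp add: field_simps)
  qed (use e in auto)
  then show ?thesis by (auto simp: bounded_iff)
qed

lemma polar_body_closed: "closed (polar_body L y)"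
proof -
  have "polar_body L y = (\<Inter>z\<in>L. {u. (y - z) \<bullet> u \<le> 1})" by (auto simp: polar_body_def inner_commute)
  then show ?thesis by (auto intro!: closed_INT closed_halfspace_le)
qed

lemma polar_body_compact: "compact L \<Longrightarrow> y \<in> interior L \<Longrightarrow> compact (polar_body L y)"
  by (simp add: compact_eq_bounded_closed polar_body_bounded polar_body_closed)

lemma polar_body_convex: "convex (polar_body L y)"
proof -
  have "polar_body L y = (\<Inter>z\<in>L. {u. (y - z) \<bullet> u \<le> 1})" by (auto simp: polar_body_def inner_commute)
  then show ?thesis by (auto intro!: convex_INT convex_halfspace_le)
qed

lemma polar_body_interior:
  assumes "compact L" shows "0 \<in> interior (polar_body L y)"
proof -
  have "bounded ((\<lambda>z. y - z) ` L)"
    by (intro compact_imp_bounded compact_continuous_image continuous_intros assms)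
  then obtain C where C: "0 < C" "\<And>z. z \<in> L \<Longrightarrow> norm (y - z) \<le> C"
    by (force simp: bounded_pos)
  have "ball 0 (1/C) \<subseteq> polar_body L y"
  proof
    fix u :: 'a assume "u \<in> ball 0 (1/C)"
    then have u: "norm u \<le> 1/C" by simp
    have "u \<bullet> (y - z) \<le> 1" if "z \<in> L" for z
    proof -
      have "u \<bullet> (y - z) \<le> norm u * norm (y - z)" by (rule norm_cauchy_schwarz)
      also have "\<dots> \<le> 1/C * C" using u C(1) C(2)[OF that] by (intro mult_mono) auto
      finally show ?thesis using C by simp
    qed
    then show "u \<in> polar_body L y" by (simp add: polar_body_def)
  qed
  then show ?thesis using C by (auto simp: mem_interior intro!: exI[of _ "1/C"])
qed

lemma polar_body_measure_pos:
  assumes "compact L" "y \<in> interior L" shows "0 < measure lborel (polar_body L y)"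
proof -
  obtain e where e: "0 < e" "ball 0 e \<subseteq> polar_body L y"
    using polar_body_interior[OF assms(1), of y] by (auto simp: mem_interior)
  have c: "compact (polar_body L y)" by (rule polar_body_compact[OF assms])
  have "0 < measure lborel (ball (0::'a) e)"
    using e content_ball_pos[of e "0::'a"] by simp
  also have "\<dots> \<le> measure lborel (polar_body L y)"
    using e c by (intro measure_mono_fmeasurable fmeasurable_compact) auto
  finally show ?thesis .
qed

text \<open>The signed version of \<open>nn_integral_gauge\<close>, through positive and negative parts. On the compact
polar body every continuous \<open>\<phi>\<close> is integrable, and this carries over to the whole space.\<close>

lemma integral_gauge:
  fixes \<phi> :: "'a::euclidean_space \<Rightarrow> real"
  assumes L: "compact L" "y \<in> interior L" and cont: "continuous_on UNIV \<phi>"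
    and hom: "\<And>r x. 0 < r \<Longrightarrow> \<phi> (r *\<^sub>R x) = r ^ k * \<phi> x"
  shows "integrable lborel (\<lambda>x. \<phi> x * exp (- gauge_at L y x))" (is ?I)
    and "(\<integral>x. \<phi> x * exp (- gauge_at L y x) \<partial>lborel) = fact (DIM('a) + k) * (LINT x:polar_body L y|lborel. \<phi> x)" (is ?E)
proof -
  have yL: "y \<in> L" using L interior_subset by auto
  then have ne: "L \<noteq> {}" by auto
  define P where "P = polar_body L y"
  note [measurable] = measurable_gauge_at[OF L(1) ne]
  have [measurable]: "\<phi> \<in> borel_measurable borel" by (intro borel_measurable_continuous_onI cont)
  have P: "compact P" using polar_body_compact[OF L] by (simp add: P_def)
  then have [measurable]: "P \<in> sets borel" by (rule borel_compact)
  have nn: "(\<integral>\<^sup>+x. ennreal (\<psi> x * exp (- gauge_at L y x)) \<partial>lborel)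
      = ennreal (fact (DIM('a) + k)) * (\<integral>\<^sup>+x. ennreal (indicator P x * \<psi> x) \<partial>lborel)"
    if [measurable]: "\<psi> \<in> borel_measurable borel" and hom: "\<And>r x. 0 < r \<Longrightarrow> \<psi> (r *\<^sub>R x) = r ^ k * \<psi> x"
    for \<psi> :: "'a \<Rightarrow> real"
  proof -
    have "(\<integral>\<^sup>+x. ennreal (\<psi> x * exp (- gauge_at L y x)) \<partial>lborel)
      = (\<integral>\<^sup>+x. ennreal (\<psi> x) * ennreal (exp (- gauge_at L y x)) \<partial>lborel)"
      by (simp add: ennreal_mult'')
    also have "\<dots> = ennreal (fact (DIM('a) + k)) * (\<integral>\<^sup>+x. ennreal (\<psi> x) * indicator P x \<partial>lborel)"
      unfolding P_def by (rule nn_integral_gauge[OF L(1) yL]) (auto simp: hom ennreal_mult')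
    also have "(\<integral>\<^sup>+x. ennreal (\<psi> x) * indicator P x \<partial>lborel) = (\<integral>\<^sup>+x. ennreal (indicator P x * \<psi> x) \<partial>lborel)"
      by (intro nn_integral_cong) (auto simp: indicator_def)
    finally show ?thesis .
  qed
  have Pint: "integrable lborel (\<lambda>x. indicator P x * \<phi> x)"
    using set_integrable_continuous_compact[OF P continuous_on_subset[OF cont subset_UNIV]]
    by (simp add: set_integrable_def)
  show I: ?I
  proof (rule integrableI_bounded)
    have "(\<integral>\<^sup>+x. ennreal (norm (\<phi> x * exp (- gauge_at L y x))) \<partial>lborel)
      = (\<integral>\<^sup>+x. ennreal (\<bar>\<phi> x\<bar> * exp (- gauge_at L y x)) \<partial>lborel)"
      by (simp add: abs_mult)
    also have "\<dots> = ennreal (fact (DIM('a) + k)) * (\<integral>\<^sup>+x. ennreal (indicator P x * \<bar>\<phi> x\<bar>) \<partial>lborel)"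
      by (rule nn) (auto simp: hom abs_mult)
    also have "(\<integral>\<^sup>+x. ennreal (indicator P x * \<bar>\<phi> x\<bar>) \<partial>lborel) = (\<integral>\<^sup>+x. ennreal (norm (indicator P x * \<phi> x)) \<partial>lborel)"
      by (simp add: abs_mult)
    also have "ennreal (fact (DIM('a) + k)) * \<dots> < \<infinity>"
      using Pint by (auto simp: integrable_iff_bounded ennreal_mult_less_top)
    finally show "(\<integral>\<^sup>+x. ennreal (norm (\<phi> x * exp (- gauge_at L y x))) \<partial>lborel) < \<infinity>" .
  qed measurable
  have neg: "(\<integral>\<^sup>+x. ennreal (- (\<phi> x * exp (- gauge_at L y x))) \<partial>lborel)
      = ennreal (fact (DIM('a) + k)) * (\<integral>\<^sup>+x. ennreal (- (indicator P x * \<phi> x)) \<partial>lborel)"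
    using nn[of "\<lambda>x. - \<phi> x"] hom by simp
  have "(LINT x:P|lborel. \<phi> x) = (\<integral>x. indicator P x * \<phi> x \<partial>lborel)"
    by (simp add: set_lebesgue_integral_def)
  then show ?E
    unfolding real_lebesgue_integral_def[OF I] P_def[symmetric] neg nn[of \<phi>, OF _ hom, simplified]
    by (simp only: real_lebesgue_integral_def[OF Pint]) (simp add: enn2real_mult right_diff_distrib)
qed

text \<open>The moments of the exponential weight, in direction \<open>v\<close>. For \<open>j = 0\<close> this is the Laplace
transform \<open>W(L, y)\<close>, and each differentiation along \<open>v\<close> raises \<open>j\<close> by one and changes the sign.\<close>

definition gauge_moment :: "'a::euclidean_space set \<Rightarrow> 'a \<Rightarrow> nat \<Rightarrow> 'a \<Rightarrow> real" where
  "gauge_moment L v j y = (\<integral>x. (x \<bullet> v) ^ j * exp (- gauge_at L y x) \<partial>lborel)"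

lemma gauge_moment_integrable:
  assumes "compact L" "y \<in> interior L"
  shows "integrable lborel (\<lambda>x. (x \<bullet> v) ^ j * exp (- gauge_at L y x))"
    and "integrable lborel (\<lambda>x. \<bar>x \<bullet> v\<bar> ^ j * exp (- gauge_at L y x))"
  by (rule integral_gauge(1)[OF assms, where k = j];
      auto intro!: continuous_intros simp: power_mult_distrib abs_mult)+

lemma gauge_moment_eq:
  fixes L :: "'a::euclidean_space set"
  assumes "compact L" "y \<in> interior L"
  shows "gauge_moment L v j y = fact (DIM('a) + j) * (LINT x:polar_body L y|lborel. (x \<bullet> v) ^ j)"
  unfolding gauge_moment_def
  by (rule integral_gauge(2)[OF assms]) (auto intro!: continuous_intros simp: power_mult_distrib)

lemma exp_taylor_bound: "\<bar>exp z - 1 - z\<bar> \<le> z\<^sup>2 / 2 * exp \<bar>z\<bar>" for z :: real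
proof -
  obtain t where t: "\<bar>t\<bar> \<le> \<bar>z\<bar>" "exp z = (\<Sum>m<2. z ^ m / fact m) + exp t / fact 2 * z ^ 2"
    using Maclaurin_exp_le[of z 2] by blast
  have "exp z - 1 - z = exp t / 2 * z\<^sup>2" using t(2) by (simp add: numeral_2_eq_2)
  then have "\<bar>exp z - 1 - z\<bar> = exp t / 2 * z\<^sup>2" by (simp only: abs_mult) simp
  moreover have "exp t \<le> exp \<bar>z\<bar>" using t(1) by simp
  then have "exp t / 2 * z\<^sup>2 \<le> exp \<bar>z\<bar> / 2 * z\<^sup>2" by (intro mult_right_mono) auto
  ultimately show ?thesis by (simp add: mult_ac)
qed

text \<open>Differentiation under the integral. Since \<open>y\<close> enters the gauge linearly, the weight at a displacement
\<open>h\<close> is the weight at \<open>0\<close> times \<open>exp (- h l)\<close> with \<open>l = x \<bullet> v\<close>. The second-order Taylor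
remainder is dominated by moments at the two points with displacement \<open>\<plusminus> \<eta>\<close>, because
\<open>exp (\<eta> \<bar>l\<bar>) \<le> exp (\<eta> l) + exp (- \<eta> l)\<close>.\<close>

lemma gauge_moment_has_derivative:
  fixes L :: "'a::euclidean_space set"
  assumes L: "compact L" and y: "y + \<tau> *\<^sub>R v \<in> interior L"
  shows "((\<lambda>t. gauge_moment L v j (y + t *\<^sub>R v)) has_real_derivative - gauge_moment L v (Suc j) (y + \<tau> *\<^sub>R v)) (at \<tau>)"
proof -
  define w where "w = y + \<tau> *\<^sub>R v"
  obtain e where e: "0 < e" "ball w e \<subseteq> interior L"
    using y open_interior open_contains_ball unfolding w_def by blast
  define \<eta> where "\<eta> = e / (2 * (norm v + 1))"
  have \<eta>: "0 < \<eta>" using e by (auto simp: \<eta>_def add_nonneg_pos)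
  have inL: "w + h *\<^sub>R v \<in> interior L" if "\<bar>h\<bar> \<le> \<eta>" for h
  proof -
    have "\<bar>h\<bar> * norm v \<le> \<eta> * (norm v + 1)" using that \<eta> by (intro mult_mono) auto
    also have "\<dots> = e / 2"
    proof -
      have "norm v + 1 \<noteq> 0" by (smt (verit) norm_ge_zero)
      moreover have "e / (2 * N) * N = e / 2" if "N \<noteq> 0" for N using that by simp
      ultimately show ?thesis unfolding \<eta>_def by blast
    qed
    finally show ?thesis using e by (intro subsetD[OF e(2)]) (auto simp: dist_norm)
  qed
  define G where "G h x = exp (- gauge_at L (w + h *\<^sub>R v) x)" for h x
  have G: "G h x = exp (- h * (x \<bullet> v)) * G 0 x" for h x
    by (simp add: G_def gauge_at_shift exp_add[symmetric])
  have Gi: "integrable lborel (\<lambda>x. (x \<bullet> v) ^ i * G h x)" "integrable lborel (\<lambda>x. \<bar>x \<bullet> v\<bar> ^ i * G h x)"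
    if "\<bar>h\<bar> \<le> \<eta>" for i h
    unfolding G_def using gauge_moment_integrable[OF L inL[OF that]] by auto
  define M where "M i h = (\<integral>x. (x \<bullet> v) ^ i * G h x \<partial>lborel)" for i h
  define C where "C = (\<integral>x. \<bar>x \<bullet> v\<bar> ^ (j + 2) * G \<eta> x + \<bar>x \<bullet> v\<bar> ^ (j + 2) * G (- \<eta>) x \<partial>lborel)"
  have Ci: "integrable lborel (\<lambda>x. \<bar>x \<bullet> v\<bar> ^ (j + 2) * G \<eta> x + \<bar>x \<bullet> v\<bar> ^ (j + 2) * G (- \<eta>) x)"
    using Gi(2)[of \<eta> "j + 2"] Gi(2)[of "- \<eta>" "j + 2"] \<eta> by auto
  have key: "\<bar>M j h - M j 0 + h * M (Suc j) 0\<bar> \<le> h\<^sup>2 * C" if h: "\<bar>h\<bar> \<le> \<eta>" for h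
  proof -
    have pt: "\<bar>(x \<bullet> v) ^ j * G h x - (x \<bullet> v) ^ j * G 0 x + h * ((x \<bullet> v) ^ Suc j * G 0 x)\<bar>
      \<le> h\<^sup>2 * (\<bar>x \<bullet> v\<bar> ^ (j + 2) * G \<eta> x + \<bar>x \<bullet> v\<bar> ^ (j + 2) * G (- \<eta>) x)" for x
    proof -
      define l where "l = x \<bullet> v"
      have "exp \<bar>- h * l\<bar> \<le> exp (\<eta> * \<bar>l\<bar>)" using h by (simp add: abs_mult mult_right_mono)
      also have "\<dots> \<le> exp (- \<eta> * l) + exp (- (- \<eta>) * l)" by (cases "0 \<le> l") auto
      finally have ex: "exp \<bar>- h * l\<bar> \<le> exp (- \<eta> * l) + exp (- (- \<eta>) * l)" .
      have "l ^ j * G h x - l ^ j * G 0 x + h * (l ^ Suc j * G 0 x)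
          = l ^ j * G 0 x * (exp (- h * l) - 1 - (- h * l))"
        unfolding G[of h] l_def by (simp add: algebra_simps)
      then have "\<bar>l ^ j * G h x - l ^ j * G 0 x + h * (l ^ Suc j * G 0 x)\<bar> = \<bar>l\<bar> ^ j * G 0 x * \<bar>exp (- h * l) - 1 - (- h * l)\<bar>"
        by (simp add: abs_mult power_abs G_def)
      also have "\<dots> \<le> \<bar>l\<bar> ^ j * G 0 x * ((- h * l)\<^sup>2 / 2 * exp \<bar>- h * l\<bar>)"
        by (intro mult_left_mono exp_taylor_bound) (auto simp: G_def)
      also have "\<dots> \<le> \<bar>l\<bar> ^ j * G 0 x * ((- h * l)\<^sup>2 * (exp (- \<eta> * l) + exp (- (- \<eta>) * l)))"
        using ex by (intro mult_left_mono mult_mono) (auto simp: G_def)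
      also have "\<dots> = h\<^sup>2 * (\<bar>l\<bar> ^ (j + 2) * G \<eta> x + \<bar>l\<bar> ^ (j + 2) * G (- \<eta>) x)"
      proof -
        have pw: "\<bar>l\<bar> ^ (j + 2) = \<bar>l\<bar> ^ j * l\<^sup>2" by (simp add: power_add power2_eq_square)
        show ?thesis
          unfolding G[of \<eta>] G[of "- \<eta>"] l_def[symmetric] pw
          by (simp add: power_mult_distrib algebra_simps)
      qed
      finally show ?thesis unfolding l_def .
    qed
    have 0: "\<bar>0\<bar> \<le> \<eta>" using \<eta> by simp
    have diff: "M j h - M j 0 + h * M (Suc j) 0
      = (\<integral>x. (x \<bullet> v) ^ j * G h x - (x \<bullet> v) ^ j * G 0 x + h * ((x \<bullet> v) ^ Suc j * G 0 x) \<partial>lborel)"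
      unfolding M_def using Gi(1)[OF h, of j] Gi(1)[OF 0, of j] Gi(1)[OF 0, of "Suc j"]
      by (subst Bochner_Integration.integral_add, force, force, subst Bochner_Integration.integral_diff, force, force)
         (simp only: integral_mult_right_zero)
    have "\<bar>M j h - M j 0 + h * M (Suc j) 0\<bar> \<le> (\<integral>x. \<bar>(x \<bullet> v) ^ j * G h x - (x \<bullet> v) ^ j * G 0 x + h * ((x \<bullet> v) ^ Suc j * G 0 x)\<bar> \<partial>lborel)"
      unfolding diff by (rule integral_abs_bound)
    also have "\<dots> \<le> (\<integral>x. h\<^sup>2 * (\<bar>x \<bullet> v\<bar> ^ (j + 2) * G \<eta> x + \<bar>x \<bullet> v\<bar> ^ (j + 2) * G (- \<eta>) x) \<partial>lborel)"
    proof (rule integral_mono')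
      show "integrable lborel (\<lambda>x. h\<^sup>2 * (\<bar>x \<bullet> v\<bar> ^ (j + 2) * G \<eta> x + \<bar>x \<bullet> v\<bar> ^ (j + 2) * G (- \<eta>) x))"
        by (intro integrable_mult_right Ci)
      show "0 \<le> h\<^sup>2 * (\<bar>x \<bullet> v\<bar> ^ (j + 2) * G \<eta> x + \<bar>x \<bullet> v\<bar> ^ (j + 2) * G (- \<eta>) x)" for x
        by (intro mult_nonneg_nonneg add_nonneg_nonneg) (auto simp: G_def)
    qed (rule pt)
    also have "\<dots> = h\<^sup>2 * C" unfolding C_def by simp
    finally show ?thesis .
  qed
  have "((\<lambda>h. (M j h - M j 0) / h + M (Suc j) 0) \<longlongrightarrow> 0) (at 0)"
  proof (rule Lim_null_comparison[where g = "\<lambda>h. \<bar>h\<bar> * C"])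
    show "((\<lambda>h. \<bar>h\<bar> * C) \<longlongrightarrow> 0) (at 0)" by (auto intro!: tendsto_eq_intros)
    show "\<forall>\<^sub>F h in at 0. norm ((M j h - M j 0) / h + M (Suc j) 0) \<le> \<bar>h\<bar> * C"
      unfolding eventually_at
    proof (intro exI[of _ \<eta>] conjI ballI impI \<eta>)
      fix h :: real assume "h \<noteq> 0 \<and> dist h 0 < \<eta>"
      then have h: "h \<noteq> 0" "\<bar>h\<bar> \<le> \<eta>" by auto
      have "norm ((M j h - M j 0) / h + M (Suc j) 0) = \<bar>M j h - M j 0 + h * M (Suc j) 0\<bar> / \<bar>h\<bar>"
        using h by (simp add: field_simps flip: abs_divide)
      also have "\<dots> \<le> h\<^sup>2 * C / \<bar>h\<bar>" using key[OF h(2)] by (intro divide_right_mono) auto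
      also have "\<dots> = \<bar>h\<bar> * C" using h by (simp add: power2_eq_square abs_if)
      finally show "norm ((M j h - M j 0) / h + M (Suc j) 0) \<le> \<bar>h\<bar> * C" .
    qed
  qed
  from tendsto_diff[OF this tendsto_const[of "M (Suc j) 0"]]
  have lim: "((\<lambda>h. (M j h - M j 0) / h) \<longlongrightarrow> - M (Suc j) 0) (at 0)" by simp
  have M: "gauge_moment L v i (y + (\<tau> + h) *\<^sub>R v) = M i h" for i h
    by (simp add: gauge_moment_def M_def G_def w_def scaleR_add_left add.assoc)
  show ?thesis
    unfolding DERIV_def using lim M M[of _ 0, simplified] by simp
qed

section \<open>Existence of Santalo points\<close>

lemma gauge_moment_zero_pos:
  assumes "compact L" "y \<in> interior L"
  shows "0 < gauge_moment L v 0 y"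
proof -
  have "(LINT x:polar_body L y|lborel. (x \<bullet> v) ^ 0) = measure lborel (polar_body L y)"
    by (simp add: set_lebesgue_integral_def)
  then show ?thesis
    using gauge_moment_eq[OF assms, of v 0] polar_body_measure_pos[OF assms] by simp
qed

lemma gauge_moment_zero_indep: "gauge_moment L v 0 = gauge_moment L w 0"
  by (simp add: gauge_moment_def fun_eq_iff)

lemma polar_dual_eq_translate: "polar_dual y L = (\<lambda>x. y + x) ` polar_body L y"
proof -
  have *: "x \<in> polar_dual y L \<longleftrightarrow> x - y \<in> polar_body L y" for x
    by (auto simp: polar_dual_def polar_body_def inner_diff_right inner_diff_left algebra_simps)
  show ?thesis
  proof (intro set_eqI iffI)
    fix x assume "x \<in> polar_dual y L"
    then show "x \<in> (\<lambda>x. y + x) ` polar_body L y" by (intro image_eqI[of x _ "x - y"]) (auto simp: *)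
  qed (auto simp: *)
qed

text \<open>The centroid of \<open>polar_body L y\<close> is the quotient of its first moment and its volume; the
factorials \<open>(d + 1)!\<close> and \<open>d!\<close> leave the factor \<open>d + 1\<close>.\<close>

lemma centroid_polar_dual_inner:
  fixes L :: "'a::euclidean_space set"
  assumes L: "compact L" "y \<in> interior L"
  shows "centroid (polar_dual y L) \<bullet> v
    = y \<bullet> v + gauge_moment L v 1 y / (real (DIM('a) + 1) * gauge_moment L v 0 y)"
proof -
  define P where "P = polar_body L y"
  define S where "S = (\<lambda>x. y + x) ` P"
  have P: "compact P" unfolding P_def by (rule polar_body_compact[OF L])
  then have S: "compact S" unfolding S_def by (rule compact_translation)
  have [measurable]: "P \<in> sets borel" "S \<in> sets borel" using P S by (auto intro: borel_compact)
  have SP: "y + x \<in> S \<longleftrightarrow> x \<in> P" for x by (auto simp: S_def)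
  have int: "integrable lborel (\<lambda>x. indicator S x *\<^sub>R x)"
    by (rule borel_integrable_compact[OF S]) (rule continuous_on_id)
  have vol: "measure lborel S = measure lborel P"
  proof -
    have "measure lborel S = (\<integral>x. indicator S x \<partial>lborel)" by simp
    also have "\<dots> = (\<integral>x. indicator S (y + 1 *\<^sub>R x) \<partial>lborel)"
      using lborel_integral_affine[of "indicator S" 1 y] by simp
    also have "(\<lambda>x. indicator S (y + 1 *\<^sub>R x) :: real) = indicator P" using SP by (auto simp: indicator_def fun_eq_iff)
    finally show ?thesis by simp
  qed
  have "integral S (\<lambda>x. x) \<bullet> v = (\<integral>x. indicator S x *\<^sub>R x \<partial>lborel) \<bullet> v"
    using set_borel_integral_eq_integral(2)[of S "\<lambda>x. x"] int
    by (simp add: set_integrable_def set_lebesgue_integral_def)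
  also have "\<dots> = (\<integral>x. indicator S x * (x \<bullet> v) \<partial>lborel)"
    using int by (subst integral_inner_left[symmetric]) auto
  also have "\<dots> = (\<integral>x. indicator S (y + 1 *\<^sub>R x) * ((y + 1 *\<^sub>R x) \<bullet> v) \<partial>lborel)"
    using lborel_integral_affine[of "\<lambda>x. indicator S x * (x \<bullet> v)" 1 y] by simp
  also have "\<dots> = (LINT x:P|lborel. y \<bullet> v + x \<bullet> v)"
    unfolding set_lebesgue_integral_def
    by (intro Bochner_Integration.integral_cong) (auto simp: SP indicator_def inner_add_left)
  also have "\<dots> = (LINT x:P|lborel. y \<bullet> v) + (LINT x:P|lborel. x \<bullet> v)"
    by (rule set_integral_add) (intro set_integrable_continuous_compact P continuous_intros)+
  also have "(LINT x:P|lborel. y \<bullet> v) = (y \<bullet> v) * measure lborel P"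
    by (simp add: set_lebesgue_integral_def)
  finally have num: "integral S (\<lambda>x. x) \<bullet> v = (y \<bullet> v) * measure lborel P + (LINT x:P|lborel. x \<bullet> v)" .
  have pos: "0 < measure lborel P" unfolding P_def by (rule polar_body_measure_pos[OF L])
  have m0: "gauge_moment L v 0 y = fact DIM('a) * measure lborel P"
    using gauge_moment_eq[OF L, of v 0] by (simp add: P_def set_lebesgue_integral_def)
  have m1: "gauge_moment L v 1 y = fact DIM('a) * (real (DIM('a) + 1) * (LINT x:P|lborel. x \<bullet> v))"
    using gauge_moment_eq[OF L, of v 1] by (simp add: P_def algebra_simps)
  have "(F * (n * q)) / (n * (F * p)) = q / p" if "F \<noteq> 0" "n \<noteq> 0" for F n p q :: real
    using that by simp
  then have "gauge_moment L v 1 y / (real (DIM('a) + 1) * gauge_moment L v 0 y)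
      = (LINT x:P|lborel. x \<bullet> v) / measure lborel P"
    unfolding m0 m1 by simp
  moreover have "centroid S \<bullet> v = (integral S (\<lambda>x. x) \<bullet> v) / measure lborel P"
    using vol by (simp add: centroid_def measure_completion)
  ultimately show ?thesis
    using pos unfolding num by (simp add: polar_dual_eq_translate S_def P_def add_divide_distrib)
qed

text \<open>Minus the derivative of \<open>log W(L, y)\<close> in direction \<open>v\<close>.\<close>

definition log_slope :: "'a::euclidean_space set \<Rightarrow> 'a \<Rightarrow> 'a \<Rightarrow> real" where
  "log_slope L v y = gauge_moment L v 1 y / gauge_moment L v 0 y"

lemma santalo_point_iff_log_slope:
  fixes L1 L2 :: "'a::euclidean_space set"
  assumes "compact L1" "compact L2" "y \<in> interior L1" "y \<in> interior L2"
  shows "santalo_point L1 L2 y \<longleftrightarrow> (\<forall>v. log_slope L1 v y = log_slope L2 v y)"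
proof -
  have "centroid (polar_dual y L1) = centroid (polar_dual y L2)
    \<longleftrightarrow> (\<forall>v. centroid (polar_dual y L1) \<bullet> v = centroid (polar_dual y L2) \<bullet> v)"
    by (metis vector_eq_rdot)
  also have "\<dots> \<longleftrightarrow> (\<forall>v. log_slope L1 v y = log_slope L2 v y)"
  proof -
    have "gauge_moment L v 1 y / (real (DIM('a) + 1) * gauge_moment L v 0 y) = log_slope L v y / real (DIM('a) + 1)"
      for L v by (simp add: log_slope_def mult.commute)
    then show ?thesis
      unfolding centroid_polar_dual_inner[OF assms(1,3)] centroid_polar_dual_inner[OF assms(2,4)]
      by simp
  qed
  finally show ?thesis using assms by (simp add: santalo_point_def)
qed

text \<open>\<open>W(L, y)\<close> is an integral of exponentials of affine functions of \<open>y\<close>, hence convex in \<open>y\<close>.\<close>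

lemma gauge_volume_continuous:
  fixes L :: "'a::euclidean_space set"
  assumes L: "compact L" "convex L"
  shows "continuous_on (interior L) (gauge_moment L v 0)"
proof (rule convex_on_continuous[OF open_interior])
  show "convex_on (interior L) (gauge_moment L v 0)"
  proof (rule convex_onI)
    fix t :: real and y w :: 'a
    assume t: "0 < t" "t < 1" and yw: "y \<in> interior L" "w \<in> interior L"
    define z where "z = (1 - t) *\<^sub>R y + t *\<^sub>R w"
    have zL: "z \<in> interior L"
      unfolding z_def by (rule convexD_alt[OF convex_interior[OF L(2)] yw]) (use t in auto)
    have i: "integrable lborel (\<lambda>x. exp (- gauge_at L y x))" "integrable lborel (\<lambda>x. exp (- gauge_at L w x))"
      "integrable lborel (\<lambda>x. exp (- gauge_at L z x))"
      using gauge_moment_integrable(1)[OF L(1), of _ v 0] yw zL by auto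
    have "(\<integral>x. exp (- gauge_at L z x) \<partial>lborel) \<le> (\<integral>x. (1 - t) * exp (- gauge_at L y x) + t * exp (- gauge_at L w x) \<partial>lborel)"
    proof (rule integral_mono)
      fix x
      have "- gauge_at L z x = (1 - t) *\<^sub>R (- gauge_at L y x) + t *\<^sub>R (- gauge_at L w x)"
        by (simp add: gauge_at_def z_def inner_add_right algebra_simps)
      then show "exp (- gauge_at L z x) \<le> (1 - t) * exp (- gauge_at L y x) + t * exp (- gauge_at L w x)"
        using convex_onD[OF exp_convex, of t "- gauge_at L y x" "- gauge_at L w x"] t by simp
    qed (use i in auto)
    also have "\<dots> = (1 - t) * (\<integral>x. exp (- gauge_at L y x) \<partial>lborel) + t * (\<integral>x. exp (- gauge_at L w x) \<partial>lborel)"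
      using i by simp
    finally show "gauge_moment L v 0 z \<le> (1 - t) * gauge_moment L v 0 y + t * gauge_moment L v 0 w"
      by (simp add: gauge_moment_def)
  qed (rule convex_interior[OF L(2)])
qed

lemma supporting_functional:
  fixes L :: "'a::euclidean_space set"
  assumes "convex L" "interior L \<noteq> {}" "z0 \<notin> interior L"
  obtains a where "a \<noteq> 0" "\<And>z. z \<in> L \<Longrightarrow> a \<bullet> z0 \<le> a \<bullet> z"
proof -
  obtain a b where a: "a \<noteq> 0" "a \<bullet> z0 \<le> b" "\<And>z. z \<in> interior L \<Longrightarrow> b \<le> a \<bullet> z"
    using separating_hyperplane_sets[of "{z0}" "interior L"] assms convex_interior by auto
  have "closure (interior L) \<subseteq> {z. a \<bullet> z \<ge> b}"
    using a(3) by (intro closure_minimal closed_halfspace_ge) auto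
  moreover have "L \<subseteq> closure (interior L)"
    using convex_closure_interior[OF assms(1,2)] closure_subset by auto
  ultimately show thesis using that[OF a(1)] a(2) by force
qed

text \<open>If \<open>y\<close> is not interior to \<open>L\<close>, a supporting functional \<open>a\<close> exists along which the gauge does not
increase. The gauge is therefore bounded on infinitely many disjoint unit balls centred on the ray
spanned by \<open>a\<close>.\<close>

lemma gauge_volume_infinite:
  fixes L :: "'a::euclidean_space set"
  assumes L: "compact L" "convex L" "interior L \<noteq> {}" and y: "y \<notin> interior L"
  shows "(\<integral>\<^sup>+x. ennreal (exp (- gauge_at L y x)) \<partial>lborel) = \<infinity>"
proof -
  have ne: "L \<noteq> {}" using L(3) interior_subset by auto
  note [measurable] = measurable_gauge_at[OF L(1) ne]
  obtain a where a: "a \<noteq> 0" "\<And>z. z \<in> L \<Longrightarrow> a \<bullet> y \<le> a \<bullet> z"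
    using supporting_functional[OF L(2,3) y] by blast
  have hp: "a \<bullet> (y - z) \<le> 0" if "z \<in> L" for z
    using a(2)[OF that] by (simp add: inner_diff_right)
  have "bounded ((\<lambda>z. y - z) ` L)"
    by (intro compact_imp_bounded compact_continuous_image continuous_intros L)
  then obtain C where C: "0 < C" "\<And>z. z \<in> L \<Longrightarrow> norm (y - z) \<le> C"
    by (force simp: bounded_pos)
  define A where "A = {x. gauge_at L y x \<le> C}"
  have [measurable]: "A \<in> sets borel" unfolding A_def by measurable
  define B where "B n = ball ((2 * real n / norm a) *\<^sub>R a) 1" for n :: nat
  have BA: "B n \<subseteq> A" for n
  proof
    fix x assume x: "x \<in> B n"
    define c where "c = 2 * real n / norm a"
    have u: "norm (x - c *\<^sub>R a) \<le> 1" using x by (auto simp: B_def c_def dist_norm norm_minus_commute)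
    have "x \<bullet> (y - z) \<le> C" if z: "z \<in> L" for z
    proof -
      have "x \<bullet> (y - z) = (x - c *\<^sub>R a) \<bullet> (y - z) + c * (a \<bullet> (y - z))"
        by (simp add: inner_diff_left)
      moreover have "(x - c *\<^sub>R a) \<bullet> (y - z) \<le> 1 * C"
        using u C(2)[OF z] by (intro order_trans[OF norm_cauchy_schwarz] mult_mono) auto
      moreover have "c * (a \<bullet> (y - z)) \<le> 0"
        using hp[OF z] by (intro mult_nonneg_nonpos) (auto simp: c_def)
      ultimately show ?thesis by simp
    qed
    then show "x \<in> A" using L(1) ne by (simp add: A_def gauge_at_le_iff)
  qed
  have disj: "disjoint_family B"
    unfolding disjoint_family_on_def
  proof (intro ballI impI)
    fix m n :: nat assume "m \<noteq> n"
    have "dist ((2 * real m / norm a) *\<^sub>R a) ((2 * real n / norm a) *\<^sub>R a) = 2 * \<bar>real m - real n\<bar>"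
    proof -
      have "(2 * real m / norm a) *\<^sub>R a - (2 * real n / norm a) *\<^sub>R a = (2 * (real m - real n) / norm a) *\<^sub>R a"
        by (simp add: scaleR_diff_left[symmetric] diff_divide_distrib[symmetric] right_diff_distrib)
      then show ?thesis using a(1) abs_mult[of 2 "real m - real n"] by (simp add: dist_norm right_diff_distrib)
    qed
    also have "\<dots> \<ge> 2" using \<open>m \<noteq> n\<close> by (cases "m < n") auto
    finally show "B m \<inter> B n = {}" unfolding B_def by (intro disjoint_ballI) simp
  qed
  define c where "c = measure lborel (ball (0::'a) 1)"
  have c: "0 < c" unfolding c_def using content_ball_pos[of 1 "0::'a"] by simp
  have mB: "emeasure lborel (B n) = ennreal c" for n
  proof -
    have "emeasure lborel (B n) = ennreal (measure lborel (B n))"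
      unfolding B_def by (intro emeasure_eq_ennreal_measure) (use emeasure_lborel_ball_finite in \<open>auto simp: less_top[symmetric]\<close>)
    also have "measure lborel (B n) = c"
      unfolding B_def c_def using content_ball_conv_unit_ball[of 1 "(2 * real n / norm a) *\<^sub>R a"] by simp
    finally show ?thesis .
  qed
  have "emeasure lborel A = \<infinity>"
  proof (rule ccontr)
    assume "emeasure lborel A \<noteq> \<infinity>"
    then obtain r where r: "emeasure lborel A = ennreal r" "0 \<le> r" by (cases "emeasure lborel A") auto
    obtain N where N: "r < real N * c" using reals_Archimedean3[OF c] by blast
    have "ennreal (real N * c) = (\<Sum>n<N. emeasure lborel (B n))"
      using c by (simp add: mB ennreal_mult' ennreal_of_nat_eq_real_of_nat)
    also have "\<dots> = emeasure lborel (\<Union>n<N. B n)"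
      by (rule sum_emeasure) (use disj in \<open>auto simp: B_def disjoint_family_on_def\<close>)
    also have "\<dots> \<le> emeasure lborel A" using BA by (intro emeasure_mono) auto
    finally show False using r N by simp
  qed
  then have "\<infinity> = ennreal (exp (- C)) * emeasure lborel A" by (simp add: ennreal_mult_top)
  also have "\<dots> = (\<integral>\<^sup>+x. ennreal (exp (- C)) * indicator A x \<partial>lborel)"
    by (simp add: nn_integral_cmult_indicator)
  also have "\<dots> \<le> (\<integral>\<^sup>+x. ennreal (exp (- gauge_at L y x)) \<partial>lborel)"
    by (intro nn_integral_mono) (auto simp: A_def indicator_def)
  finally show ?thesis by (simp add: top_unique)
qed

lemma gauge_volume_lower_semicontinuous:
  fixes L :: "'a::euclidean_space set"
  assumes L: "compact L" "L \<noteq> {}" and lim: "u \<longlonglongrightarrow> y"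
  shows "(\<integral>\<^sup>+x. ennreal (exp (- gauge_at L y x)) \<partial>lborel)
    \<le> liminf (\<lambda>n. \<integral>\<^sup>+x. ennreal (exp (- gauge_at L (u n) x)) \<partial>lborel)"
proof -
  note [measurable] = measurable_gauge_at[OF L]
  have l: "(\<lambda>n. ennreal (exp (- gauge_at L (u n) x))) \<longlonglongrightarrow> ennreal (exp (- gauge_at L y x))" for x
    unfolding gauge_at_def by (intro tendsto_ennrealI tendsto_intros lim)
  then have "(\<integral>\<^sup>+x. ennreal (exp (- gauge_at L y x)) \<partial>lborel)
      = (\<integral>\<^sup>+x. liminf (\<lambda>n. ennreal (exp (- gauge_at L (u n) x))) \<partial>lborel)"
    by (intro nn_integral_cong lim_imp_Liminf[symmetric] l) auto
  also have "\<dots> \<le> liminf (\<lambda>n. \<integral>\<^sup>+x. ennreal (exp (- gauge_at L (u n) x)) \<partial>lborel)"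
    by (intro nn_integral_liminf) measurable
  finally show ?thesis .
qed

lemma nn_integral_gauge_volume:
  assumes "compact L" "y \<in> interior L"
  shows "(\<integral>\<^sup>+x. ennreal (exp (- gauge_at L y x)) \<partial>lborel) = ennreal (gauge_moment L v 0 y)"
  using nn_integral_eq_integral[OF gauge_moment_integrable(1)[OF assms, of v 0]]
  by (simp add: gauge_moment_def)

text \<open>A minimizing sequence for the quotient has a limit \<open>y\<close> in the compact set \<open>L2\<close>, which lies in the
interior of \<open>L1\<close>, where the denominator is continuous. Fatou's lemma then bounds the numerator at
\<open>y\<close> by a finite number, which excludes the boundary of \<open>L2\<close> and shows that \<open>y\<close> attains the infimum.\<close>

lemma ratio_minimizer_exists:
  fixes L1 L2 :: "'a::euclidean_space set"
  assumes L1: "compact L1" "convex L1" and L2: "compact L2" "convex L2" "interior L2 \<noteq> {}"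
    and sub: "L2 \<subseteq> interior L1"
  obtains y where "y \<in> interior L2"
    "\<And>w. w \<in> interior L2 \<Longrightarrow>
      gauge_moment L2 v 0 y / gauge_moment L1 v 0 y \<le> gauge_moment L2 v 0 w / gauge_moment L1 v 0 w"
proof -
  define V1 V2 where "V1 = gauge_moment L1 v 0" and "V2 = gauge_moment L2 v 0"
  define I where "I = interior L2"
  define R where "R w = V2 w / V1 w" for w
  have I1: "w \<in> interior L1" if "w \<in> I" for w
    using that sub interior_subset by (auto simp: I_def)
  have V1pos: "0 < V1 w" if "w \<in> interior L1" for w
    unfolding V1_def by (rule gauge_moment_zero_pos[OF L1(1) that])
  have V2pos: "0 < V2 w" if "w \<in> I" for w
    unfolding V2_def by (rule gauge_moment_zero_pos[OF L2(1)]) (use that in \<open>simp add: I_def\<close>)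
  have R0: "0 \<le> R w" if "w \<in> I" for w
    using V1pos[OF I1[OF that]] V2pos[OF that] by (simp add: R_def)
  define m where "m = (INF w\<in>I. R w)"
  have bdd: "bdd_below (R ` I)" using R0 by (intro bdd_belowI2)
  have m: "m \<le> R w" if "w \<in> I" for w unfolding m_def by (rule cINF_lower[OF bdd that])
  have "\<exists>w\<in>I. R w < m + 1 / real (Suc n)" for n
  proof -
    have "(INF w\<in>I. R w) < m + 1 / real (Suc n)" by (simp add: m_def)
    then show ?thesis using L2(3) bdd by (subst (asm) cINF_less_iff) (auto simp: I_def)
  qed
  then obtain u where u: "\<And>n. u n \<in> I" "\<And>n. R (u n) < m + 1 / real (Suc n)" by metis
  have "\<forall>n. u n \<in> L2" using u(1) interior_subset by (auto simp: I_def)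
  then obtain y r where y: "y \<in> L2" "strict_mono r" "(u \<circ> r) \<longlonglongrightarrow> y"
    using L2(1) unfolding compact_def by blast
  have y1: "y \<in> interior L1" using y sub by auto
  have Rlim: "(\<lambda>n. R (u (r n))) \<longlonglongrightarrow> m"
  proof (rule real_tendsto_sandwich)
    show "\<forall>\<^sub>F n in sequentially. m \<le> R (u (r n))" using m u by auto
    show "\<forall>\<^sub>F n in sequentially. R (u (r n)) \<le> m + 1 / real (Suc (r n))" by (intro always_eventually allI less_imp_le u(2))
    have "(\<lambda>n. 1 / real (Suc n)) \<longlonglongrightarrow> 0" by (rule LIMSEQ_Suc[OF lim_1_over_n])
    from LIMSEQ_subseq_LIMSEQ[OF this y(2)]
    show "(\<lambda>n. m + 1 / real (Suc (r n))) \<longlonglongrightarrow> m"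
      using tendsto_add[OF tendsto_const[of m]] by (force simp: o_def)
  qed auto
  have V1lim: "(\<lambda>n. V1 (u (r n))) \<longlonglongrightarrow> V1 y"
    using continuous_on_tendsto_compose[OF gauge_volume_continuous[OF L1] y(3) y1] u(1) I1
    by (auto simp: V1_def o_def)
  have "(\<lambda>n. V2 (u (r n))) \<longlonglongrightarrow> m * V1 y"
  proof -
    have "V2 (u (r n)) = R (u (r n)) * V1 (u (r n))" for n
      using V1pos[OF I1[OF u(1)[of "r n"]]] by (simp add: R_def)
    then show ?thesis using tendsto_mult[OF Rlim V1lim] by simp
  qed
  then have "(\<lambda>n. ennreal (V2 (u (r n)))) \<longlonglongrightarrow> ennreal (m * V1 y)"
    by (rule tendsto_ennrealI)
  then have lim2: "liminf (\<lambda>n. ennreal (V2 (u (r n)))) = ennreal (m * V1 y)"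
    by (intro lim_imp_Liminf) auto
  have "(\<integral>\<^sup>+x. ennreal (exp (- gauge_at L2 y x)) \<partial>lborel)
      \<le> liminf (\<lambda>n. \<integral>\<^sup>+x. ennreal (exp (- gauge_at L2 ((u \<circ> r) n) x)) \<partial>lborel)"
    by (rule gauge_volume_lower_semicontinuous[OF L2(1) _ y(3)]) (use L2(3) interior_subset in auto)
  also have "\<dots> = liminf (\<lambda>n. ennreal (V2 (u (r n))))"
    using nn_integral_gauge_volume[OF L2(1), of _ v] u(1) by (simp add: V2_def I_def)
  finally have W: "(\<integral>\<^sup>+x. ennreal (exp (- gauge_at L2 y x)) \<partial>lborel) \<le> ennreal (m * V1 y)"
    unfolding lim2 .
  have yI: "y \<in> I"
  proof (rule ccontr)
    assume "y \<notin> I"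
    then show False using gauge_volume_infinite[OF L2, of y] W by (simp add: I_def top_unique)
  qed
  have m0: "0 \<le> m" unfolding m_def using R0 L2(3) by (intro cINF_greatest) (auto simp: I_def)
  have "ennreal (V2 y) \<le> ennreal (m * V1 y)"
    using W nn_integral_gauge_volume[OF L2(1), of y v] yI by (simp add: V2_def I_def)
  then have "V2 y \<le> m * V1 y" using m0 V1pos[OF y1] by (simp add: ennreal_le_iff)
  then have "R y \<le> m" using V1pos[OF y1] by (simp add: R_def pos_divide_le_eq)
  then show thesis
    using that[of y] yI m order_trans unfolding I_def R_def V1_def V2_def by blast
qed

text \<open>At a minimizer of the quotient the derivatives along every line vanish, which says that the
logarithmic slopes of both bodies agree in every direction.\<close>

theorem santalo_point_exists:
  fixes L1 L2 :: "'a::euclidean_space set"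
  assumes L1: "compact L1" "convex L1" and L2: "compact L2" "convex L2" "interior L2 \<noteq> {}"
    and sub: "L2 \<subseteq> interior L1"
  shows "\<exists>y. santalo_point L1 L2 y"
proof -
  obtain y where y: "y \<in> interior L2" and min: "\<And>w. w \<in> interior L2 \<Longrightarrow>
      gauge_moment L2 0 0 y / gauge_moment L1 0 0 y \<le> gauge_moment L2 0 0 w / gauge_moment L1 0 0 w"
    using ratio_minimizer_exists[OF assms, of 0] by blast
  have y1: "y \<in> interior L1" using y sub interior_subset by blast
  have "log_slope L1 v y = log_slope L2 v y" for v
  proof -
    define g1 g2 where "g1 = (\<lambda>t. gauge_moment L1 v 0 (y + t *\<^sub>R v))" and "g2 = (\<lambda>t. gauge_moment L2 v 0 (y + t *\<^sub>R v))"
    define a1 a2 where "a1 = gauge_moment L1 v 1 y" and "a2 = gauge_moment L2 v 1 y"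
    have d1: "(g1 has_real_derivative - a1) (at 0)" and d2: "(g2 has_real_derivative - a2) (at 0)"
      using gauge_moment_has_derivative[OF L1(1), of y 0 v 0] gauge_moment_has_derivative[OF L2(1), of y 0 v 0] y y1
      by (simp_all add: g1_def g2_def a1_def a2_def)
    have pos: "0 < g1 0" "0 < g2 0"
      using gauge_moment_zero_pos[OF L1(1) y1] gauge_moment_zero_pos[OF L2(1) y] by (auto simp: g1_def g2_def)
    have D: "((\<lambda>t. g2 t / g1 t) has_real_derivative ((- a2 * g1 0 - g2 0 * (- a1)) / (g1 0 * g1 0))) (at 0)"
      using pos by (intro DERIV_divide d1 d2) auto
    have "\<forall>\<^sub>F t in nhds (0::real). y + t *\<^sub>R v \<in> interior L2"
    proof (rule topological_tendstoD)
      show "((\<lambda>t. y + t *\<^sub>R v) \<longlongrightarrow> y) (nhds (0::real))"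
        by (auto intro!: tendsto_eq_intros filterlim_ident)
    qed (use y in auto)
    then obtain e where e: "0 < e" "\<And>t. dist t 0 < e \<Longrightarrow> y + t *\<^sub>R v \<in> interior L2"
      unfolding eventually_nhds_metric by blast
    have "\<forall>t. \<bar>0 - t\<bar> < e \<longrightarrow> g2 0 / g1 0 \<le> g2 t / g1 t"
      using min e(2) unfolding g1_def g2_def gauge_moment_zero_indep[of _ v 0] by (simp add: dist_norm)
    from DERIV_local_min[OF D e(1) this]
    have "a1 * g2 0 = a2 * g1 0" using pos by (simp add: mult.commute)
    then have "a1 / g1 0 = a2 / g2 0" using pos by (simp add: field_simps)
    then show ?thesis by (simp add: log_slope_def a1_def a2_def g1_def g2_def)
  qed
  then show ?thesis
    using santalo_point_iff_log_slope[OF L1(1) L2(1) y1 y] by blast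
qed

section \<open>Hilbert diameter and the widths of polar bodies\<close>

text \<open>With \<open>p = \<surd>(a1 b1)\<close> and \<open>q = \<surd>(a2 b2)\<close>, the inequality of arithmetic and geometric means gives
\<open>(p + q)\<^sup>2 \<le> (a1 + b2) (b1 + a2)\<close> and \<open>(a2 - a1) (b2 - b1) \<le> (q - p)\<^sup>2\<close>: for given products
the cross-ratio is smallest when both intervals are symmetric about \<open>0\<close>.\<close>

lemma product_lt_of_cross_ratio_lt:
  fixes a1 b1 a2 b2 k :: real
  assumes ab: "0 \<le> a1" "a1 < a2" "0 \<le> b1" "b1 < b2" and k: "0 < k" "k < 1"
    and cr: "(a1 + b2) * (b1 + a2) < ((1 + k) / (1 - k))\<^sup>2 * ((a2 - a1) * (b2 - b1))"
  shows "a1 * b1 < k\<^sup>2 * (a2 * b2)"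
proof -
  define p q where "p = sqrt (a1 * b1)" and "q = sqrt (a2 * b2)"
  have p: "0 \<le> p" "p\<^sup>2 = a1 * b1" and q: "0 \<le> q" "q\<^sup>2 = a2 * b2"
    using ab by (auto simp: p_def q_def)
  have "p\<^sup>2 < q\<^sup>2" unfolding p q using ab by (intro mult_strict_mono') auto
  then have pq: "p < q" using q(1) by (rule power2_less_imp_less)
  have am: "2 * (p * q) \<le> x + y" if "x * y = (p * q)\<^sup>2" "0 \<le> x" "0 \<le> y" for x y :: real
    using arith_geo_mean[of "p * q" x y] that by simp
  have e: "(p * q)\<^sup>2 = a1 * b1 * (a2 * b2)" by (simp add: power_mult_distrib p q)
  have "(p + q)\<^sup>2 = p\<^sup>2 + q\<^sup>2 + 2 * (p * q)" by (simp add: power2_eq_square algebra_simps)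
  also have "\<dots> \<le> (a1 + b2) * (b1 + a2)"
    using am[of "a1 * a2" "b1 * b2"] ab unfolding e p q by (simp add: algebra_simps)
  also have "\<dots> < ((1 + k) / (1 - k))\<^sup>2 * ((a2 - a1) * (b2 - b1))" by (rule cr)
  also have "\<dots> \<le> ((1 + k) / (1 - k))\<^sup>2 * (q - p)\<^sup>2"
  proof (rule mult_left_mono)
    have "(a2 - a1) * (b2 - b1) \<le> q\<^sup>2 + p\<^sup>2 - 2 * (p * q)"
      using am[of "a2 * b1" "a1 * b2"] ab unfolding e p q by (simp add: algebra_simps)
    also have "\<dots> = (q - p)\<^sup>2" by (simp add: power2_eq_square algebra_simps)
    finally show "(a2 - a1) * (b2 - b1) \<le> (q - p)\<^sup>2" .
  qed simp
  finally have "(p + q)\<^sup>2 < ((1 + k) / (1 - k) * (q - p))\<^sup>2" by (simp only: power_mult_distrib)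
  then have "p + q < (1 + k) / (1 - k) * (q - p)"
    by (rule power2_less_imp_less) (use k pq in auto)
  then have "(p + q) * (1 - k) < (1 + k) * (q - p)" using k by (simp add: field_simps)
  then have "p < k * q" by (simp add: algebra_simps)
  then have "p\<^sup>2 < (k * q)\<^sup>2" using p by (intro power_strict_mono) auto
  then show ?thesis by (simp add: power_mult_distrib p q)
qed

text \<open>The largest value of \<open>u \<bullet> v\<close> on the polar body is the reciprocal of the distance, measured in
multiples of \<open>v\<close>, from \<open>y\<close> to the boundary point of \<open>L\<close> in direction \<open>- v\<close>. The maximum is attained
at a normalized supporting functional of \<open>L\<close> at that boundary point.\<close>

lemma polar_body_width:
  fixes L :: "'a::euclidean_space set"
  assumes L: "compact L" "convex L" and y: "y \<in> interior L" and "v \<noteq> 0"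
  obtains s u where "0 < s" "y - s *\<^sub>R v \<in> frontier L" "u \<in> polar_body L y" "u \<bullet> v = 1 / s"
    "\<forall>u\<in>polar_body L y. u \<bullet> v \<le> 1 / s"
proof -
  obtain s where s: "0 < s" "y + s *\<^sub>R (- v) \<in> frontier L"
    using ray_to_frontier[OF compact_imp_bounded[OF L(1)] y, of "- v"] \<open>v \<noteq> 0\<close> by auto
  define z0 where "z0 = y - s *\<^sub>R v"
  have z0: "z0 \<in> frontier L" using s by (simp add: z0_def)
  then have z0L: "z0 \<in> L" "z0 \<notin> interior L"
    using L(1) by (auto simp: frontier_def compact_imp_closed)
  obtain a where a: "a \<noteq> 0" "\<And>z. z \<in> L \<Longrightarrow> a \<bullet> z0 \<le> a \<bullet> z"
    using supporting_functional[OF L(2) _ z0L(2)] y by blast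
  obtain e where e: "0 < e" "cball y e \<subseteq> L" using y mem_interior_cball by blast
  have "y - (e / norm a) *\<^sub>R a \<in> L" using e a(1) by (intro subsetD[OF e(2)]) (auto simp: dist_norm)
  from a(2)[OF this] have "a \<bullet> z0 \<le> a \<bullet> y - e * norm a"
    using a(1) by (simp add: inner_diff_right power2_norm_eq_inner[symmetric] power2_eq_square)
  moreover have "0 < e * norm a" using e a(1) by simp
  ultimately have av: "0 < s * (a \<bullet> v)" by (simp add: z0_def inner_diff_right)
  define u where "u = (1 / (s * (a \<bullet> v))) *\<^sub>R a"
  have "u \<in> polar_body L y"
    unfolding polar_body_def
  proof (intro CollectI ballI)
    fix z assume "z \<in> L"
    then have "a \<bullet> (y - z) \<le> s * (a \<bullet> v)" using a(2)[of z] by (simp add: z0_def inner_diff_right)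
    then show "u \<bullet> (y - z) \<le> 1" using av by (simp add: u_def field_simps)
  qed
  moreover have "a \<bullet> v \<noteq> 0" "s \<noteq> 0" using av by auto
  then have "u \<bullet> v = 1 / s" by (simp add: u_def)
  moreover have "w \<bullet> v \<le> 1 / s" if "w \<in> polar_body L y" for w
  proof -
    have "w \<bullet> (y - z0) \<le> 1" using that z0L by (auto simp: polar_body_def)
    then show ?thesis using s(1) by (simp add: z0_def field_simps)
  qed
  ultimately show thesis using that[of s u] s(1) z0 by (simp add: z0_def)
qed

lemma frontier_beyond_inner_body:
  fixes L1 :: "'a::euclidean_space set"
  assumes "convex L1" "y \<in> interior L1" "y + s *\<^sub>R v \<in> interior L1" "y + t *\<^sub>R v \<in> frontier L1" "0 < t" "0 < s"
  shows "s < t"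
proof (rule ccontr)
  assume "\<not> s < t"
  then have "(1 - t / s) *\<^sub>R y + (t / s) *\<^sub>R (y + s *\<^sub>R v) \<in> interior L1"
    using assms by (intro convexD_alt[OF convex_interior]) auto
  moreover have "(1 - t / s) *\<^sub>R y + (t / s) *\<^sub>R (y + s *\<^sub>R v) = y + t *\<^sub>R v"
    using assms by (simp add: algebra_simps)
  ultimately show False using assms(4) by (simp add: frontier_def)
qed

text \<open>Without an upper bound the supremum in \<open>hilbert_diam\<close> would be an unspecified real number. Points of
\<open>L2\<close> keep a positive distance from \<open>frontier L1\<close>, and for collinear points the inner products in
the cross-ratio are products of distances up to sign.\<close>

lemma hilbert_diam_bdd_above:
  fixes L1 L2 :: "'a::euclidean_space set"
  assumes "compact L1" "compact L2" "L2 \<subseteq> interior L1"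
  shows "bdd_above {v. \<exists>p\<in>L2. \<exists>q\<in>L2. (p = q \<and> v = 0) \<or>
     (p \<noteq> q \<and> (\<exists>a\<in>frontier L1. \<exists>b\<in>frontier L1. a \<noteq> b \<and> collinear {p, q, a, b} \<and>
        v = 1/2 * ln \<bar>cross_ratio p q a b\<bar>))}"
proof -
  have "L2 \<inter> frontier L1 = {}" using assms(3) by (auto simp: frontier_def)
  then obtain \<delta> where \<delta>: "0 < \<delta>" "\<And>x z. x \<in> L2 \<Longrightarrow> z \<in> frontier L1 \<Longrightarrow> \<delta> \<le> dist x z"
    using separate_compact_closed[OF assms(2) frontier_closed] by metis
  obtain D where D: "\<And>x z. x \<in> L1 \<Longrightarrow> z \<in> L1 \<Longrightarrow> dist x z \<le> D"
    using compact_imp_bounded[OF assms(1)] unfolding bounded_two_points by auto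
  have sub: "L2 \<subseteq> L1" "frontier L1 \<subseteq> L1"
    using assms interior_subset by (auto simp: frontier_def compact_imp_closed)
  have "1/2 * ln \<bar>cross_ratio p q a b\<bar> \<le> 1/2 * ln (D * D / (\<delta> * \<delta>))"
    if pq: "p \<in> L2" "q \<in> L2" and ab: "a \<in> frontier L1" "b \<in> frontier L1" and col: "collinear {p, q, a, b}" for p q a b
  proof -
    obtain u where u: "\<And>x z. x \<in> {p, q, a, b} \<Longrightarrow> z \<in> {p, q, a, b} \<Longrightarrow> \<exists>c. x - z = c *\<^sub>R u"
      using col unfolding collinear_def by blast
    have inner: "\<bar>(x - z) \<bullet> (x' - z')\<bar> = dist x z * dist x' z'"
      if xz: "x \<in> {p, q, a, b}" "z \<in> {p, q, a, b}" "x' \<in> {p, q, a, b}" "z' \<in> {p, q, a, b}" for x z x' z'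
    proof -
      obtain c c' where "x - z = c *\<^sub>R u" "x' - z' = c' *\<^sub>R u" using u xz by meson
      then show ?thesis by (simp add: dist_norm abs_mult power2_norm_eq_inner[symmetric] power2_eq_square)
    qed
    have "\<bar>cross_ratio p q a b\<bar> = (dist p a * dist q b) / (dist p b * dist q a)"
      by (simp add: cross_ratio_def abs_divide inner)
    moreover have "(dist p a * dist q b) / (dist p b * dist q a) \<le> D * D / (\<delta> * \<delta>)"
      using pq ab sub \<delta>(1) by (intro frac_le mult_mono D \<delta>(2)) (auto intro: order_trans[OF zero_le_dist D])
    moreover have "0 < dist p a" "0 < dist q b" "0 < dist p b" "0 < dist q a"
      using \<delta> pq ab by (meson less_le_trans)+
    ultimately show ?thesis by (auto intro!: ln_mono)
  qed
  then show ?thesis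
    by (intro bdd_aboveI[of _ "max 0 (1/2 * ln (D * D / (\<delta> * \<delta>)))"]) (auto simp: le_max_iff_disj)
qed

lemma hilbert_diam_ge_on_line:
  fixes L1 L2 :: "'a::euclidean_space set"
  assumes L: "compact L1" "compact L2" "L2 \<subseteq> interior L1" and "v \<noteq> 0"
    and pos: "0 < s2" "s2 < s1" "0 < t2" "t2 < t1"
    and mem: "y - s2 *\<^sub>R v \<in> L2" "y + t2 *\<^sub>R v \<in> L2" "y - s1 *\<^sub>R v \<in> frontier L1" "y + t1 *\<^sub>R v \<in> frontier L1"
  shows "1/2 * ln ((t2 + s1) * (s2 + t1) / ((t1 - t2) * (s1 - s2))) \<le> hilbert_diam L1 L2"
  unfolding hilbert_diam_def
proof (rule cSup_upper[OF _ hilbert_diam_bdd_above[OF L]], rule CollectI)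
  define p q a b where "p = y + t2 *\<^sub>R v" and "q = y + (- s2) *\<^sub>R v" and "a = y + (- s1) *\<^sub>R v" and "b = y + t1 *\<^sub>R v"
  have "p \<noteq> q" "a \<noteq> b" using pos \<open>v \<noteq> 0\<close> by (auto simp: p_def q_def a_def b_def simp flip: scaleR_minus_left)
  moreover have "collinear {p, q, a, b}"
    unfolding collinear_alt p_def q_def a_def b_def by blast
  moreover have "\<bar>cross_ratio p q a b\<bar> = (t2 + s1) * (s2 + t1) / ((t1 - t2) * (s1 - s2))"
  proof -
    have "cross_ratio p q a b = ((t2 - (- s1)) * (- s2 - t1)) / ((t2 - t1) * (- s2 - (- s1)))"
      unfolding p_def q_def a_def b_def by (rule cross_ratio_on_line[OF \<open>v \<noteq> 0\<close>])
    also have "\<dots> = - ((t2 + s1) * (s2 + t1)) / (- ((t1 - t2) * (s1 - s2)))"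
      by (intro arg_cong2[of _ _ _ _ "(/)"]) (simp_all add: algebra_simps)
    also have "\<dots> = (t2 + s1) * (s2 + t1) / ((t1 - t2) * (s1 - s2))" by simp
    finally show ?thesis using pos by simp
  qed
  moreover have "p \<in> L2" "q \<in> L2" "a \<in> frontier L1" "b \<in> frontier L1"
    using mem by (auto simp: p_def q_def a_def b_def)
  ultimately show "\<exists>p\<in>L2. \<exists>q\<in>L2. (p = q \<and> 1/2 * ln ((t2 + s1) * (s2 + t1) / ((t1 - t2) * (s1 - s2))) = 0) \<or>
     (p \<noteq> q \<and> (\<exists>a\<in>frontier L1. \<exists>b\<in>frontier L1. a \<noteq> b \<and> collinear {p, q, a, b} \<and>
        1/2 * ln ((t2 + s1) * (s2 + t1) / ((t1 - t2) * (s1 - s2))) = 1/2 * ln \<bar>cross_ratio p q a b\<bar>))"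
    by metis
qed

section \<open>Uniqueness of Santalo points\<close>

text \<open>Just after \<open>0\<close> the function is negative, so at its first later zero it would have to arrive from below,
which a negative derivative forbids.\<close>

lemma no_two_zeros_if_decreasing_at_zeros:
  fixes f f' :: "real \<Rightarrow> real"
  assumes deriv: "\<And>t. 0 \<le> t \<Longrightarrow> t \<le> 1 \<Longrightarrow> (f has_real_derivative f' t) (at t)"
    and neg: "\<And>t. 0 \<le> t \<Longrightarrow> t \<le> 1 \<Longrightarrow> f t = 0 \<Longrightarrow> f' t < 0"
    and ends: "f 0 = 0" "f 1 = 0"
  shows False
proof -
  have cont: "continuous_on {0..1} f"
    using deriv by (intro DERIV_atLeastAtMost_imp_continuous_on) blast
  obtain e where e: "0 < e" "\<And>h. 0 < h \<Longrightarrow> h < e \<Longrightarrow> f (0 + h) < f 0"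
    using DERIV_neg_dec_right[OF deriv[of 0]] neg[of 0] ends by auto
  \<comment> \<open>From a point \<open>h0\<close> with \<open>f h0 < 0\<close>, let \<open>t\<close> be the first zero after \<open>h0\<close>; a positive value shortly before \<open>t\<close> yields an earlier one.\<close>
  define h0 where "h0 = min (e / 2) (1 / 2)"
  have h0: "0 < h0" "h0 < 1" "f h0 < 0" using e(1) e(2)[of h0] ends by (auto simp: h0_def)
  define Z where "Z = {t \<in> {h0..1}. f t = 0}"
  have "closed Z"
  proof -
    have "closed ({h0..1} \<inter> f -` {0})"
      using h0 by (intro continuous_closed_preimage continuous_on_subset[OF cont]) auto
    then show ?thesis by (simp add: Z_def vimage_def Int_def)
  qed
  moreover have "1 \<in> Z" using h0 ends by (auto simp: Z_def)
  moreover have bdd: "bdd_below Z" by (auto simp: Z_def)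
  ultimately have iZ: "Inf Z \<in> Z" by (intro closed_contains_Inf) auto
  define t where "t = Inf Z"
  have t: "h0 \<le> t" "t \<le> 1" "f t = 0" using iZ by (auto simp: Z_def t_def)
  have "h0 < t" using t h0 by (cases "t = h0") auto
  obtain e' where e': "0 < e'" "\<And>h. 0 < h \<Longrightarrow> h < e' \<Longrightarrow> f t < f (t - h)"
    using DERIV_neg_dec_left[OF deriv[of t]] neg[of t] t h0 by auto
  define h where "h = min (e' / 2) ((t - h0) / 2)"
  have h: "0 < h" "h < e'" "h < t - h0" using e'(1) \<open>h0 < t\<close> by (auto simp: h_def min_def field_simps)
  have "\<exists>s. h0 \<le> s \<and> s \<le> t - h \<and> f s = 0"
    using h0 h t e'(2)[OF h(1,2)] by (intro IVT' continuous_on_subset[OF cont]) auto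
  then obtain s where s: "h0 \<le> s" "s \<le> t - h" "f s = 0" by auto
  then have "s \<in> Z" using t h by (auto simp: Z_def)
  then have "t \<le> s" unfolding t_def by (rule cInf_lower[OF _ bdd])
  then show False using s h by linarith
qed

definition polar_variance :: "'a::euclidean_space set \<Rightarrow> 'a \<Rightarrow> 'a \<Rightarrow> real \<Rightarrow> real" where
  "polar_variance L v y m =
     (LINT x:polar_body L y|lborel. (x \<bullet> v - m)\<^sup>2) / measure lborel (polar_body L y)"

text \<open>The logarithmic slope is \<open>d + 1\<close> times the mean \<open>m\<close> of the polar body in direction \<open>v\<close>, and its
derivative is \<open>- (d + 1) (d + 2)\<close> times the second moment plus \<open>((d + 1) m)\<^sup>2\<close>. Splitting the
second moment into variance and \<open>m\<^sup>2\<close> leaves a term that depends on \<open>m\<close> alone, so it cancels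
between two bodies with the same mean.\<close>

lemma polar_body_mean_and_slope_derivative:
  fixes L :: "'a::euclidean_space set"
  assumes L: "compact L" and y: "y + \<tau> *\<^sub>R v \<in> interior L"
  defines "d \<equiv> real DIM('a)" and "w \<equiv> y + \<tau> *\<^sub>R v"
  shows "(LINT x:polar_body L w|lborel. x \<bullet> v - log_slope L v w / (d + 1)) = 0"
    and "((\<lambda>t. log_slope L v (y + t *\<^sub>R v)) has_real_derivative
      - ((d + 1) * (d + 2)) * polar_variance L v w (log_slope L v w / (d + 1)) - (log_slope L v w)\<^sup>2 / (d + 1)) (at \<tau>)"
proof -
  define P where "P = polar_body L w"
  have wL: "w \<in> interior L" using y by (simp add: w_def)
  have P: "compact P" unfolding P_def by (rule polar_body_compact[OF L wL])
  define V M1 M2 where "V = measure lborel P" and "M1 = (LINT x:P|lborel. x \<bullet> v)" and "M2 = (LINT x:P|lborel. (x \<bullet> v)\<^sup>2)"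
  have V: "0 < V" unfolding V_def P_def by (rule polar_body_measure_pos[OF L wL])
  have d: "0 < d" by (simp add: d_def)
  define F where "F = (fact DIM('a) :: real)"
  have F: "0 < F" by (simp add: F_def)
  have g0: "gauge_moment L v 0 w = F * V"
    using gauge_moment_eq[OF L wL, of v 0] by (simp add: P_def F_def V_def set_lebesgue_integral_def)
  have g1: "gauge_moment L v 1 w = F * ((d + 1) * M1)"
    using gauge_moment_eq[OF L wL, of v 1] by (simp add: P_def F_def M1_def d_def algebra_simps)
  have g2: "gauge_moment L v 2 w = F * ((d + 1) * (d + 2) * M2)"
    using gauge_moment_eq[OF L wL, of v 2] by (simp add: P_def F_def M2_def d_def algebra_simps numeral_2_eq_2)
  have sl: "log_slope L v w = (d + 1) * (M1 / V)"
    unfolding log_slope_def g0 g1 using F V by simp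
  define m where "m = log_slope L v w / (d + 1)"
  have m: "m = M1 / V" using d by (simp add: m_def sl)
  have i: "set_integrable lborel P (\<lambda>x. (x \<bullet> v)\<^sup>2)" "set_integrable lborel P (\<lambda>x. x \<bullet> v)"
    "set_integrable lborel P (\<lambda>x. c)" for c :: real
    by (intro set_integrable_continuous_compact P continuous_intros)+
  have c: "(LINT x:P|lborel. c) = c * V" for c :: real
    by (simp add: set_lebesgue_integral_def V_def)
  have mean: "(LINT x:P|lborel. x \<bullet> v - m) = 0"
    using i V by (simp add: set_integral_diff c M1_def[symmetric] m)
  then show "(LINT x:polar_body L w|lborel. x \<bullet> v - log_slope L v w / (d + 1)) = 0"
    by (simp add: P_def m_def)
  have "(LINT x:P|lborel. (x \<bullet> v - m)\<^sup>2) = (LINT x:P|lborel. (x \<bullet> v)\<^sup>2 - (2 * m * (x \<bullet> v) - m\<^sup>2))"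
    by (simp add: power2_diff algebra_simps)
  also have "\<dots> = M2 - (2 * m * M1 - m\<^sup>2 * V)"
    using i(1) i(2) i(3)[of "m\<^sup>2"] set_integrable_mult_right[of "2 * m" lborel P "\<lambda>x. x \<bullet> v"]
    by (simp add: set_integral_diff c M1_def M2_def)
  also have "\<dots> = M2 - m\<^sup>2 * V" using V by (simp add: m power2_eq_square)
  finally have var: "polar_variance L v w m = M2 / V - m\<^sup>2"
    using V by (simp add: polar_variance_def P_def[symmetric] V_def[symmetric] diff_divide_distrib)
  have D: "((\<lambda>t. log_slope L v (y + t *\<^sub>R v)) has_real_derivative
     (- gauge_moment L v 2 w * gauge_moment L v 0 w - gauge_moment L v 1 w * (- gauge_moment L v 1 w)) / (gauge_moment L v 0 w * gauge_moment L v 0 w)) (at \<tau>)"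
  proof -
    have g0': "gauge_moment L v 0 (y + \<tau> *\<^sub>R v) \<noteq> 0" using g0 F V by (simp add: w_def)
    show ?thesis
      using DERIV_divide[OF gauge_moment_has_derivative[OF L y, of 1] gauge_moment_has_derivative[OF L y, of 0] g0']
      unfolding log_slope_def w_def by (simp add: numeral_2_eq_2)
  qed
  have "(- gauge_moment L v 2 w * gauge_moment L v 0 w - gauge_moment L v 1 w * (- gauge_moment L v 1 w)) / (gauge_moment L v 0 w * gauge_moment L v 0 w)
     = - ((d + 1) * (d + 2)) * (M2 / V) + ((d + 1) * m)\<^sup>2"
    unfolding g0 g1 g2 m using F V by (simp add: field_simps power2_eq_square)
  also have "\<dots> = - ((d + 1) * (d + 2)) * polar_variance L v w m - (d + 1) * m\<^sup>2"
    unfolding var by (simp add: algebra_simps power2_eq_square)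
  also have "(d + 1) * m\<^sup>2 = (log_slope L v w)\<^sup>2 / (d + 1)"
    unfolding m_def using d by (simp add: power_divide power2_eq_square)
  finally show "((\<lambda>t. log_slope L v (y + t *\<^sub>R v)) has_real_derivative
      - ((d + 1) * (d + 2)) * polar_variance L v w (log_slope L v w / (d + 1)) - (log_slope L v w)\<^sup>2 / (d + 1)) (at \<tau>)"
    using D unfolding m_def by simp
qed

text \<open>The mean of a function is at least its infimum.\<close>

lemma extent_nonneg:
  fixes P :: "'a::euclidean_space set"
  assumes "compact P" "0 < measure lborel P" "(LINT x:P|lborel. x \<bullet> v - m) = 0"
    and "\<And>x. x \<in> P \<Longrightarrow> m - a \<le> x \<bullet> v"
  shows "0 \<le> a"
proof -
  have "(LINT x:P|lborel. - a) \<le> (LINT x:P|lborel. x \<bullet> v - m)"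
    using assms(4) by (intro set_integral_mono set_integrable_continuous_compact assms continuous_intros) force
  also have "(LINT x:P|lborel. - a) = - a * measure lborel P" by (simp add: set_lebesgue_integral_def)
  finally show ?thesis using assms(2,3) by (simp add: zero_le_mult_iff)
qed

text \<open>The two variance bounds, applied to the polar bodies with the intervals \<open>[m - a1, m + b1]\<close> and
\<open>[m - a2, m + b2]\<close> into which they project. The endpoints are reciprocals of the endpoints of the
sections of \<open>L1\<close> and \<open>L2\<close> by the line through \<open>y\<close> with direction \<open>v\<close>; taking reciprocals and
translating by \<open>m\<close> preserves cross-ratios, so the Hilbert diameter controls the four numbers.\<close>

lemma polar_variance_less:
  fixes L1 L2 :: "'a::euclidean_space set"
  assumes L1: "compact L1" "convex L1" and L2: "compact L2" "convex L2"
    and sub: "L2 \<subseteq> interior L1" and d2: "2 \<le> DIM('a)"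
    and hil: "hilbert_diam L1 L2 < ln ((1 + kappa DIM('a)) / (1 - kappa DIM('a)))"
    and y: "y \<in> interior L2" and "v \<noteq> 0"
    and mean1: "(LINT x:polar_body L1 y|lborel. x \<bullet> v - m) = 0"
    and mean2: "(LINT x:polar_body L2 y|lborel. x \<bullet> v - m) = 0"
  shows "polar_variance L1 v y m < polar_variance L2 v y m"
proof -
  have y1: "y \<in> interior L1" using y sub interior_subset by blast
  define P1 P2 where "P1 = polar_body L1 y" and "P2 = polar_body L2 y"
  have P: "compact P1" "compact P2" "convex P1" "convex P2" "0 < measure lborel P1" "0 < measure lborel P2"
    unfolding P1_def P2_def
    by (auto intro: polar_body_compact polar_body_convex polar_body_measure_pos L1 L2 y y1)
  note mean = mean1[folded P1_def] mean2[folded P2_def]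
  have nv: "- v \<noteq> 0" using \<open>v \<noteq> 0\<close> by simp
  obtain s1 where s1: "0 < s1" "y - s1 *\<^sub>R v \<in> frontier L1" "\<forall>u\<in>P1. u \<bullet> v \<le> 1 / s1"
    unfolding P1_def by (rule polar_body_width[OF L1 y1 \<open>v \<noteq> 0\<close>])
  obtain t1 where t1: "0 < t1" "y - t1 *\<^sub>R (- v) \<in> frontier L1" "\<forall>u\<in>P1. u \<bullet> (- v) \<le> 1 / t1"
    unfolding P1_def by (rule polar_body_width[OF L1 y1 nv])
  obtain s2 q where s2: "0 < s2" "y - s2 *\<^sub>R v \<in> frontier L2" "q \<in> P2" "q \<bullet> v = 1 / s2"
      "\<forall>u\<in>P2. u \<bullet> v \<le> 1 / s2"
    unfolding P2_def by (rule polar_body_width[OF L2 y \<open>v \<noteq> 0\<close>])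
  obtain t2 p where t2: "0 < t2" "y - t2 *\<^sub>R (- v) \<in> frontier L2" "p \<in> P2" "p \<bullet> (- v) = 1 / t2"
      "\<forall>u\<in>P2. u \<bullet> (- v) \<le> 1 / t2"
    unfolding P2_def by (rule polar_body_width[OF L2 y nv])
  have mem: "y - s2 *\<^sub>R v \<in> L2" "y + t2 *\<^sub>R v \<in> L2"
    using s2(2) t2(2) L2(1) by (auto simp: frontier_def compact_imp_closed)
  have fr: "y - s1 *\<^sub>R v \<in> frontier L1" "y + t1 *\<^sub>R v \<in> frontier L1" using s1 t1 by auto
  have st: "s2 < s1" "t2 < t1"
    using frontier_beyond_inner_body[OF L1(2) y1, of s2 "- v" s1] frontier_beyond_inner_body[OF L1(2) y1, of t2 v t1]
      mem fr sub s1(1) s2(1) t1(1) t2(1) by auto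
  define a1 b1 a2 b2 where "a1 = m + 1 / t1" and "b1 = 1 / s1 - m" and "a2 = m + 1 / t2" and "b2 = 1 / s2 - m"
  have ran1: "m - a1 \<le> x \<bullet> v \<and> x \<bullet> v \<le> m + b1" if "x \<in> P1" for x
    using bspec[OF s1(3) that] bspec[OF t1(3) that] by (simp add: a1_def b1_def)
  have ran2: "m - a2 \<le> x \<bullet> v \<and> x \<bullet> v \<le> m + b2" if "x \<in> P2" for x
    using bspec[OF s2(5) that] bspec[OF t2(5) that] by (simp add: a2_def b2_def)
  have pq: "p \<bullet> v = m - a2" "q \<bullet> v = m + b2" using s2(4) t2(4) by (simp_all add: a2_def b2_def)
  have "0 \<le> a1" by (rule extent_nonneg[OF P(1,5) mean(1)]) (use ran1 in auto)
  have "0 \<le> b1"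
  proof (rule extent_nonneg[OF P(1,5), of "- v" "- m"])
    have "(LINT x:P1|lborel. x \<bullet> (- v) - (- m)) = (LINT x:P1|lborel. - (x \<bullet> v - m))" by simp
    also have "\<dots> = 0"
      using mean(1) unfolding set_lebesgue_integral_def
      by (simp only: scaleR_minus_right Bochner_Integration.integral_minus)
    finally show "(LINT x:P1|lborel. x \<bullet> (- v) - (- m)) = 0" .
    show "- m - b1 \<le> x \<bullet> (- v)" if "x \<in> P1" for x using ran1[OF that] by simp
  qed
  have lt: "a1 < a2" "b1 < b2"
    using st s1(1) s2(1) t1(1) t2(1) by (auto simp: a1_def a2_def b1_def b2_def frac_less2)
  define k where "k = kappa DIM('a)"
  define d where "d = real DIM('a)"
  have d: "2 \<le> d" using d2 by (simp add: d_def)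
  have k2: "k\<^sup>2 = 6 / ((d + 1) * (d + 2))" using d by (simp add: k_def kappa_def d_def)
  have "0 < k" using d by (simp add: k_def kappa_def d_def)
  moreover have "k < 1"
  proof -
    have "3 * 4 \<le> (d + 1) * (d + 2)" using d by (intro mult_mono) auto
    then have "k\<^sup>2 < 1\<^sup>2" unfolding k2 by (simp add: divide_less_eq)
    then show ?thesis by (rule power2_less_imp_less) simp
  qed
  ultimately have k: "0 < k" "k < 1" by auto
  define R where "R = (t2 + s1) * (s2 + t1) / ((t1 - t2) * (s1 - s2))"
  have R: "0 < R" using st s1(1) s2(1) t1(1) t2(1) by (auto simp: R_def)
  have "1/2 * ln R \<le> hilbert_diam L1 L2"
    unfolding R_def using hilbert_diam_ge_on_line[OF L1(1) L2(1) sub \<open>v \<noteq> 0\<close> s2(1) st(1) t2(1) st(2) mem fr] .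
  then have "ln R < 2 * ln ((1 + k) / (1 - k))" using hil unfolding k_def by linarith
  also have "\<dots> = ln (((1 + k) / (1 - k))\<^sup>2)" using k by (simp add: ln_realpow)
  finally have "R < ((1 + k) / (1 - k))\<^sup>2" using R k by (subst (asm) ln_less_cancel_iff) auto
  moreover have "R * ((a2 - a1) * (b2 - b1)) = (a1 + b2) * (b1 + a2)"
    using st s1(1) s2(1) t1(1) t2(1) by (simp add: R_def a1_def a2_def b1_def b2_def divide_simps) algebra
  moreover have "0 < (a2 - a1) * (b2 - b1)" using lt by simp
  ultimately have "(a1 + b2) * (b1 + a2) < ((1 + k) / (1 - k))\<^sup>2 * ((a2 - a1) * (b2 - b1))"
    by (metis mult_strict_right_mono)
  then have prod: "a1 * b1 < k\<^sup>2 * (a2 * b2)"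
    by (rule product_lt_of_cross_ratio_lt[OF \<open>0 \<le> a1\<close> lt(1) \<open>0 \<le> b1\<close> lt(2) k])
  have "(LINT x:P1|lborel. (x \<bullet> v - m)\<^sup>2) \<le> a1 * b1 / 3 * measure lborel P1"
    by (rule convex_second_moment_le[OF P(1,3) \<open>0 \<le> a1\<close> \<open>0 \<le> b1\<close> ran1 mean(1)])
  then have "polar_variance L1 v y m \<le> a1 * b1 / 3"
    using P(5) by (simp add: polar_variance_def P1_def divide_le_eq)
  also have "\<dots> < 2 * a2 * b2 / ((d + 1) * (d + 2))"
    using prod unfolding k2 by simp
  also have "2 * a2 * b2 / ((d + 1) * (d + 2)) * measure lborel P2 \<le> (LINT x:P2|lborel. (x \<bullet> v - m)\<^sup>2)"
    unfolding d_def by (rule convex_second_moment_ge[OF P(2,4,6) d2 t2(3) pq(1) s2(3) pq(2) ran2 mean(2)])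
  then have "2 * a2 * b2 / ((d + 1) * (d + 2)) \<le> polar_variance L2 v y m"
    using P(6) by (simp add: polar_variance_def P2_def le_divide_eq)
  finally show ?thesis .
qed

text \<open>The difference of the two logarithmic slopes along the segment from \<open>y\<close> to \<open>y'\<close> vanishes at both
ends. At each of its zeros the two polar bodies have the same mean in direction \<open>v\<close>, so the
comparison of the variances makes its derivative negative there.\<close>

theorem santalo_point_unique:
  fixes L1 L2 :: "'a::euclidean_space set"
  assumes L1: "compact L1" "convex L1" and L2: "compact L2" "convex L2"
    and sub: "L2 \<subseteq> interior L1" and d2: "2 \<le> DIM('a)"
    and hil: "hilbert_diam L1 L2 < ln ((1 + kappa DIM('a)) / (1 - kappa DIM('a)))"
    and y: "santalo_point L1 L2 y" and y': "santalo_point L1 L2 y'"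
  shows "y = y'"
proof (rule ccontr)
  assume "y \<noteq> y'"
  define v where "v = y' - y"
  have "v \<noteq> 0" using \<open>y \<noteq> y'\<close> by (simp add: v_def)
  have int: "y \<in> interior L2" "y' \<in> interior L2" using y y' by (auto simp: santalo_point_def)
  have seg: "y + t *\<^sub>R v \<in> interior L2" if "0 \<le> t" "t \<le> 1" for t
    using convexD_alt[OF convex_interior[OF L2(2)] int that] by (simp add: v_def algebra_simps)
  have seg1: "y + t *\<^sub>R v \<in> interior L1" if "0 \<le> t" "t \<le> 1" for t
    using seg[OF that] sub interior_subset by blast
  define d where "d = real DIM('a)"
  define f where "f t = log_slope L2 v (y + t *\<^sub>R v) - log_slope L1 v (y + t *\<^sub>R v)" for t
  define D where "D L w = - ((d + 1) * (d + 2)) * polar_variance L v w (log_slope L v w / (d + 1)) - (log_slope L v w)\<^sup>2 / (d + 1)" for L w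
  show False
  proof (rule no_two_zeros_if_decreasing_at_zeros)
    fix t :: real assume t: "0 \<le> t" "t \<le> 1"
    show "(f has_real_derivative (D L2 (y + t *\<^sub>R v) - D L1 (y + t *\<^sub>R v))) (at t)"
      unfolding f_def D_def d_def
      by (intro DERIV_diff polar_body_mean_and_slope_derivative(2) L1 L2 seg seg1 t)
    assume "f t = 0"
    define w where "w = y + t *\<^sub>R v"
    define m where "m = log_slope L1 v w / (d + 1)"
    have eq: "log_slope L2 v w = log_slope L1 v w" using \<open>f t = 0\<close> by (simp add: f_def w_def)
    have "polar_variance L1 v w m < polar_variance L2 v w m"
    proof (rule polar_variance_less[OF L1 L2 sub d2 hil])
      show "w \<in> interior L2" using seg[OF t] by (simp add: w_def)
      show "(LINT x:polar_body L1 w|lborel. x \<bullet> v - m) = 0"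
        using polar_body_mean_and_slope_derivative(1)[OF L1(1) seg1[OF t]] by (simp add: m_def d_def w_def)
      show "(LINT x:polar_body L2 w|lborel. x \<bullet> v - m) = 0"
        using polar_body_mean_and_slope_derivative(1)[OF L2(1) seg[OF t]] eq by (simp add: m_def d_def w_def)
    qed fact
    then have "(d + 1) * (d + 2) * polar_variance L1 v w m < (d + 1) * (d + 2) * polar_variance L2 v w m"
      by (intro mult_strict_left_mono) (auto simp: d_def)
    then show "D L2 (y + t *\<^sub>R v) - D L1 (y + t *\<^sub>R v) < 0"
      by (simp add: D_def w_def[symmetric] eq m_def[symmetric])
  next
    have "log_slope L1 v z = log_slope L2 v z" if "santalo_point L1 L2 z" for z
      using santalo_point_iff_log_slope[OF L1(1) L2(1), of z] that by (auto simp: santalo_point_def)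
    from this[OF y] this[OF y'] show "f 0 = 0" "f 1 = 0" by (auto simp: f_def v_def)
  qed
qed

theorem corollary1p5:
  fixes L1 L2 :: "'a::euclidean_space set"
  assumes "convex_body L1" and "convex_body L2" and "L2 \<subseteq> interior L1"
  shows "(\<exists>y. santalo_point L1 L2 y) \<and>
    (DIM('a) \<ge> 2 \<longrightarrow>
     hilbert_diam L1 L2 < ln ((1 + kappa DIM('a)) / (1 - kappa DIM('a))) \<longrightarrow>
     (\<exists>!y. santalo_point L1 L2 y))"
proof -
  have L: "compact L1" "convex L1" "compact L2" "convex L2" "interior L2 \<noteq> {}"
    using assms by (auto simp: convex_body_def)
  have "\<exists>y. santalo_point L1 L2 y" by (rule santalo_point_exists[OF L assms(3)])
  then show ?thesis using santalo_point_unique[OF L(1-4) assms(3)] by blast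
qed

end
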